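(* Let $\pi\colon P\to M$ be a principal $\mathbb{X}$-bundle for a Lie groupoid $\mathbb{X}=[X_1\rightrightarrows X_0]$ and let $(\omega,\mathbb{H})$ be a connection pair on it. Then $$F_0([p,u,v])=[p,\omega_p(u),v],\qquad F_1([p,u,v],g)=([p,\omega_p(u),v],g)$$ defines a (well-defined, smooth) functor $F=(F_0,F_1)\colon\mathcal{A}\mathfrak{t}(P)\to\mathcal{A}\mathfrak{d}(P)$ which is a quasi-connection, i.e. a splitting of the Atiyah sequence of $P\to M$ for $\mathbb{H}$.
   Context: Lie groupoid $\mathbb{X}=[X_1\rightrightarrows X_0]$: source $s$, target $t$ are submersions, $gh$ is defined when $s(g)=t(h)$, units $1_x$, inversion $i$. Right action on $P$ with anchor $a\colon P\to X_0$: $pg$ is defined when $a(p)=t(g)$, $a(pg)=s(g)$, $(pg)h=p(gh)$, $p1_{a(p)}=p$; for $(u,\beta)$ tangent to $P\times_{a,X_0,t}X_1$ at $(p,g)$, $u.\beta\in T_{pg}P$ is its image under the differential of the action. Principal $\mathbb{X}$-bundle: a surjective submersion $\pi\colon P\to M$ with a right action, $\pi(pg)=\pi(p)$, and $(p,g)\mapsto(p,pg)$ a diffeomorphism $P\times_{X_0}X_1\to P\times_MP$. Lie algebroid $A\to X_0$: $A_x=\ker(ds)_{1_x}$. $r_g\colon A_{t(g)}\to T_gX_1$ is the differential at $1_{t(g)}$ of $h\mapsto hg$; $l_g\colon A_{s(g)}\to T_gX_1$ is the differential at $1_{s(g)}$ of $h\mapsto gh^{-1}$ on $s^{-1}(s(g))$.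 Ehresmann connection: a subbundle $\mathbb{H}\subset TX_1$ with $TX_1=\mathbb{H}\oplus\ker ds$ and $\mathbb{H}_{1_x}=(d1)_x(T_xX_0)$; $\sigma_g\colon T_{s(g)}X_0\to\mathbb{H}_g$ is the inverse of $ds|_{\mathbb{H}_g}$; $\psi_g\colon T_gX_1\to A_{t(g)}$ satisfies $r_g\psi_g+\sigma_g(ds)_g=\mathrm{Id}$. Put $\lambda^0_g=-\psi_gl_g$ on $A_{s(g)}$, $\lambda^1_g=(dt)_g\sigma_g$ on $T_{s(g)}X_0$. For $a(p)=t(g)$, $\tau_g\colon T_pP\to T_{pg}P$, $\tau_g(u)=u.(di)_{g^{-1}}\sigma_{g^{-1}}(da)_p(u)$. $d\delta_p\colon A_{a(p)}\to T_pP$ is the differential at $1_{a(p)}$ of $h\mapsto ph^{-1}$ on $s^{-1}(a(p))$. Connection pair $(\omega,\mathbb{H})$: $\mathbb{H}$ is an Ehresmann connection and $\omega\colon TP\to P\times_{X_0}A$ is a smooth vector bundle map over $P$ with $\omega_{pg}(\tau_g(u))=\lambda^0_{g^{-1}}(\omega_p(u))$ for $u\in T_pP$, $a(p)=t(g)$, and $\omega_p(d\delta_p(\alpha))=\alpha$ for $\alpha\in A_{a(p)}$. $\mathcal{A}\mathfrak{d}(P)$: on $P\times_{X_0}A\oplus a^*TX_0$ put $(p,\alpha,v)\sim(p,\alpha',v')$ iff $\alpha-\alpha'=\sum_{i=1}^n(\lambda^0_{h_i^{-1}g_i^{-1}}-\lambda^0_{h_i^{-1}}\lambda^0_{g_i^{-1}})(\alpha_i)$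 and $v-v'=\sum_{i=1}^n(\lambda^1_{h_i^{-1}g_i^{-1}}-\lambda^1_{h_i^{-1}}\lambda^1_{g_i^{-1}})(v_i)$ for some $p_i\in P$, $g_i,h_i\in X_1$, $\alpha_i\in A_{a(p_i)}$, $v_i\in T_{a(p_i)}X_0$ with $p=p_ig_ih_i$. Objects: classes $[p,\alpha,v]$; morphisms $([p,\alpha,v],g)$, $a(p)=t(g)$, from $[p,\alpha,v]$ to $[pg,\lambda^0_{g^{-1}}\alpha,\lambda^1_{g^{-1}}v]$; composition multiplies $X_1$-components. $\mathcal{A}\mathfrak{t}(P)$: the same with $TP\oplus a^*TX_0$ and $\tau$: $(p,u,v)\sim(p,u',v')$ iff $u-u'=\sum_i(\tau_{g_ih_i}-\tau_{h_i}\tau_{g_i})(u_i)$, $v-v'=\sum_i(\lambda^1_{h_i^{-1}g_i^{-1}}-\lambda^1_{h_i^{-1}}\lambda^1_{g_i^{-1}})(v_i)$ with $u_i\in T_{p_i}P$, $v_i\in T_{a(p_i)}X_0$, $p=p_ig_ih_i$; $([p,u,v],g)$ has target $[pg,\tau_gu,\lambda^1_{g^{-1}}v]$. Objects carry the quotient diffeology, morphisms the fibre product diffeology. Objects form diffeological graded vector spaces over $P$ (addition and scalars in the components $\alpha$ or $u$, and $v$). Both map to the discrete category $M$ by $\bar\pi$ (object or arrow over $p$ goes to $\pi(p)$). The set $\mathfrak{Conn}(\bar\pi^{-1}(m))$ of isomorphism classes $\langle\cdot\rangle$ in the fibre over $m$ is a graded vector space via $\langle[p,\alpha,v]\rangle+\langle[pg,\beta,v']\rangle=\langle[pg,\lambda^0_{g^{-1}}\alpha+\beta,\lambda^1_{g^{-1}}v+v']\rangle$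 (with $\tau_g$ in place of $\lambda^0_{g^{-1}}$ for $\mathcal{A}\mathfrak{t}(P)$). $\overline{d\delta}\colon\mathcal{A}\mathfrak{d}(P)\to\mathcal{A}\mathfrak{t}(P)$ is $[p,\alpha,v]\mapsto[p,d\delta_p(\alpha),v]$, $([p,\alpha,v],g)\mapsto([p,d\delta_p(\alpha),v],g)$. Quasi-connection: a functor $F=(F_0,F_1)\colon\mathcal{A}\mathfrak{t}(P)\to\mathcal{A}\mathfrak{d}(P)$ over $M$ such that (1) $F\circ\overline{d\delta}=\mathrm{Id}_{\mathcal{A}\mathfrak{d}(P)}$; (2) $F_0$ is a map of diffeological graded vector bundles over $P$; (3) the induced map $\mathfrak{Conn}(\bar\pi^{-1}_{\mathcal{A}\mathfrak{t}(P)}(m))\to\mathfrak{Conn}(\bar\pi^{-1}_{\mathcal{A}\mathfrak{d}(P)}(m))$ is linear for each $m\in M$. *)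

theory Defs
  imports "HOL-Analysis.Analysis" "HOL-Library.Function_Algebras"
begin

section \<open>Smooth functions between open subsets of coordinate spaces\<close>

text \<open>
  The coordinate space of dimension n (n = 0 included) is the library's \<^term>\<open>Euclidean_space n\<close>,
  i.e. the functions from nat to real supported in {..<n}. A real function is smooth if all its
  iterated partial derivatives exist and are continuous.
\<close>

definition partial :: "nat \<Rightarrow> ((nat \<Rightarrow> real) \<Rightarrow> real) \<Rightarrow> (nat \<Rightarrow> real) \<Rightarrow> real" where
  "partial i f x = deriv (\<lambda>r. f (x(i := r))) (x i)"

primrec Ck :: "nat \<Rightarrow> nat \<Rightarrow> (nat \<Rightarrow> real) set \<Rightarrow> ((nat \<Rightarrow> real) \<Rightarrow> real) \<Rightarrow> bool" where
  "Ck 0 n U f \<longleftrightarrow> continuous_on U f"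
| "Ck (Suc k) n U f \<longleftrightarrow> continuous_on U f \<and>
     (\<forall>i<n. (\<forall>x\<in>U. (\<lambda>r. f (x(i := r))) differentiable (at (x i))) \<and> Ck k n U (partial i f))"

definition smooth_Rn :: "nat \<Rightarrow> (nat \<Rightarrow> real) set \<Rightarrow> nat \<Rightarrow> ((nat \<Rightarrow> real) \<Rightarrow> nat \<Rightarrow> real) \<Rightarrow> bool" where
  "smooth_Rn n U m f \<longleftrightarrow> openin (Euclidean_space n) U \<and> f ` U \<subseteq> topspace (Euclidean_space m) \<and>
     (\<forall>j<m. \<forall>k. Ck k n U (\<lambda>x. f x j))"

definition Jac :: "nat \<Rightarrow> nat \<Rightarrow> ((nat \<Rightarrow> real) \<Rightarrow> nat \<Rightarrow> real) \<Rightarrow> (nat \<Rightarrow> real) \<Rightarrow> (nat \<Rightarrow> real) \<Rightarrow> nat \<Rightarrow> real" where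
  "Jac n m f x v = (\<lambda>j. if j < m then \<Sum>i<n. partial i (\<lambda>y. f y j) x * v i else 0)"

definition coord_append :: "nat \<Rightarrow> (nat \<Rightarrow> real) \<Rightarrow> (nat \<Rightarrow> real) \<Rightarrow> nat \<Rightarrow> real" where
  "coord_append n x y = (\<lambda>i. if i < n then x i else y (i - n))"


section \<open>Smooth manifolds\<close>

type_synonym 'a chart = "'a set \<times> ('a \<Rightarrow> nat \<Rightarrow> real)"

record 'a mfd =
  pts :: "'a set"
  mdim :: nat
  atlas :: "'a chart set"

definition chart_inv :: "'a chart \<Rightarrow> (nat \<Rightarrow> real) \<Rightarrow> 'a" where
  "chart_inv c = inv_into (fst c) (snd c)"

definition mtop :: "'a mfd \<Rightarrow> 'a topology" where
  "mtop X = topology (\<lambda>W. W \<subseteq> pts X \<and>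
     (\<forall>c\<in>atlas X. openin (Euclidean_space (mdim X)) (snd c ` (W \<inter> fst c))))"

definition manifold :: "'a mfd \<Rightarrow> bool" where
  "manifold X \<longleftrightarrow>
     (\<Union>c\<in>atlas X. fst c) = pts X \<and>
     (\<forall>c\<in>atlas X. inj_on (snd c) (fst c) \<and> openin (Euclidean_space (mdim X)) (snd c ` fst c)) \<and>
     (\<forall>c\<in>atlas X. \<forall>d\<in>atlas X.
        smooth_Rn (mdim X) (snd c ` (fst c \<inter> fst d)) (mdim X) (snd d \<circ> chart_inv c)) \<and>
     Hausdorff_space (mtop X) \<and>
     (\<exists>\<B>. countable \<B> \<and> (\<forall>V\<in>\<B>. openin (mtop X) V) \<and>
        (\<forall>U x. openin (mtop X) U \<and> x \<in> U \<longrightarrow> (\<exists>V\<in>\<B>. x \<in> V \<and> V \<subseteq> U)))"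

definition smooth_on :: "'a mfd \<Rightarrow> 'a set \<Rightarrow> 'b mfd \<Rightarrow> ('a \<Rightarrow> 'b) \<Rightarrow> bool" where
  "smooth_on X W Y f \<longleftrightarrow> openin (mtop X) W \<and> f ` W \<subseteq> pts Y \<and>
     (\<forall>c\<in>atlas X. \<forall>d\<in>atlas Y.
        smooth_Rn (mdim X) (snd c ` {x \<in> W \<inter> fst c. f x \<in> fst d}) (mdim Y) (snd d \<circ> f \<circ> chart_inv c))"

abbreviation smooth_map :: "'a mfd \<Rightarrow> 'b mfd \<Rightarrow> ('a \<Rightarrow> 'b) \<Rightarrow> bool" where
  "smooth_map X Y f \<equiv> smooth_on X (pts X) Y f"

text \<open>
  A tangent vector at x is given by its coordinates in every chart around x, related by the
  Jacobians of the transition maps; it is set to 0 at all other arguments, so that addition and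
  scalar multiplication are pointwise.
\<close>

type_synonym 'a tvec = "'a chart \<Rightarrow> nat \<Rightarrow> real"

definition tscale :: "real \<Rightarrow> 'a tvec \<Rightarrow> 'a tvec" where
  "tscale r v = (\<lambda>c i. r * v c i)"

definition tangent :: "'a mfd \<Rightarrow> 'a \<Rightarrow> 'a tvec set" where
  "tangent X x = {v.
     (\<forall>c. \<not> (c \<in> atlas X \<and> x \<in> fst c) \<longrightarrow> v c = 0) \<and>
     (\<forall>c\<in>atlas X. x \<in> fst c \<longrightarrow> v c \<in> topspace (Euclidean_space (mdim X))) \<and>
     (\<forall>c\<in>atlas X. \<forall>d\<in>atlas X. x \<in> fst c \<longrightarrow> x \<in> fst d \<longrightarrow>
        v d = Jac (mdim X) (mdim X) (snd d \<circ> chart_inv c) (snd c x) (v c))}"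

definition diff :: "'a mfd \<Rightarrow> 'b mfd \<Rightarrow> ('a \<Rightarrow> 'b) \<Rightarrow> 'a \<Rightarrow> 'a tvec \<Rightarrow> 'b tvec" where
  "diff X Y f x v = (let c = (SOME c. c \<in> atlas X \<and> x \<in> fst c) in
     (\<lambda>d. if d \<in> atlas Y \<and> f x \<in> fst d
          then Jac (mdim X) (mdim Y) (snd d \<circ> f \<circ> chart_inv c) (snd c x) (v c) else 0))"

definition submersion :: "'a mfd \<Rightarrow> 'b mfd \<Rightarrow> ('a \<Rightarrow> 'b) \<Rightarrow> bool" where
  "submersion X Y f \<longleftrightarrow> smooth_map X Y f \<and> (\<forall>x\<in>pts X. diff X Y f x ` tangent X x = tangent Y (f x))"

definition prod_mfd :: "'a mfd \<Rightarrow> 'b mfd \<Rightarrow> ('a \<times> 'b) mfd" where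
  "prod_mfd X Y = \<lparr>pts = pts X \<times> pts Y, mdim = mdim X + mdim Y,
     atlas = {(fst c \<times> fst d, \<lambda>(x, y). coord_append (mdim X) (snd c x) (snd d y)) |c d.
               c \<in> atlas X \<and> d \<in> atlas Y}\<rparr>"

definition tangent_bundle :: "'a mfd \<Rightarrow> ('a \<times> 'a tvec) mfd" where
  "tangent_bundle X = \<lparr>pts = Sigma (pts X) (tangent X), mdim = mdim X + mdim X,
     atlas = {(Sigma (fst c) (tangent X), \<lambda>(x, v). coord_append (mdim X) (snd c x) (v c)) |c.
               c \<in> atlas X}\<rparr>"

text \<open>The vector with components u and w under the identification of the tangent space of a
  product with the product of the tangent spaces.\<close>

definition tpair :: "'a mfd \<Rightarrow> 'b mfd \<Rightarrow> 'a \<Rightarrow> 'b \<Rightarrow> 'a tvec \<Rightarrow> 'b tvec \<Rightarrow> ('a \<times> 'b) tvec" where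
  "tpair X Y x y u w = (THE z. z \<in> tangent (prod_mfd X Y) (x, y) \<and>
     diff (prod_mfd X Y) X fst (x, y) z = u \<and> diff (prod_mfd X Y) Y snd (x, y) z = w)"

text \<open>
  Fibre products of submersions and fibres of submersions are embedded submanifolds S of an ambient
  manifold X. A map on S is smooth iff it locally extends to a smooth map on X, and its
  differential at x, on vectors tangent to S, is the restriction of that of any such extension
  (on vectors not tangent to S the function below has no meaning and is never used). A map
  into S is smooth iff it is smooth as a map into the ambient manifold.
\<close>

definition smooth_sub :: "'a mfd \<Rightarrow> 'a set \<Rightarrow> 'b mfd \<Rightarrow> ('a \<Rightarrow> 'b) \<Rightarrow> bool" where
  "smooth_sub X S Y f \<longleftrightarrow> S \<subseteq> pts X \<and> f ` S \<subseteq> pts Y \<and>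
     (\<forall>x\<in>S. \<exists>W F. x \<in> W \<and> smooth_on X W Y F \<and> (\<forall>z\<in>S \<inter> W. F z = f z))"

definition diff_sub :: "'a mfd \<Rightarrow> 'a set \<Rightarrow> 'b mfd \<Rightarrow> ('a \<Rightarrow> 'b) \<Rightarrow> 'a \<Rightarrow> 'a tvec \<Rightarrow> 'b tvec" where
  "diff_sub X S Y f x v =
     diff X Y (SOME F. \<exists>W. x \<in> W \<and> smooth_on X W Y F \<and> (\<forall>z\<in>S \<inter> W. F z = f z)) x v"

text \<open>A smooth subbundle of the tangent bundle: locally the span of a smooth frame.\<close>

definition smooth_subbundle :: "'a mfd \<Rightarrow> ('a \<Rightarrow> 'a tvec set) \<Rightarrow> bool" where
  "smooth_subbundle X H \<longleftrightarrow> (\<exists>k. \<forall>x\<in>pts X. \<exists>W Y. x \<in> W \<and> openin (mtop X) W \<and>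
     (\<forall>i<k. (\<forall>y\<in>W. Y i y \<in> tangent X y) \<and> smooth_on X W (tangent_bundle X) (\<lambda>y. (y, Y i y))) \<and>
     (\<forall>y\<in>W. bij_betw (\<lambda>r. \<Sum>i<k. tscale (r i) (Y i y)) (topspace (Euclidean_space k)) (H y)))"


section \<open>Lie groupoids and principal bundles\<close>

record ('a, 'b) groupoid =
  X0 :: "'a mfd"
  X1 :: "'b mfd"
  gsrc :: "'b \<Rightarrow> 'a"
  gtgt :: "'b \<Rightarrow> 'a"
  gunit :: "'a \<Rightarrow> 'b"
  ginv :: "'b \<Rightarrow> 'b"
  gmult :: "'b \<Rightarrow> 'b \<Rightarrow> 'b"

definition lie_groupoid :: "('a, 'b) groupoid \<Rightarrow> bool" where
  "lie_groupoid G \<longleftrightarrow>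
     manifold (X0 G) \<and> manifold (X1 G) \<and>
     submersion (X1 G) (X0 G) (gsrc G) \<and> submersion (X1 G) (X0 G) (gtgt G) \<and>
     smooth_map (X0 G) (X1 G) (gunit G) \<and> smooth_map (X1 G) (X1 G) (ginv G) \<and>
     smooth_sub (prod_mfd (X1 G) (X1 G))
       {(g, h). g \<in> pts (X1 G) \<and> h \<in> pts (X1 G) \<and> gsrc G g = gtgt G h}
       (X1 G) (\<lambda>(g, h). gmult G g h) \<and>
     (\<forall>g\<in>pts (X1 G). \<forall>h\<in>pts (X1 G). gsrc G g = gtgt G h \<longrightarrow>
        gsrc G (gmult G g h) = gsrc G h \<and> gtgt G (gmult G g h) = gtgt G g) \<and>
     (\<forall>g\<in>pts (X1 G). \<forall>h\<in>pts (X1 G). \<forall>k\<in>pts (X1 G). gsrc G g = gtgt G h \<longrightarrow> gsrc G h = gtgt G k \<longrightarrow>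
        gmult G (gmult G g h) k = gmult G g (gmult G h k)) \<and>
     (\<forall>x\<in>pts (X0 G). gsrc G (gunit G x) = x \<and> gtgt G (gunit G x) = x) \<and>
     (\<forall>g\<in>pts (X1 G). gmult G (gunit G (gtgt G g)) g = g \<and> gmult G g (gunit G (gsrc G g)) = g) \<and>
     (\<forall>g\<in>pts (X1 G). gsrc G (ginv G g) = gtgt G g \<and> gtgt G (ginv G g) = gsrc G g \<and>
        gmult G g (ginv G g) = gunit G (gtgt G g) \<and> gmult G (ginv G g) g = gunit G (gsrc G g))"

record ('a, 'b, 'p, 'm) pbundle =
  gpd :: "('a, 'b) groupoid"
  tot :: "'p mfd"
  base :: "'m mfd"
  proj :: "'p \<Rightarrow> 'm"
  anchor :: "'p \<Rightarrow> 'a"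
  act :: "'p \<Rightarrow> 'b \<Rightarrow> 'p"

definition act_dom :: "('a, 'b, 'p, 'm) pbundle \<Rightarrow> ('p \<times> 'b) set" where
  "act_dom B = {(p, g). p \<in> pts (tot B) \<and> g \<in> pts (X1 (gpd B)) \<and> anchor B p = gtgt (gpd B) g}"

definition right_action :: "('a, 'b, 'p, 'm) pbundle \<Rightarrow> bool" where
  "right_action B \<longleftrightarrow> (let G = gpd B in
     smooth_map (tot B) (X0 G) (anchor B) \<and>
     smooth_sub (prod_mfd (tot B) (X1 G)) (act_dom B) (tot B) (\<lambda>(p, g). act B p g) \<and>
     (\<forall>(p, g)\<in>act_dom B. anchor B (act B p g) = gsrc G g) \<and>
     (\<forall>(p, g)\<in>act_dom B. \<forall>h\<in>pts (X1 G). gsrc G g = gtgt G h \<longrightarrow>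
        act B (act B p g) h = act B p (gmult G g h)) \<and>
     (\<forall>p\<in>pts (tot B). act B p (gunit G (anchor B p)) = p))"

definition principal_bundle :: "('a, 'b, 'p, 'm) pbundle \<Rightarrow> bool" where
  "principal_bundle B \<longleftrightarrow>
     manifold (tot B) \<and> manifold (base B) \<and>
     submersion (tot B) (base B) (proj B) \<and> proj B ` pts (tot B) = pts (base B) \<and>
     right_action B \<and>
     (\<forall>(p, g)\<in>act_dom B. proj B (act B p g) = proj B p) \<and>
     (let \<Phi> = (\<lambda>(p, g). (p, act B p g));
          S = {(p, q). p \<in> pts (tot B) \<and> q \<in> pts (tot B) \<and> proj B p = proj B q} in
        bij_betw \<Phi> (act_dom B) S \<and>
        smooth_sub (prod_mfd (tot B) (X1 (gpd B))) (act_dom B) (prod_mfd (tot B) (tot B)) \<Phi> \<and>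
        smooth_sub (prod_mfd (tot B) (tot B)) S (prod_mfd (tot B) (X1 (gpd B)))
          (inv_into (act_dom B) \<Phi>))"


section \<open>Connection pairs\<close>

definition alg :: "('a, 'b) groupoid \<Rightarrow> 'a \<Rightarrow> 'b tvec set" where
  "alg G x = {\<alpha> \<in> tangent (X1 G) (gunit G x). diff (X1 G) (X0 G) (gsrc G) (gunit G x) \<alpha> = 0}"

definition src_fibre :: "('a, 'b) groupoid \<Rightarrow> 'a \<Rightarrow> 'b set" where
  "src_fibre G x = {h \<in> pts (X1 G). gsrc G h = x}"

definition rtrans :: "('a, 'b) groupoid \<Rightarrow> 'b \<Rightarrow> 'b tvec \<Rightarrow> 'b tvec" where
  "rtrans G g = diff_sub (X1 G) (src_fibre G (gtgt G g)) (X1 G) (\<lambda>h. gmult G h g) (gunit G (gtgt G g))"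

definition ltrans :: "('a, 'b) groupoid \<Rightarrow> 'b \<Rightarrow> 'b tvec \<Rightarrow> 'b tvec" where
  "ltrans G g = diff_sub (X1 G) (src_fibre G (gsrc G g)) (X1 G) (\<lambda>h. gmult G g (ginv G h)) (gunit G (gsrc G g))"

definition ehresmann :: "('a, 'b) groupoid \<Rightarrow> ('b \<Rightarrow> 'b tvec set) \<Rightarrow> bool" where
  "ehresmann G H \<longleftrightarrow> smooth_subbundle (X1 G) H \<and>
     (\<forall>g\<in>pts (X1 G). H g \<subseteq> tangent (X1 G) g \<and>
        (\<forall>w\<in>tangent (X1 G) g. \<exists>!(a, b). a \<in> H g \<and> b \<in> tangent (X1 G) g \<and>
           diff (X1 G) (X0 G) (gsrc G) g b = 0 \<and> w = a + b)) \<and>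
     (\<forall>x\<in>pts (X0 G). H (gunit G x) = diff (X0 G) (X1 G) (gunit G) x ` tangent (X0 G) x)"

definition hlift :: "('a, 'b) groupoid \<Rightarrow> ('b \<Rightarrow> 'b tvec set) \<Rightarrow> 'b \<Rightarrow> 'a tvec \<Rightarrow> 'b tvec" where
  "hlift G H g v = (THE w. w \<in> H g \<and> diff (X1 G) (X0 G) (gsrc G) g w = v)"

definition vproj :: "('a, 'b) groupoid \<Rightarrow> ('b \<Rightarrow> 'b tvec set) \<Rightarrow> 'b \<Rightarrow> 'b tvec \<Rightarrow> 'b tvec" where
  "vproj G H g w = (THE \<alpha>. \<alpha> \<in> alg G (gtgt G g) \<and>
     rtrans G g \<alpha> + hlift G H g (diff (X1 G) (X0 G) (gsrc G) g w) = w)"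

definition lam0 :: "('a, 'b) groupoid \<Rightarrow> ('b \<Rightarrow> 'b tvec set) \<Rightarrow> 'b \<Rightarrow> 'b tvec \<Rightarrow> 'b tvec" where
  "lam0 G H g \<alpha> = - vproj G H g (ltrans G g \<alpha>)"

definition lam1 :: "('a, 'b) groupoid \<Rightarrow> ('b \<Rightarrow> 'b tvec set) \<Rightarrow> 'b \<Rightarrow> 'a tvec \<Rightarrow> 'a tvec" where
  "lam1 G H g v = diff (X1 G) (X0 G) (gtgt G) g (hlift G H g v)"

definition act_diff :: "('a, 'b, 'p, 'm) pbundle \<Rightarrow> 'p \<Rightarrow> 'b \<Rightarrow> 'p tvec \<Rightarrow> 'b tvec \<Rightarrow> 'p tvec" where
  "act_diff B p g u \<beta> = diff_sub (prod_mfd (tot B) (X1 (gpd B))) (act_dom B) (tot B)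
     (\<lambda>(p, g). act B p g) (p, g) (tpair (tot B) (X1 (gpd B)) p g u \<beta>)"

definition tau :: "('a, 'b, 'p, 'm) pbundle \<Rightarrow> ('b \<Rightarrow> 'b tvec set) \<Rightarrow> 'p \<Rightarrow> 'b \<Rightarrow> 'p tvec \<Rightarrow> 'p tvec" where
  "tau B H p g u = (let G = gpd B in
     act_diff B p g u (diff (X1 G) (X1 G) (ginv G) (ginv G g)
       (hlift G H (ginv G g) (diff (tot B) (X0 G) (anchor B) p u))))"

definition ddelta :: "('a, 'b, 'p, 'm) pbundle \<Rightarrow> 'p \<Rightarrow> 'b tvec \<Rightarrow> 'p tvec" where
  "ddelta B p = diff_sub (X1 (gpd B)) (src_fibre (gpd B) (anchor B p)) (tot B)
     (\<lambda>h. act B p (ginv (gpd B) h)) (gunit (gpd B) (anchor B p))"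

text \<open>The Lie algebroid is an embedded submanifold of the tangent bundle of the arrow manifold
  (a point is a unit together with a vector there), which gives the smoothness of \<open>\<omega>\<close>.\<close>

definition connection_pair ::
  "('a, 'b, 'p, 'm) pbundle \<Rightarrow> ('p \<Rightarrow> 'p tvec \<Rightarrow> 'b tvec) \<Rightarrow> ('b \<Rightarrow> 'b tvec set) \<Rightarrow> bool" where
  "connection_pair B \<omega> H \<longleftrightarrow> (let G = gpd B in
     ehresmann G H \<and>
     (\<forall>p\<in>pts (tot B). \<forall>u\<in>tangent (tot B) p. \<omega> p u \<in> alg G (anchor B p)) \<and>
     (\<forall>p\<in>pts (tot B). \<forall>u\<in>tangent (tot B) p. \<forall>u'\<in>tangent (tot B) p. \<omega> p (u + u') = \<omega> p u + \<omega> p u') \<and>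
     (\<forall>p\<in>pts (tot B). \<forall>u\<in>tangent (tot B) p. \<forall>r. \<omega> p (tscale r u) = tscale r (\<omega> p u)) \<and>
     smooth_map (tangent_bundle (tot B)) (tangent_bundle (X1 G))
       (\<lambda>(p, u). (gunit G (anchor B p), \<omega> p u)) \<and>
     (\<forall>(p, g)\<in>act_dom B. \<forall>u\<in>tangent (tot B) p.
        \<omega> (act B p g) (tau B H p g u) = lam0 G H (ginv G g) (\<omega> p u)) \<and>
     (\<forall>p\<in>pts (tot B). \<forall>\<alpha>\<in>alg G (anchor B p). \<omega> p (ddelta B p \<alpha>) = \<alpha>))"


section \<open>Diffeologies and categories\<close>

text \<open>A diffeology is given by its plots: \<open>D n U f\<close> says that f, on the open subset U of
  n-dimensional coordinate space, is a plot.\<close>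

type_synonym 'a diffeology = "nat \<Rightarrow> (nat \<Rightarrow> real) set \<Rightarrow> ((nat \<Rightarrow> real) \<Rightarrow> 'a) \<Rightarrow> bool"

definition dsmooth :: "'a diffeology \<Rightarrow> 'b diffeology \<Rightarrow> ('a \<Rightarrow> 'b) \<Rightarrow> bool" where
  "dsmooth D E f \<longleftrightarrow> (\<forall>n U \<phi>. D n U \<phi> \<longrightarrow> E n U (f \<circ> \<phi>))"

definition mfd_plot :: "'a mfd \<Rightarrow> 'a diffeology" where
  "mfd_plot X n U f \<longleftrightarrow> openin (Euclidean_space n) U \<and> f ` U \<subseteq> pts X \<and>
     (\<forall>c\<in>atlas X. smooth_Rn n {x \<in> U. f x \<in> fst c} (mdim X) (snd c \<circ> f))"

definition quot_plot :: "'a diffeology \<Rightarrow> ('a \<Rightarrow> 'b) \<Rightarrow> 'b diffeology" where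
  "quot_plot D q n U f \<longleftrightarrow> openin (Euclidean_space n) U \<and>
     (\<forall>x\<in>U. \<exists>V g. x \<in> V \<and> V \<subseteq> U \<and> D n V g \<and> (\<forall>y\<in>V. f y = q (g y)))"

record ('o, 'r) dcat =
  Obj :: "'o set"
  Arr :: "'r set"
  Dom :: "'r \<Rightarrow> 'o"
  Cod :: "'r \<Rightarrow> 'o"
  Idn :: "'o \<Rightarrow> 'r"
  Cmp :: "'r \<Rightarrow> 'r \<Rightarrow> 'r"   (* Cmp f' f is defined when Dom f' = Cod f *)
  ObjD :: "'o diffeology"
  ArrD :: "'r diffeology"

definition is_functor ::
  "('o, 'r) dcat \<Rightarrow> ('o2, 'r2) dcat \<Rightarrow> ('o \<Rightarrow> 'o2) \<Rightarrow> ('r \<Rightarrow> 'r2) \<Rightarrow> bool" where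
  "is_functor C D F0 F1 \<longleftrightarrow>
     F0 ` Obj C \<subseteq> Obj D \<and> F1 ` Arr C \<subseteq> Arr D \<and>
     (\<forall>f\<in>Arr C. Dom D (F1 f) = F0 (Dom C f) \<and> Cod D (F1 f) = F0 (Cod C f)) \<and>
     (\<forall>x\<in>Obj C. F1 (Idn C x) = Idn D (F0 x)) \<and>
     (\<forall>f\<in>Arr C. \<forall>f'\<in>Arr C. Dom C f' = Cod C f \<longrightarrow> F1 (Cmp C f' f) = Cmp D (F1 f') (F1 f))"

definition smooth_functor ::
  "('o, 'r) dcat \<Rightarrow> ('o2, 'r2) dcat \<Rightarrow> ('o \<Rightarrow> 'o2) \<Rightarrow> ('r \<Rightarrow> 'r2) \<Rightarrow> bool" where
  "smooth_functor C D F0 F1 \<longleftrightarrow>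
     is_functor C D F0 F1 \<and> dsmooth (ObjD C) (ObjD D) F0 \<and> dsmooth (ArrD C) (ArrD D) F1"

definition isomorphic :: "('o, 'r) dcat \<Rightarrow> 'o \<Rightarrow> 'o \<Rightarrow> bool" where
  "isomorphic C x y \<longleftrightarrow> (\<exists>f\<in>Arr C. \<exists>f'\<in>Arr C. Dom C f = x \<and> Cod C f = y \<and> Dom C f' = y \<and> Cod C f' = x \<and>
     Cmp C f' f = Idn C x \<and> Cmp C f f' = Idn C y)"

definition isoclass :: "('o, 'r) dcat \<Rightarrow> 'o \<Rightarrow> 'o set" where
  "isoclass C x = {y \<in> Obj C. isomorphic C x y}"


section \<open>The adjoint and Atiyah groupoids\<close>

text \<open>
  Both groupoids arise in the same way from a vector bundle over P with quasi-action:
  \<open>fib p\<close> is the fibre over p, realised inside the tangent space of the manifold \<open>amb\<close> at the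
  point \<open>pt p\<close> (this fixes the smooth structure), and \<open>tr p g\<close> maps \<open>fib p\<close> to \<open>fib (pg)\<close>.
\<close>

record ('p, 'b, 'q) qbundle =
  amb :: "'q mfd"
  pt :: "'p \<Rightarrow> 'q"
  fib :: "'p \<Rightarrow> 'q tvec set"
  tr :: "'p \<Rightarrow> 'b \<Rightarrow> 'q tvec \<Rightarrow> 'q tvec"

definition Ad_q :: "('a, 'b, 'p, 'm) pbundle \<Rightarrow> ('b \<Rightarrow> 'b tvec set) \<Rightarrow> ('p, 'b, 'b) qbundle" where
  "Ad_q B H = \<lparr>amb = X1 (gpd B), pt = (\<lambda>p. gunit (gpd B) (anchor B p)),
     fib = (\<lambda>p. alg (gpd B) (anchor B p)), tr = (\<lambda>p g. lam0 (gpd B) H (ginv (gpd B) g))\<rparr>"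

definition At_q :: "('a, 'b, 'p, 'm) pbundle \<Rightarrow> ('b \<Rightarrow> 'b tvec set) \<Rightarrow> ('p, 'b, 'p) qbundle" where
  "At_q B H = \<lparr>amb = tot B, pt = (\<lambda>p. p), fib = tangent (tot B), tr = tau B H\<rparr>"

text \<open>The total space of the direct sum with the pullback of the tangent bundle of the object
  manifold, with its diffeology as a submanifold of a product.\<close>

definition qtot :: "('a, 'b, 'p, 'm) pbundle \<Rightarrow> ('p, 'b, 'q) qbundle \<Rightarrow> ('p \<times> 'q tvec \<times> 'a tvec) set" where
  "qtot B Q = {(p, u, v). p \<in> pts (tot B) \<and> u \<in> fib Q p \<and> v \<in> tangent (X0 (gpd B)) (anchor B p)}"

definition qtot_plot :: "('a, 'b, 'p, 'm) pbundle \<Rightarrow> ('p, 'b, 'q) qbundle \<Rightarrow> ('p \<times> 'q tvec \<times> 'a tvec) diffeology" where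
  "qtot_plot B Q n U f \<longleftrightarrow> f ` U \<subseteq> qtot B Q \<and>
     mfd_plot (tot B) n U (\<lambda>x. fst (f x)) \<and>
     mfd_plot (tangent_bundle (amb Q)) n U (\<lambda>x. (pt Q (fst (f x)), fst (snd (f x)))) \<and>
     mfd_plot (tangent_bundle (X0 (gpd B))) n U (\<lambda>x. (anchor B (fst (f x)), snd (snd (f x))))"

text \<open>For \<open>Ad_q\<close> the first summand is \<open>\<lambda>\<^sup>0\<close> at \<open>(g h)\<^sup>-\<^sup>1 = h\<^sup>-\<^sup>1 g\<^sup>-\<^sup>1\<close>.\<close>

definition qrel :: "('a, 'b, 'p, 'm) pbundle \<Rightarrow> ('b \<Rightarrow> 'b tvec set) \<Rightarrow> ('p, 'b, 'q) qbundle \<Rightarrow>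
    ('p \<times> 'q tvec \<times> 'a tvec) \<Rightarrow> ('p \<times> 'q tvec \<times> 'a tvec) \<Rightarrow> bool" where
  "qrel B H Q z z' \<longleftrightarrow> (case z of (p, u, v) \<Rightarrow> case z' of (p', u', v') \<Rightarrow>
     let G = gpd B in
     p' = p \<and> (\<exists>n ps gs hs us vs.
       (\<forall>i<n::nat. (ps i, gs i) \<in> act_dom B \<and> hs i \<in> pts (X1 G) \<and> gsrc G (gs i) = gtgt G (hs i) \<and>
          us i \<in> fib Q (ps i) \<and> vs i \<in> tangent (X0 G) (anchor B (ps i)) \<and>
          p = act B (act B (ps i) (gs i)) (hs i)) \<and>
       u - u' = (\<Sum>i<n. tr Q (ps i) (gmult G (gs i) (hs i)) (us i)
                          - tr Q (act B (ps i) (gs i)) (hs i) (tr Q (ps i) (gs i) (us i))) \<and>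
       v - v' = (\<Sum>i<n. lam1 G H (gmult G (ginv G (hs i)) (ginv G (gs i))) (vs i)
                          - lam1 G H (ginv G (hs i)) (lam1 G H (ginv G (gs i)) (vs i)))))"

type_synonym ('a, 'p, 'q) qobj = "('p \<times> 'q tvec \<times> 'a tvec) set"

definition qcls :: "('a, 'b, 'p, 'm) pbundle \<Rightarrow> ('b \<Rightarrow> 'b tvec set) \<Rightarrow> ('p, 'b, 'q) qbundle \<Rightarrow>
    ('p \<times> 'q tvec \<times> 'a tvec) \<Rightarrow> ('a, 'p, 'q) qobj" where
  "qcls B H Q z = {z' \<in> qtot B Q. qrel B H Q z z'}"

text \<open>Operations on classes are computed on a chosen representative; in the situations considered
  they do not depend on the choice.\<close>

definition rep :: "('a, 'p, 'q) qobj \<Rightarrow> 'p \<times> 'q tvec \<times> 'a tvec" where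
  "rep C = (SOME z. z \<in> C)"

definition bpt :: "('a, 'p, 'q) qobj \<Rightarrow> 'p" where
  "bpt C = fst (rep C)"

definition qobjs :: "('a, 'b, 'p, 'm) pbundle \<Rightarrow> ('b \<Rightarrow> 'b tvec set) \<Rightarrow> ('p, 'b, 'q) qbundle \<Rightarrow> ('a, 'p, 'q) qobj set" where
  "qobjs B H Q = qcls B H Q ` qtot B Q"

definition qarrs :: "('a, 'b, 'p, 'm) pbundle \<Rightarrow> ('b \<Rightarrow> 'b tvec set) \<Rightarrow> ('p, 'b, 'q) qbundle \<Rightarrow> (('a, 'p, 'q) qobj \<times> 'b) set" where
  "qarrs B H Q = {(C, g). C \<in> qobjs B H Q \<and> (bpt C, g) \<in> act_dom B}"

definition qcod :: "('a, 'b, 'p, 'm) pbundle \<Rightarrow> ('b \<Rightarrow> 'b tvec set) \<Rightarrow> ('p, 'b, 'q) qbundle \<Rightarrow>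
    ('a, 'p, 'q) qobj \<times> 'b \<Rightarrow> ('a, 'p, 'q) qobj" where
  "qcod B H Q = (\<lambda>(C, g). case rep C of (p, u, v) \<Rightarrow>
     qcls B H Q (act B p g, tr Q p g u, lam1 (gpd B) H (ginv (gpd B) g) v))"

definition qcat :: "('a, 'b, 'p, 'm) pbundle \<Rightarrow> ('b \<Rightarrow> 'b tvec set) \<Rightarrow> ('p, 'b, 'q) qbundle \<Rightarrow>
    (('a, 'p, 'q) qobj, ('a, 'p, 'q) qobj \<times> 'b) dcat" where
  "qcat B H Q = (let OD = quot_plot (qtot_plot B Q) (qcls B H Q) in
    \<lparr>Obj = qobjs B H Q,
     Arr = qarrs B H Q,
     Dom = fst,
     Cod = qcod B H Q,
     Idn = (\<lambda>C. (C, gunit (gpd B) (anchor B (bpt C)))),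
     Cmp = (\<lambda>f' f. (fst f, gmult (gpd B) (snd f) (snd f'))),
     ObjD = OD,
     ArrD = (\<lambda>n U f. f ` U \<subseteq> qarrs B H Q \<and>
              OD n U (\<lambda>x. fst (f x)) \<and> mfd_plot (X1 (gpd B)) n U (\<lambda>x. snd (f x)))\<rparr>)"

definition Ad_gpd where "Ad_gpd B H = qcat B H (Ad_q B H)"

definition At_gpd where "At_gpd B H = qcat B H (At_q B H)"

text \<open>The graded vector space structure on the objects over a point of P.\<close>

definition qadd :: "('a, 'b, 'p, 'm) pbundle \<Rightarrow> ('b \<Rightarrow> 'b tvec set) \<Rightarrow> ('p, 'b, 'q) qbundle \<Rightarrow>
    ('a, 'p, 'q) qobj \<Rightarrow> ('a, 'p, 'q) qobj \<Rightarrow> ('a, 'p, 'q) qobj" where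
  "qadd B H Q C C' = (case rep C of (p, u, v) \<Rightarrow> case rep C' of (p', u', v') \<Rightarrow>
     qcls B H Q (p, u + u', v + v'))"

definition qscale :: "('a, 'b, 'p, 'm) pbundle \<Rightarrow> ('b \<Rightarrow> 'b tvec set) \<Rightarrow> ('p, 'b, 'q) qbundle \<Rightarrow>
    real \<Rightarrow> ('a, 'p, 'q) qobj \<Rightarrow> ('a, 'p, 'q) qobj" where
  "qscale B H Q r C = (case rep C of (p, u, v) \<Rightarrow> qcls B H Q (p, tscale r u, tscale r v))"

definition qgrade_fst :: "('a, 'b, 'p, 'm) pbundle \<Rightarrow> ('b \<Rightarrow> 'b tvec set) \<Rightarrow> ('p, 'b, 'q) qbundle \<Rightarrow> 'p \<Rightarrow> ('a, 'p, 'q) qobj set" where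
  "qgrade_fst B H Q p = {qcls B H Q (p, u, 0) |u. u \<in> fib Q p}"

definition qgrade_snd :: "('a, 'b, 'p, 'm) pbundle \<Rightarrow> ('b \<Rightarrow> 'b tvec set) \<Rightarrow> ('p, 'b, 'q) qbundle \<Rightarrow> 'p \<Rightarrow> ('a, 'p, 'q) qobj set" where
  "qgrade_snd B H Q p = {qcls B H Q (p, 0, v) |v. v \<in> tangent (X0 (gpd B)) (anchor B p)}"

definition graded_bundle_map :: "('a, 'b, 'p, 'm) pbundle \<Rightarrow> ('b \<Rightarrow> 'b tvec set) \<Rightarrow>
    ('p, 'b, 'q) qbundle \<Rightarrow> ('p, 'b, 'r) qbundle \<Rightarrow> (('a, 'p, 'q) qobj \<Rightarrow> ('a, 'p, 'r) qobj) \<Rightarrow> bool" where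
  "graded_bundle_map B H Q R F0 \<longleftrightarrow>
     dsmooth (ObjD (qcat B H Q)) (ObjD (qcat B H R)) F0 \<and>
     (\<forall>C\<in>qobjs B H Q. F0 C \<in> qobjs B H R \<and> bpt (F0 C) = bpt C) \<and>
     (\<forall>C\<in>qobjs B H Q. \<forall>C'\<in>qobjs B H Q. bpt C = bpt C' \<longrightarrow>
        F0 (qadd B H Q C C') = qadd B H R (F0 C) (F0 C')) \<and>
     (\<forall>C\<in>qobjs B H Q. \<forall>r. F0 (qscale B H Q r C) = qscale B H R r (F0 C)) \<and>
     (\<forall>p\<in>pts (tot B). F0 ` qgrade_fst B H Q p \<subseteq> qgrade_fst B H R p \<and>
                       F0 ` qgrade_snd B H Q p \<subseteq> qgrade_snd B H R p)"

text \<open>The vector space of isomorphism classes of objects over a point m of M: the sum of the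
  classes of C and C' is the class of \<open>C g + C'\<close>, where g is the arrow (unique, since the bundle
  is principal) carrying the base point of C to that of C'.\<close>

definition qconn :: "('a, 'b, 'p, 'm) pbundle \<Rightarrow> ('b \<Rightarrow> 'b tvec set) \<Rightarrow> ('p, 'b, 'q) qbundle \<Rightarrow> 'm \<Rightarrow> ('a, 'p, 'q) qobj set set" where
  "qconn B H Q m = isoclass (qcat B H Q) ` {C \<in> qobjs B H Q. proj B (bpt C) = m}"

definition conn_add :: "('a, 'b, 'p, 'm) pbundle \<Rightarrow> ('b \<Rightarrow> 'b tvec set) \<Rightarrow> ('p, 'b, 'q) qbundle \<Rightarrow>
    ('a, 'p, 'q) qobj set \<Rightarrow> ('a, 'p, 'q) qobj set \<Rightarrow> ('a, 'p, 'q) qobj set" where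
  "conn_add B H Q K L = (let C = (SOME C. C \<in> K); C' = (SOME C. C \<in> L);
       g = (THE g. (bpt C, g) \<in> act_dom B \<and> act B (bpt C) g = bpt C') in
     isoclass (qcat B H Q) (qadd B H Q (qcod B H Q (C, g)) C'))"

definition conn_scale :: "('a, 'b, 'p, 'm) pbundle \<Rightarrow> ('b \<Rightarrow> 'b tvec set) \<Rightarrow> ('p, 'b, 'q) qbundle \<Rightarrow>
    real \<Rightarrow> ('a, 'p, 'q) qobj set \<Rightarrow> ('a, 'p, 'q) qobj set" where
  "conn_scale B H Q r K = isoclass (qcat B H Q) (qscale B H Q r (SOME C. C \<in> K))"

definition induced :: "('a, 'b, 'p, 'm) pbundle \<Rightarrow> ('b \<Rightarrow> 'b tvec set) \<Rightarrow> ('p, 'b, 'r) qbundle \<Rightarrow>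
    (('a, 'p, 'q) qobj \<Rightarrow> ('a, 'p, 'r) qobj) \<Rightarrow> ('a, 'p, 'q) qobj set \<Rightarrow> ('a, 'p, 'r) qobj set" where
  "induced B H R F0 K = isoclass (qcat B H R) (F0 (SOME C. C \<in> K))"

definition conn_linear :: "('a, 'b, 'p, 'm) pbundle \<Rightarrow> ('b \<Rightarrow> 'b tvec set) \<Rightarrow>
    ('p, 'b, 'q) qbundle \<Rightarrow> ('p, 'b, 'r) qbundle \<Rightarrow> 'm \<Rightarrow>
    (('a, 'p, 'q) qobj set \<Rightarrow> ('a, 'p, 'r) qobj set) \<Rightarrow> bool" where
  "conn_linear B H Q R m T \<longleftrightarrow>
     T ` qconn B H Q m \<subseteq> qconn B H R m \<and>
     (\<forall>K\<in>qconn B H Q m. \<forall>L\<in>qconn B H Q m. T (conn_add B H Q K L) = conn_add B H R (T K) (T L)) \<and>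
     (\<forall>K\<in>qconn B H Q m. \<forall>r. T (conn_scale B H Q r K) = conn_scale B H R r (T K))"


section \<open>Quasi-connections\<close>

definition ddelta_obj :: "('a, 'b, 'p, 'm) pbundle \<Rightarrow> ('b \<Rightarrow> 'b tvec set) \<Rightarrow> ('a, 'p, 'b) qobj \<Rightarrow> ('a, 'p, 'p) qobj" where
  "ddelta_obj B H C = (case rep C of (p, \<alpha>, v) \<Rightarrow> qcls B H (At_q B H) (p, ddelta B p \<alpha>, v))"

definition ddelta_arr :: "('a, 'b, 'p, 'm) pbundle \<Rightarrow> ('b \<Rightarrow> 'b tvec set) \<Rightarrow>
    ('a, 'p, 'b) qobj \<times> 'b \<Rightarrow> ('a, 'p, 'p) qobj \<times> 'b" where
  "ddelta_arr B H = (\<lambda>(C, g). (ddelta_obj B H C, g))"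

definition quasi_connection :: "('a, 'b, 'p, 'm) pbundle \<Rightarrow> ('b \<Rightarrow> 'b tvec set) \<Rightarrow>
    (('a, 'p, 'p) qobj \<Rightarrow> ('a, 'p, 'b) qobj) \<Rightarrow>
    (('a, 'p, 'p) qobj \<times> 'b \<Rightarrow> ('a, 'p, 'b) qobj \<times> 'b) \<Rightarrow> bool" where
  "quasi_connection B H F0 F1 \<longleftrightarrow>
     is_functor (At_gpd B H) (Ad_gpd B H) F0 F1 \<and>
     (\<forall>C\<in>Obj (At_gpd B H). proj B (bpt (F0 C)) = proj B (bpt C)) \<and>
     (\<forall>f\<in>Arr (At_gpd B H). proj B (bpt (fst (F1 f))) = proj B (bpt (fst f))) \<and>
     (\<forall>C\<in>Obj (Ad_gpd B H). F0 (ddelta_obj B H C) = C) \<and>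
     (\<forall>f\<in>Arr (Ad_gpd B H). F1 (ddelta_arr B H f) = f) \<and>
     graded_bundle_map B H (At_q B H) (Ad_q B H) F0 \<and>
     (\<forall>m\<in>pts (base B). conn_linear B H (At_q B H) (Ad_q B H) m (induced B H (Ad_q B H) F0))"

end

theory Submission
  imports Defs
begin

text \<open>
  Why the theorem holds. The map \<open>(u, v) \<mapsto> (\<omega> u, v)\<close> between the fibres of the two bundles is
  linear, and the equivariance of \<open>\<omega>\<close> says that it intertwines the quasi-actions \<open>\<tau>\<close> and
  \<open>\<lambda>\<^sup>0\<close>. Hence it sends the defect of functoriality of \<open>\<tau>\<close> to that of \<open>\<lambda>\<^sup>0\<close> and descends to
  classes (\<open>\<Phi>_N\<close>, \<open>F0_cls\<close>). On classes both quasi-actions are genuine linear actions: the span of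
  the defects is stable under transport, by the cocycle identity \<open>Tr_defect\<close>. Functoriality,
  linearity on the objects and linearity on the isomorphism classes are then formal consequences, and
  \<open>\<omega> d\<delta> = Id\<close> gives the splitting. Smoothness on objects and arrows holds because a plot of the
  quotient lifts locally, and \<open>\<omega>\<close> is smooth on the tangent bundle of the total space (\<open>F0_plot\<close>).

  The formal part, done once for both bundles in the locale \<open>quasi_action\<close>, rests on three facts
  about the transports: they are linear, they map fibre to fibre, and at a unit they are the identity.
  For \<open>\<lambda>\<^sup>1\<close> and \<open>\<tau>\<close> this is the chain rule, together with the unique lifting property of the
  Ehresmann connection; for \<open>\<tau>\<close> at a unit, \<open>q \<mapsto> (q, 1)\<close> stays inside the domain of the action, so
  every extension of the action restricts to the identity along it (\<open>tau_unit\<close>). For \<open>\<lambda>\<^sup>0\<close> there is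
  a shortcut: \<open>\<omega>\<close> is onto with section \<open>d\<delta>\<close>, so equivariance writes \<open>\<lambda>\<^sup>0\<close> as
  \<open>\<omega> \<tau> d\<delta>\<close> and its properties follow from those of \<open>\<tau>\<close> (\<open>lam0_eq\<close>).

  The chain rule itself is proved from the definition of smoothness by iterated partial derivatives:
  continuous partial derivatives give the derivative along differentiable curves
  (\<open>chain_rule_curve\<close>), from which smooth functions are closed under composition (\<open>Ck_comp\<close>).
\<close>

section \<open>Smooth functions of several real variables\<close>

abbreviation Esp :: "nat \<Rightarrow> (nat \<Rightarrow> real) set" where
  "Esp n \<equiv> topspace (Euclidean_space n)"

lemma Esp_iff: "x \<in> Esp n \<longleftrightarrow> (\<forall>i\<ge>n. x i = 0)"
  by (simp add: topspace_Euclidean_space)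

lemma openin_Esp_iff: "openin (Euclidean_space n) U \<longleftrightarrow> (\<exists>T. open T \<and> U = T \<inter> Esp n)"
proof -
  have "openin (powertop_real UNIV) T \<longleftrightarrow> open T" for T
    by (simp add: euclidean_product_topology)
  then show ?thesis
    by (auto simp: Euclidean_space_def openin_subtopology)
qed

lemma openin_Esp_preimage:
  assumes "openin (Euclidean_space n) U" "openin (Euclidean_space m) V"
    and "continuous_on U g" "g ` U \<subseteq> Esp m"
  shows "openin (Euclidean_space n) {x \<in> U. g x \<in> V}"
proof -
  obtain T where T: "open T" "V = T \<inter> Esp m"
    using assms(2) openin_Esp_iff by blast
  obtain S where S: "open S" "U = S \<inter> Esp n"
    using assms(1) openin_Esp_iff by blast
  obtain A where A: "open A" "A \<inter> U = g -` T \<inter> U"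
    using continuous_on_open_invariant[THEN iffD1, OF assms(3)] T(1) by blast
  have "{x \<in> U. g x \<in> V} = (A \<inter> S) \<inter> Esp n"
    using A(2) S(2) T(2) assms(4) by auto
  then show ?thesis
    using A(1) S(1) openin_Esp_iff by blast
qed

lemma fun_tendstoI:
  fixes g :: "'c \<Rightarrow> nat \<Rightarrow> real"
  assumes "\<And>i. ((\<lambda>r. g r i) \<longlongrightarrow> a i) F"
  shows "(g \<longlongrightarrow> a) F"
proof -
  have "limitin (powertop_real UNIV) g a F"
    using assms by (subst limitin_componentwise) simp
  then show ?thesis
    by (simp add: euclidean_product_topology)
qed

lemma eventually_in_openin:
  assumes "openin (Euclidean_space n) U" "a \<in> U" "(g \<longlongrightarrow> a) F" "\<forall>\<^sub>F r in F. g r \<in> Esp n"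
  shows "\<forall>\<^sub>F r in F. g r \<in> U"
proof -
  obtain T where T: "open T" "U = T \<inter> Esp n"
    using assms(1) openin_Esp_iff by blast
  then have "\<forall>\<^sub>F r in F. g r \<in> T"
    using assms(2,3) topological_tendstoD by fastforce
  then show ?thesis
    using assms(4) by eventually_elim (simp add: T)
qed

text \<open>The coordinate box is the convex neighbourhood along whose edges the mean value theorem is
  applied in the chain rule.\<close>

lemma openin_Esp_box:
  assumes "openin (Euclidean_space n) U" "a \<in> U"
  obtains e where "e > 0" "\<And>y. y \<in> Esp n \<Longrightarrow> (\<And>i. i < n \<Longrightarrow> \<bar>y i - a i\<bar> < e) \<Longrightarrow> y \<in> U"
proof -
  have "\<exists>k. \<forall>y\<in>Esp n. (\<forall>i<n. \<bar>y i - a i\<bar> < inverse (real (Suc k))) \<longrightarrow> y \<in> U"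
  proof (rule ccontr)
    assume "\<not> ?thesis"
    then obtain y where y: "\<And>k. y k \<in> Esp n" "\<And>k. y k \<notin> U"
      and close: "\<And>k i. i < n \<Longrightarrow> \<bar>y k i - a i\<bar> < inverse (real (Suc k))"
      by metis
    have aE: "a \<in> Esp n"
      using assms openin_subset by blast
    have "(y \<longlongrightarrow> a) sequentially"
    proof (rule fun_tendstoI)
      fix i
      show "(\<lambda>k. y k i) \<longlonglongrightarrow> a i"
      proof (cases "i < n")
        case True
        have "(\<lambda>k. y k i - a i) \<longlonglongrightarrow> 0"
        proof (rule tendsto_rabs_zero_cancel, rule tendsto_sandwich[OF _ _ tendsto_const LIMSEQ_inverse_real_of_nat])
          show "\<forall>\<^sub>F k in sequentially. 0 \<le> \<bar>y k i - a i\<bar>" by simp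
          show "\<forall>\<^sub>F k in sequentially. \<bar>y k i - a i\<bar> \<le> inverse (real (Suc k))"
            using close[OF True] by (intro always_eventually allI) (simp add: less_imp_le)
        qed
        then show ?thesis by (simp add: LIM_zero_iff)
      next
        case False
        then have "y k i = a i" for k
          using y(1)[of k] aE by (simp add: Esp_iff)
        then show ?thesis by simp
      qed
    qed
    then have "\<forall>\<^sub>F k in sequentially. y k \<in> U"
      by (rule eventually_in_openin[OF assms]) (simp add: y(1))
    then show False using y(2) by simp
  qed
  then obtain k where "\<forall>y\<in>Esp n. (\<forall>i<n. \<bar>y i - a i\<bar> < inverse (real (Suc k))) \<longrightarrow> y \<in> U" ..
  then show ?thesis
    by (intro that[of "inverse (real (Suc k))"]) auto
qed

lemma line_in_Esp: "x \<in> Esp n \<Longrightarrow> i < n \<Longrightarrow> x(i := r) \<in> Esp n"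
  by (simp add: Esp_iff)

lemma line_tendsto: "((\<lambda>r. x(i := r)) \<longlongrightarrow> x(i := s)) (at s)" for x :: "nat \<Rightarrow> real"
  by (rule fun_tendstoI) auto

lemma line_eventually_in:
  assumes "openin (Euclidean_space n) U" "x \<in> U" "i < n"
  shows "\<forall>\<^sub>F r in nhds (x i). x(i := r) \<in> U"
proof -
  have "x \<in> Esp n" using assms openin_subset by blast
  then have "\<forall>\<^sub>F r in at (x i). x(i := r) \<in> U"
    using line_tendsto[of x i "x i"] assms(3)
    by (intro eventually_in_openin[OF assms(1,2)] always_eventually) (simp_all add: line_in_Esp)
  then show ?thesis
    using assms(2) by (simp add: eventually_nhds_conv_at)
qed

lemma partial_cong:
  assumes "openin (Euclidean_space n) U" "x \<in> U" "i < n" "\<And>y. y \<in> U \<Longrightarrow> f y = g y"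
  shows "partial i f x = partial i g x"
  unfolding partial_def
  by (rule deriv_cong_ev[OF eventually_mono[OF line_eventually_in[OF assms(1-3)] assms(4)] refl])

lemma differentiable_cong_ev:
  fixes f g :: "real \<Rightarrow> real"
  assumes "\<forall>\<^sub>F r in nhds s. f r = g r" "f differentiable (at s)"
  shows "g differentiable (at s)"
  using assms DERIV_cong_ev[OF refl assms(1) refl]
  by (metis real_differentiable_def)

lemma partial_DERIV:
  assumes "(\<lambda>r. f (x(i := r))) differentiable (at (x i))"
  shows "((\<lambda>r. f (x(i := r))) has_real_derivative partial i f x) (at (x i))"
  using assms unfolding partial_def by (simp add: DERIV_deriv_iff_real_differentiable)

lemma Ck_Suc_D:
  assumes "Ck (Suc k) n U f" "i < n"
  shows "x \<in> U \<Longrightarrow> ((\<lambda>r. f (x(i := r))) has_real_derivative partial i f x) (at (x i))"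
    and "Ck k n U (partial i f)"
  using assms partial_DERIV by auto

lemma Ck_continuous: "Ck k n U f \<Longrightarrow> continuous_on U f"
  by (cases k) auto

lemma Ck_decrease: "Ck (Suc k) n U f \<Longrightarrow> Ck k n U f"
  by (induction k arbitrary: f) auto

lemma Ck_subset: "Ck k n U f \<Longrightarrow> U' \<subseteq> U \<Longrightarrow> Ck k n U' f"
  by (induction k arbitrary: f) (auto intro: continuous_on_subset)

lemma Ck_cong:
  assumes "openin (Euclidean_space n) U" "\<And>x. x \<in> U \<Longrightarrow> f x = g x" "Ck k n U f"
  shows "Ck k n U g"
  using assms(2,3)
proof (induction k arbitrary: f g)
  case 0
  then show ?case using continuous_on_cong by fastforce
next
  case (Suc k)
  have c: "continuous_on U g"
    using Suc.prems Ck_continuous continuous_on_cong by fastforce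
  have "(\<lambda>r. g (x(i := r))) differentiable (at (x i))" if "i < n" "x \<in> U" for i x
  proof (rule differentiable_cong_ev)
    show "(\<lambda>r. f (x(i := r))) differentiable (at (x i))"
      using Suc.prems that by simp
    show "\<forall>\<^sub>F r in nhds (x i). f (x(i := r)) = g (x(i := r))"
      using line_eventually_in[OF assms(1) that(2,1)] by eventually_elim (rule Suc.prems(1))
  qed
  moreover have "Ck k n U (partial i g)" if i: "i < n" for i
  proof (rule Suc.IH)
    show "partial i f x = partial i g x" if "x \<in> U" for x
      by (rule partial_cong[OF assms(1) that i Suc.prems(1)])
    show "Ck k n U (partial i f)"
      using Suc.prems(2) i by simp
  qed
  ultimately show ?case using c by simp
qed

lemma Ck_local:
  assumes "openin (Euclidean_space n) U"
    and "\<And>x. x \<in> U \<Longrightarrow> \<exists>V. openin (Euclidean_space n) V \<and> x \<in> V \<and> Ck k n V f"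
  shows "Ck k n U f"
  using assms(2)
proof (induction k arbitrary: f)
  case 0
  have "continuous (at x within U) f" if x: "x \<in> U" for x
  proof -
    obtain V where V: "openin (Euclidean_space n) V" "x \<in> V" "continuous_on V f"
      using 0 x by auto
    obtain T where T: "open T" "V = T \<inter> Esp n"
      using V(1) openin_Esp_iff by blast
    have "at x within U = at x within (U \<inter> V)"
      using openin_subset[OF assms(1)] T V(2) by (intro at_within_nhd[of _ T]) auto
    moreover have "continuous (at x within (U \<inter> V)) f"
      using V(2,3) x continuous_on_subset[of V f "U \<inter> V"] continuous_on_eq_continuous_within by blast
    ultimately show ?thesis by simp
  qed
  then show ?case by (simp add: continuous_on_eq_continuous_within)
next
  case (Suc k)
  obtain V where V: "\<And>x. x \<in> U \<Longrightarrow> openin (Euclidean_space n) (V x)" "\<And>x. x \<in> U \<Longrightarrow> x \<in> V x"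
    "\<And>x. x \<in> U \<Longrightarrow> Ck (Suc k) n (V x) f"
    using Suc.prems by metis
  have "Ck k n U f"
    by (rule Suc.IH) (use V(1,2) Ck_decrease[OF V(3)] in blast)
  then have "continuous_on U f"
    by (rule Ck_continuous)
  moreover have "(\<lambda>r. f (x(i := r))) differentiable (at (x i))" if "i < n" "x \<in> U" for i x
    using V(2)[OF that(2)] V(3)[OF that(2)] that(1) by simp
  moreover have "Ck k n U (partial i f)" if "i < n" for i
    by (rule Suc.IH) (use V(1,2) Ck_Suc_D(2)[OF V(3) that] in blast)
  ultimately show ?case by simp
qed

lemma Ck_const: "Ck k n U (\<lambda>x. c)"
proof (induction k arbitrary: c)
  case (Suc k)
  have "partial i (\<lambda>x. c) = (\<lambda>x. 0)" for i
    by (auto simp: partial_def)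
  then show ?case using Suc by simp
qed simp

lemma partial_coord: "partial i (\<lambda>x. x j) = (\<lambda>x. if i = j then 1 else 0)"
  by (auto simp: partial_def)

lemma Ck_coord: "Ck k n U (\<lambda>x. x j)"
proof (cases k)
  case 0
  then show ?thesis
    by (simp add: continuous_on_subset[OF continuous_on_product_coordinates])
next
  case (Suc k')
  have "(\<lambda>r. (x(i := r)) j) differentiable (at (x i))" for i and x :: "nat \<Rightarrow> real"
    by (cases "i = j") auto
  then show ?thesis
    by (simp add: Suc partial_coord Ck_const continuous_on_subset[OF continuous_on_product_coordinates]
          del: fun_upd_apply)
qed

lemma Ck_SucI:
  assumes "openin (Euclidean_space n) U" "continuous_on U f"
    and "\<And>i x. i < n \<Longrightarrow> x \<in> U \<Longrightarrow> ((\<lambda>r. f (x(i := r))) has_real_derivative f' i x) (at (x i))"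
    and "\<And>i. i < n \<Longrightarrow> Ck k n U (f' i)"
  shows "Ck (Suc k) n U f"
proof -
  have "Ck k n U (partial i f)" if i: "i < n" for i
  proof (rule Ck_cong[OF assms(1) _ assms(4)[OF i]])
    show "f' i x = partial i f x" if "x \<in> U" for x
      using DERIV_imp_deriv[OF assms(3)[OF i that]] by (simp add: partial_def)
  qed
  moreover have "(\<lambda>r. f (x(i := r))) differentiable (at (x i))" if "i < n" "x \<in> U" for i x
    using assms(3)[OF that] real_differentiable_def by blast
  ultimately show ?thesis using assms(2) by simp
qed

lemma Ck_add:
  assumes U: "openin (Euclidean_space n) U" and "Ck k n U f" "Ck k n U g"
  shows "Ck k n U (\<lambda>x. f x + g x)"
  using assms(2,3)
proof (induction k arbitrary: f g)
  case (Suc k)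
  show ?case
  proof (rule Ck_SucI[OF U])
    show "continuous_on U (\<lambda>x. f x + g x)"
      using Suc.prems by (intro continuous_on_add Ck_continuous)
    show "((\<lambda>r. f (x(i := r)) + g (x(i := r))) has_real_derivative partial i f x + partial i g x) (at (x i))"
      if "i < n" "x \<in> U" for i x
      by (intro DERIV_add Ck_Suc_D(1)[OF Suc.prems(1) that] Ck_Suc_D(1)[OF Suc.prems(2) that])
    show "Ck k n U (\<lambda>x. partial i f x + partial i g x)" if "i < n" for i
      by (intro Suc.IH Ck_Suc_D(2)[OF Suc.prems(1) that] Ck_Suc_D(2)[OF Suc.prems(2) that])
  qed
qed (auto intro: continuous_on_add)

lemma Ck_mult:
  assumes U: "openin (Euclidean_space n) U" and "Ck k n U f" "Ck k n U g"
  shows "Ck k n U (\<lambda>x. f x * g x)"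
  using assms(2,3)
proof (induction k arbitrary: f g)
  case (Suc k)
  show ?case
  proof (rule Ck_SucI[OF U])
    show "continuous_on U (\<lambda>x. f x * g x)"
      using Suc.prems by (intro continuous_on_mult Ck_continuous)
    show "((\<lambda>r. f (x(i := r)) * g (x(i := r))) has_real_derivative partial i f x * g x + partial i g x * f x) (at (x i))"
      if "i < n" "x \<in> U" for i x
      using DERIV_mult[OF Ck_Suc_D(1)[OF Suc.prems(1) that] Ck_Suc_D(1)[OF Suc.prems(2) that]] by (simp del: fun_upd_apply)
    show "Ck k n U (\<lambda>x. partial i f x * g x + partial i g x * f x)" if "i < n" for i
      by (intro Ck_add[OF U] Suc.IH Ck_decrease[OF Suc.prems(1)] Ck_decrease[OF Suc.prems(2)]
          Ck_Suc_D(2)[OF Suc.prems(1) that] Ck_Suc_D(2)[OF Suc.prems(2) that])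
  qed
qed (auto intro: continuous_on_mult)

lemma Ck_sum:
  assumes U: "openin (Euclidean_space n) U" and "\<And>j. j < m \<Longrightarrow> Ck k n U (f j)"
  shows "Ck k n U (\<lambda>x. \<Sum>j<m::nat. f j x)"
  using assms(2)
proof (induction m)
  case (Suc m)
  then show ?case using Ck_add[OF U, of k "\<lambda>x. \<Sum>j<m. f j x" "f m"] by simp
qed (simp add: Ck_const)

text \<open>One step of the telescoping sum in the chain rule: only the coordinate \<open>j\<close> moves, and the
  mean value theorem expresses the increment of \<open>f\<close> by the partial derivative at an intermediate
  point, which tends to \<open>\<gamma> r0\<close>; continuity of that partial derivative does the rest.\<close>

lemma chain_rule_step:
  fixes \<gamma> :: "real \<Rightarrow> nat \<Rightarrow> real"
  assumes V: "openin (Euclidean_space m) V" and f: "Ck (Suc 0) m V f" and a: "\<gamma> r0 \<in> V" and j: "j < m"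
    and E: "\<forall>\<^sub>F r in at r0. \<gamma> r \<in> Esp m"
    and d: "\<And>i. i < m \<Longrightarrow> ((\<lambda>r. \<gamma> r i) has_real_derivative d i) (at r0)"
  defines "h \<equiv> \<lambda>j r i. if i < j then \<gamma> r i else \<gamma> r0 i"
  shows "((\<lambda>r. f (h (Suc j) r) - f (h j r)) has_real_derivative partial j f (\<gamma> r0) * d j) (at r0)"
proof -
  define a' where "a' = \<gamma> r0"
  have aE: "a' \<in> Esp m" using V a openin_subset a'_def by blast
  obtain e where e: "e > 0" "\<And>y. y \<in> Esp m \<Longrightarrow> (\<And>i. i < m \<Longrightarrow> \<bar>y i - a' i\<bar> < e) \<Longrightarrow> y \<in> V"
    using openin_Esp_box[OF V a] unfolding a'_def by blast
  have lim: "((\<lambda>r. \<gamma> r i) \<longlongrightarrow> a' i) (at r0)" if "i < m" for i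
    using DERIV_isCont[OF d[OF that]] unfolding a'_def isCont_def .
  have "\<forall>\<^sub>F r in at r0. \<forall>i\<in>{..<m}. \<bar>\<gamma> r i - a' i\<bar> < e"
    by (rule eventually_ball_finite) (use tendstoD[OF lim e(1)] in \<open>auto simp: dist_real_def\<close>)
  with E have near: "\<forall>\<^sub>F r in at r0. \<gamma> r \<in> Esp m \<and> (\<forall>i<m. \<bar>\<gamma> r i - a' i\<bar> < e)"
    by eventually_elim auto
  define good where "good = (\<lambda>r. \<gamma> r \<in> Esp m \<and> (\<forall>i<m. \<bar>\<gamma> r i - a' i\<bar> < e))"
  have mv: "\<exists>\<xi>. \<bar>\<xi> - a' j\<bar> \<le> \<bar>\<gamma> r j - a' j\<bar> \<and> (h j r)(j := \<xi>) \<in> V \<and>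
      f (h (Suc j) r) - f (h j r) = partial j f ((h j r)(j := \<xi>)) * (\<gamma> r j - a' j)"
    if r: "good r" for r
  proof -
    have inV: "(h j r)(j := t) \<in> V" if "\<bar>t - a' j\<bar> \<le> \<bar>\<gamma> r j - a' j\<bar>" for t
    proof (rule e(2))
      show "(h j r)(j := t) \<in> Esp m"
        using r aE j by (auto simp: good_def h_def Esp_iff a'_def)
      show "\<bar>((h j r)(j := t)) i - a' i\<bar> < e" if i: "i < m" for i
      proof (cases "i = j")
        case True
        then show ?thesis
          using r i \<open>\<bar>t - a' j\<bar> \<le> _\<close> unfolding good_def by fastforce
      next
        case False
        then show ?thesis
          using r i e(1) by (auto simp: good_def h_def a'_def)
      qed
    qed
    define \<phi> where "\<phi> = (\<lambda>t. f ((h j r)(j := t)))"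
    have der: "(\<phi> has_real_derivative partial j f ((h j r)(j := t))) (at t)"
      if "\<bar>t - a' j\<bar> \<le> \<bar>\<gamma> r j - a' j\<bar>" for t
      using Ck_Suc_D(1)[OF f j inV[OF that]] unfolding \<phi>_def by simp
    have hS: "h (Suc j) r = (h j r)(j := \<gamma> r j)"
      by (auto simp: h_def fun_eq_iff less_Suc_eq)
    have h0: "h j r = (h j r)(j := a' j)"
      by (auto simp: h_def fun_eq_iff a'_def)
    have goal: "\<exists>\<xi>. \<bar>\<xi> - a' j\<bar> \<le> \<bar>\<gamma> r j - a' j\<bar> \<and>
       \<phi> (\<gamma> r j) - \<phi> (a' j) = partial j f ((h j r)(j := \<xi>)) * (\<gamma> r j - a' j)"
    proof (cases "\<gamma> r j" "a' j" rule: linorder_cases)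
      case less
      obtain z where "\<gamma> r j < z" "z < a' j"
        "\<phi> (a' j) - \<phi> (\<gamma> r j) = (a' j - \<gamma> r j) * partial j f ((h j r)(j := z))"
        using MVT2[OF less, of \<phi> "\<lambda>t. partial j f ((h j r)(j := t))"] der by auto
      then show ?thesis
        by (intro exI[of _ z]) (auto simp: algebra_simps)
    next
      case equal
      then show ?thesis by (intro exI[of _ "a' j"]) auto
    next
      case greater
      obtain z where "a' j < z" "z < \<gamma> r j"
        "\<phi> (\<gamma> r j) - \<phi> (a' j) = (\<gamma> r j - a' j) * partial j f ((h j r)(j := z))"
        using MVT2[OF greater, of \<phi> "\<lambda>t. partial j f ((h j r)(j := t))"] der by auto
      then show ?thesis
        by (intro exI[of _ z]) (auto simp: algebra_simps)
    qed
    then show ?thesis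
      using inV hS h0 unfolding \<phi>_def by metis
  qed
  obtain \<xi> where \<xi>: "\<And>r. good r \<Longrightarrow> \<bar>\<xi> r - a' j\<bar> \<le> \<bar>\<gamma> r j - a' j\<bar>"
    "\<And>r. good r \<Longrightarrow> (h j r)(j := \<xi> r) \<in> V"
    "\<And>r. good r \<Longrightarrow> f (h (Suc j) r) - f (h j r) = partial j f ((h j r)(j := \<xi> r)) * (\<gamma> r j - a' j)"
    using mv by metis
  have good: "\<forall>\<^sub>F r in at r0. good r"
    using near unfolding good_def .
  have limz: "((\<lambda>r. (h j r)(j := \<xi> r)) \<longlongrightarrow> a') (at r0)"
  proof (rule fun_tendstoI)
    fix i
    show "((\<lambda>r. ((h j r)(j := \<xi> r)) i) \<longlongrightarrow> a' i) (at r0)"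
    proof (cases "i = j")
      case True
      have "((\<lambda>r. \<bar>\<gamma> r j - a' j\<bar>) \<longlongrightarrow> 0) (at r0)"
        using lim[OF j] by (simp add: LIM_zero tendsto_rabs_zero)
      then have "((\<lambda>r. \<bar>\<xi> r - a' j\<bar>) \<longlongrightarrow> 0) (at r0)"
        by (rule tendsto_sandwich[OF _ _ tendsto_const, rotated 2])
          (rule always_eventually, simp, rule eventually_mono[OF good \<xi>(1)])
      then show ?thesis
        using True LIM_zero_cancel[OF tendsto_rabs_zero_cancel] by simp
    next
      case False
      then show ?thesis
        using lim[of i] j by (cases "i < j") (auto simp: h_def a'_def)
    qed
  qed
  have pc: "continuous_on V (partial j f)"
    using f j by auto
  have "((\<lambda>r. partial j f ((h j r)(j := \<xi> r))) \<longlongrightarrow> partial j f a') (at r0)"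
    by (rule continuous_on_tendsto_compose[OF pc limz])
      (simp_all add: a a'_def[symmetric] eventually_mono[OF good \<xi>(2)], simp add: a'_def a)
  moreover have "((\<lambda>r. (\<gamma> r j - a' j) / (r - r0)) \<longlongrightarrow> d j) (at r0)"
    using d[OF j] by (simp add: has_field_derivative_iff a'_def)
  ultimately have L: "((\<lambda>r. partial j f ((h j r)(j := \<xi> r)) * ((\<gamma> r j - a' j) / (r - r0)))
      \<longlongrightarrow> partial j f a' * d j) (at r0)"
    by (rule tendsto_mult)
  have h00: "h (Suc j) r0 = h j r0"
    by (auto simp: h_def)
  show ?thesis
    unfolding has_field_derivative_iff a'_def[symmetric]
    by (rule Lim_transform_eventually[OF L]) (use good in \<open>eventually_elim, simp add: \<xi>(3) h00\<close>)
qed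

text \<open>Chain rule along a differentiable curve, by telescoping over the coordinates. Only continuity
  of the partial derivatives of \<open>f\<close> is available, so this is where C1 is turned into total
  differentiability.\<close>

lemma chain_rule_curve:
  fixes \<gamma> :: "real \<Rightarrow> nat \<Rightarrow> real"
  assumes V: "openin (Euclidean_space m) V" and f: "Ck (Suc 0) m V f" and a: "\<gamma> r0 \<in> V"
    and E: "\<forall>\<^sub>F r in at r0. \<gamma> r \<in> Esp m"
    and d: "\<And>i. i < m \<Longrightarrow> ((\<lambda>r. \<gamma> r i) has_real_derivative d i) (at r0)"
  shows "((\<lambda>r. f (\<gamma> r)) has_real_derivative (\<Sum>j<m. partial j f (\<gamma> r0) * d j)) (at r0)"
proof -
  define h where "h = (\<lambda>j r i. if i < j then \<gamma> r i else \<gamma> r0 i)"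
  have D: "((\<lambda>r. \<Sum>j<m. f (h (Suc j) r) - f (h j r)) has_real_derivative
      (\<Sum>j<m. partial j f (\<gamma> r0) * d j)) (at r0)"
    unfolding h_def using chain_rule_step[OF V f a _ E d] by (intro DERIV_sum) auto
  have tel: "(\<Sum>j<m. f (h (Suc j) r) - f (h j r)) = f (h m r) - f (\<gamma> r0)" for r
    using sum_lessThan_telescope[of "\<lambda>j. f (h j r)" m] by (simp add: h_def)
  have aE: "\<gamma> r0 \<in> Esp m" using V a openin_subset by blast
  have "h m r = \<gamma> r" if "\<gamma> r \<in> Esp m" for r
    using that aE by (auto simp: h_def Esp_iff fun_eq_iff)
  then have "\<forall>\<^sub>F r in at r0. f (h m r) - f (\<gamma> r0) = f (\<gamma> r) - f (\<gamma> r0)"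
    by (intro eventually_mono[OF E]) simp
  then have "\<forall>\<^sub>F r in nhds r0. (\<Sum>j<m. f (h (Suc j) r) - f (h j r)) = f (\<gamma> r) - f (\<gamma> r0)"
    unfolding tel by (auto simp: eventually_nhds_conv_at h_def)
  from this D have "((\<lambda>r. f (\<gamma> r) - f (\<gamma> r0)) has_real_derivative (\<Sum>j<m. partial j f (\<gamma> r0) * d j)) (at r0)"
    by (rule DERIV_cong_ev[OF refl _ refl, THEN iffD1])
  from DERIV_add[OF this DERIV_const[of "f (\<gamma> r0)"]] show ?thesis by simp
qed

lemma partial_comp:
  assumes U: "openin (Euclidean_space n) U" and V: "openin (Euclidean_space m) V"
    and g: "g ` U \<subseteq> V" "\<And>j. j < m \<Longrightarrow> Ck (Suc 0) n U (\<lambda>x. g x j)"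
    and f: "Ck (Suc 0) m V f" and x: "x \<in> U" and i: "i < n"
  shows "((\<lambda>r. f (g (x(i := r)))) has_real_derivative
      (\<Sum>j<m. partial j f (g x) * partial i (\<lambda>y. g y j) x)) (at (x i))"
proof -
  have "((\<lambda>r. f ((\<lambda>r. g (x(i := r))) r)) has_real_derivative
      (\<Sum>j<m. partial j f ((\<lambda>r. g (x(i := r))) (x i)) * partial i (\<lambda>y. g y j) x)) (at (x i))"
  proof (rule chain_rule_curve[OF V f])
    show "\<forall>\<^sub>F r in at (x i). g (x(i := r)) \<in> Esp m"
      using eventually_nhds_conv_at[THEN iffD1, OF line_eventually_in[OF U x i], THEN conjunct1]
      by eventually_elim (use g(1) openin_subset[OF V] in blast)
    show "((\<lambda>r. g (x(i := r)) j) has_real_derivative partial i (\<lambda>y. g y j) x) (at (x i))" if "j < m" for j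
      using Ck_Suc_D(1)[OF g(2)[OF that] i x] .
  qed (use g(1) x in auto)
  then show ?thesis by simp
qed

lemma Ck_components_continuous:
  assumes "g ` U \<subseteq> Esp m" "\<And>j. j < m \<Longrightarrow> continuous_on U (\<lambda>x. g x j)"
  shows "continuous_on U g"
proof (rule continuous_on_coordinatewise_then_product)
  fix j
  show "continuous_on U (\<lambda>x. g x j)"
  proof (cases "j < m")
    case False
    then have "g x j = 0" if "x \<in> U" for x
      using assms(1) that by (fastforce simp: Esp_iff)
    then show ?thesis
      by (simp add: continuous_on_cong[of U U _ "\<lambda>x. 0"])
  qed (use assms in auto)
qed

lemma Ck_comp:
  assumes U: "openin (Euclidean_space n) U" and V: "openin (Euclidean_space m) V"
    and gV: "g ` U \<subseteq> V" and g: "\<And>j. j < m \<Longrightarrow> Ck k n U (\<lambda>x. g x j)" and f: "Ck k m V f"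
  shows "Ck k n U (\<lambda>x. f (g x))"
  using g f
proof (induction k arbitrary: f)
  case 0
  have "continuous_on U g"
    by (rule Ck_components_continuous[of _ _ m]) (use 0 gV openin_subset[OF V] in auto)
  then show ?case
    using 0 gV continuous_on_compose2[of V f U g] by simp
next
  case (Suc k)
  have IH: "Ck k n U (\<lambda>x. f' (g x))" if "Ck k m V f'" for f'
    using Suc.IH[OF _ that] Suc.prems(1) Ck_decrease by blast
  have C1: "Ck (Suc 0) m V f" "\<And>j. j < m \<Longrightarrow> Ck (Suc 0) n U (\<lambda>x. g x j)"
    using Suc.prems by (auto dest: Ck_continuous)
  show ?case
  proof (rule Ck_SucI[OF U])
    show "continuous_on U (\<lambda>x. f (g x))"
      by (rule Ck_continuous[OF IH[OF Ck_decrease[OF Suc.prems(2)]]])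
    show "((\<lambda>r. f (g (x(i := r)))) has_real_derivative
        (\<Sum>j<m. partial j f (g x) * partial i (\<lambda>y. g y j) x)) (at (x i))" if "i < n" "x \<in> U" for i x
      by (rule partial_comp[OF U V gV C1(2) C1(1) that(2,1)])
    show "Ck k n U (\<lambda>x. \<Sum>j<m. partial j f (g x) * partial i (\<lambda>y. g y j) x)" if "i < n" for i
      by (intro Ck_sum Ck_mult U IH Ck_Suc_D(2)[OF Suc.prems(2)] Ck_Suc_D(2)[OF Suc.prems(1) that])
  qed
qed

lemma smooth_RnD:
  assumes "smooth_Rn n U m f"
  shows "openin (Euclidean_space n) U" "x \<in> U \<Longrightarrow> f x \<in> Esp m" "j < m \<Longrightarrow> Ck k n U (\<lambda>x. f x j)"
    "continuous_on U f"
proof -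
  show "openin (Euclidean_space n) U" "x \<in> U \<Longrightarrow> f x \<in> Esp m" "j < m \<Longrightarrow> Ck k n U (\<lambda>x. f x j)"
    using assms by (auto simp: smooth_Rn_def)
  show "continuous_on U f"
    by (rule Ck_components_continuous[of _ _ m]) (use assms Ck_continuous in \<open>fastforce simp: smooth_Rn_def\<close>)+
qed

lemma smooth_Rn_cong:
  assumes "smooth_Rn n U m f" "\<And>x. x \<in> U \<Longrightarrow> f x = g x"
  shows "smooth_Rn n U m g"
  unfolding smooth_Rn_def
proof (intro conjI allI impI)
  show "Ck k n U (\<lambda>x. g x j)" if "j < m" for j k
    by (rule Ck_cong[OF smooth_RnD(1)[OF assms(1)] _ smooth_RnD(3)[OF assms(1) that]]) (simp add: assms(2))
  show "g ` U \<subseteq> Esp m"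
    using smooth_RnD(2)[OF assms(1)] assms(2) by (metis image_subsetI)
qed (rule smooth_RnD(1)[OF assms(1)])

lemma smooth_Rn_subset:
  "smooth_Rn n U m f \<Longrightarrow> openin (Euclidean_space n) U' \<Longrightarrow> U' \<subseteq> U \<Longrightarrow> smooth_Rn n U' m f"
  using Ck_subset unfolding smooth_Rn_def by (meson image_mono subset_trans)

lemma smooth_Rn_comp:
  assumes g: "smooth_Rn n U m g" and f: "smooth_Rn m V l f"
  shows "smooth_Rn n {x \<in> U. g x \<in> V} l (f \<circ> g)"
proof -
  have o: "openin (Euclidean_space n) {x \<in> U. g x \<in> V}"
    using openin_Esp_preimage[OF smooth_RnD(1)[OF g] smooth_RnD(1)[OF f] smooth_RnD(4)[OF g]]
      smooth_RnD(2)[OF g] by blast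
  have "Ck k n {x \<in> U. g x \<in> V} (\<lambda>x. f (g x) j)" if j: "j < l" for j k
  proof (rule Ck_comp[OF o smooth_RnD(1)[OF f], where f = "\<lambda>y. f y j" and g = g])
    show "Ck k m V (\<lambda>y. f y j)"
      by (rule smooth_RnD(3)[OF f j])
    show "Ck k n {x \<in> U. g x \<in> V} (\<lambda>x. g x i)" if "i < m" for i
      by (rule Ck_subset[OF smooth_RnD(3)[OF g that]]) blast
  qed auto
  then show ?thesis
    using o smooth_RnD(2)[OF f] by (auto simp: smooth_Rn_def)
qed

lemma smooth_Rn_local:
  assumes "\<And>x. x \<in> U \<Longrightarrow> \<exists>V. x \<in> V \<and> V \<subseteq> U \<and> smooth_Rn n V m f"
  shows "smooth_Rn n U m f"
proof -
  obtain V where V: "\<And>x. x \<in> U \<Longrightarrow> x \<in> V x" "\<And>x. x \<in> U \<Longrightarrow> V x \<subseteq> U"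
    "\<And>x. x \<in> U \<Longrightarrow> smooth_Rn n (V x) m f"
    using assms by metis
  have Vo: "openin (Euclidean_space n) (V x)" if "x \<in> U" for x
    by (rule smooth_RnD(1)[OF V(3)[OF that]])
  have "U = \<Union> (V ` U)"
    using V(1,2) by blast
  then have o: "openin (Euclidean_space n) U"
    using Vo openin_Union[of "V ` U"] by force
  have "Ck k n U (\<lambda>x. f x j)" if j: "j < m" for j k
  proof (rule Ck_local[OF o])
    fix x assume x: "x \<in> U"
    show "\<exists>W. openin (Euclidean_space n) W \<and> x \<in> W \<and> Ck k n W (\<lambda>x. f x j)"
      using Vo[OF x] V(1)[OF x] smooth_RnD(3)[OF V(3)[OF x] j] by (intro exI[of _ "V x"] conjI)
  qed
  moreover have "f ` U \<subseteq> Esp m"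
    by (rule image_subsetI) (rule smooth_RnD(2)[OF V(3) V(1)])
  ultimately show ?thesis
    using o by (simp add: smooth_Rn_def)
qed

lemma smooth_Rn_id: "openin (Euclidean_space n) U \<Longrightarrow> smooth_Rn n U n (\<lambda>x. x)"
  using openin_subset by (auto simp: smooth_Rn_def Ck_coord)

lemma Jac_cong:
  assumes "openin (Euclidean_space n) U" "x \<in> U" "\<And>y. y \<in> U \<Longrightarrow> f y = g y"
  shows "Jac n m f x v = Jac n m g x v"
  using partial_cong[OF assms(1,2), of _ "\<lambda>y. f y j" "\<lambda>y. g y j" for j] assms(3)
  by (auto simp: Jac_def fun_eq_iff intro!: sum.cong)

lemma Jac_in_Esp: "Jac n m f x v \<in> Esp m"
  by (simp add: Jac_def Esp_iff)

lemma Jac_add: "Jac n m f x (v + w) = Jac n m f x v + Jac n m f x w"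
  by (auto simp: Jac_def fun_eq_iff sum.distrib algebra_simps)

lemma Jac_scale: "Jac n m f x (\<lambda>i. r * v i) = (\<lambda>i. r * Jac n m f x v i)"
  by (auto simp: Jac_def fun_eq_iff sum_distrib_left algebra_simps)

lemma Jac_zero [simp]: "Jac n m f x 0 = 0"
  by (auto simp: Jac_def fun_eq_iff)

lemma Jac_const: "Jac n m (\<lambda>x. c) x v = 0"
  by (auto simp: Jac_def partial_def fun_eq_iff)

lemma Jac_coords:
  assumes "v \<in> Esp n" "\<And>j. j < m \<Longrightarrow> \<sigma> j < n"
  shows "Jac n m (\<lambda>x j. if j < m then x (\<sigma> j) else 0) x v = (\<lambda>j. if j < m then v (\<sigma> j) else 0)"
proof -
  have "(\<Sum>i<n. partial i (\<lambda>x. x (\<sigma> j)) x * v i) = v (\<sigma> j)" if "j < m" for j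
    using assms(2)[OF that] sum.delta[of "{..<n}" "\<sigma> j" v]
    by (simp add: partial_coord if_distrib[of "\<lambda>c. c * _"] cong: if_cong)
  then show ?thesis
    by (auto simp: Jac_def fun_eq_iff)
qed

lemma Jac_comp:
  assumes g: "smooth_Rn n U m g" and f: "smooth_Rn m V l f" and x: "x \<in> U" "g x \<in> V"
  shows "Jac n l (f \<circ> g) x v = Jac m l f (g x) (Jac n m g x v)"
proof -
  define W where "W = {x \<in> U. g x \<in> V}"
  have W: "openin (Euclidean_space n) W"
    using smooth_RnD(1)[OF smooth_Rn_comp[OF g f]] W_def by simp
  have C1: "\<And>j. j < m \<Longrightarrow> Ck (Suc 0) n W (\<lambda>x. g x j)"
    by (rule Ck_subset[OF smooth_RnD(3)[OF g]]) (auto simp: W_def)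
  have p: "partial i (\<lambda>y. f (g y) j) x = (\<Sum>k<m. partial k (\<lambda>y. f y j) (g x) * partial i (\<lambda>y. g y k) x)"
    if "i < n" "j < l" for i j
  proof -
    have "((\<lambda>r. f (g (x(i := r))) j) has_real_derivative
        (\<Sum>k<m. partial k (\<lambda>y. f y j) (g x) * partial i (\<lambda>y. g y k) x)) (at (x i))"
      by (rule partial_comp[OF W smooth_RnD(1)[OF f] _ C1 smooth_RnD(3)[OF f that(2)] _ that(1)])
        (use x in \<open>auto simp: W_def\<close>)
    then show ?thesis
      by (simp add: partial_def DERIV_imp_deriv del: fun_upd_apply)
  qed
  have "(\<Sum>i<n. partial i (\<lambda>y. f (g y) j) x * v i) =
      (\<Sum>k<m. partial k (\<lambda>y. f y j) (g x) * (\<Sum>i<n. partial i (\<lambda>y. g y k) x * v i))" if j: "j < l" for j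
  proof -
    have "(\<Sum>i<n. partial i (\<lambda>y. f (g y) j) x * v i) =
        (\<Sum>i<n. \<Sum>k<m. partial k (\<lambda>y. f y j) (g x) * (partial i (\<lambda>y. g y k) x * v i))"
      by (intro sum.cong) (auto simp: p j sum_distrib_right mult.assoc)
    also have "\<dots> = (\<Sum>k<m. \<Sum>i<n. partial k (\<lambda>y. f y j) (g x) * (partial i (\<lambda>y. g y k) x * v i))"
      by (rule sum.swap)
    finally show ?thesis by (simp add: sum_distrib_left)
  qed
  then show ?thesis
    by (auto simp: Jac_def fun_eq_iff)
qed


section \<open>Smooth maps and differentials on manifolds\<close>

text \<open>\<open>smooth_atlas\<close> expresses smoothness of the transition maps by saying that the inverse
  charts are plots; in this form it passes to products by composing and pairing plots. For a smooth
  map out of the tangent bundle the weaker \<open>charted\<close> suffices, since plots are composed with it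
  chart by chart.\<close>

definition charted :: "'a mfd \<Rightarrow> bool" where
  "charted X \<longleftrightarrow> (\<Union>c\<in>atlas X. fst c) = pts X \<and> (\<forall>c\<in>atlas X. inj_on (snd c) (fst c))"

definition smooth_atlas :: "'a mfd \<Rightarrow> bool" where
  "smooth_atlas X \<longleftrightarrow> charted X \<and>
     (\<forall>c\<in>atlas X. mfd_plot X (mdim X) (snd c ` fst c) (chart_inv c))"

lemma smooth_atlas_charted: "smooth_atlas X \<Longrightarrow> charted X"
  by (simp add: smooth_atlas_def)

text \<open>The chart which \<^const>\<open>diff\<close> chooses to read off the components of its argument.\<close>

definition chart_at :: "'a mfd \<Rightarrow> 'a \<Rightarrow> 'a chart" where
  "chart_at X x = (SOME c. c \<in> atlas X \<and> x \<in> fst c)"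

lemma chart_at:
  assumes "charted X" "x \<in> pts X"
  shows "chart_at X x \<in> atlas X" "x \<in> fst (chart_at X x)"
proof -
  have "x \<in> (\<Union>c\<in>atlas X. fst c)"
    using assms by (simp add: charted_def)
  then have "\<exists>c. c \<in> atlas X \<and> x \<in> fst c"
    by blast
  then have "chart_at X x \<in> atlas X \<and> x \<in> fst (chart_at X x)"
    unfolding chart_at_def by (rule someI_ex)
  then show "chart_at X x \<in> atlas X" "x \<in> fst (chart_at X x)" by auto
qed

lemma chart_inv_left:
  assumes "charted X" "c \<in> atlas X" "x \<in> fst c"
  shows "chart_inv c (snd c x) = x"
  using assms by (simp add: charted_def chart_inv_def)

lemma chart_pts: "charted X \<Longrightarrow> c \<in> atlas X \<Longrightarrow> x \<in> fst c \<Longrightarrow> x \<in> pts X"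
  by (auto simp: charted_def)

lemma chart_image_Int:
  assumes "charted X" "c \<in> atlas X" "A \<subseteq> fst c" "B \<subseteq> fst c"
  shows "snd c ` (A \<inter> B) = snd c ` A \<inter> snd c ` B"
  using assms by (intro inj_on_image_Int) (auto simp: charted_def)

lemma openin_mtop:
  assumes X: "charted X"
  shows "openin (mtop X) W \<longleftrightarrow> W \<subseteq> pts X \<and>
     (\<forall>c\<in>atlas X. openin (Euclidean_space (mdim X)) (snd c ` (W \<inter> fst c)))"
proof -
  let ?P = "\<lambda>W. W \<subseteq> pts X \<and> (\<forall>c\<in>atlas X. openin (Euclidean_space (mdim X)) (snd c ` (W \<inter> fst c)))"
  have int: "?P (S \<inter> T)" if S: "?P S" and T: "?P T" for S T
  proof -
    have "snd c ` ((S \<inter> T) \<inter> fst c) = snd c ` (S \<inter> fst c) \<inter> snd c ` (T \<inter> fst c)"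
      if "c \<in> atlas X" for c
    proof -
      have "(S \<inter> T) \<inter> fst c = (S \<inter> fst c) \<inter> (T \<inter> fst c)" by blast
      then show ?thesis using chart_image_Int[OF X that, of "S \<inter> fst c" "T \<inter> fst c"] by simp
    qed
    then show ?thesis
      using S T by (simp add: openin_Int le_infI1)
  qed
  have un: "?P (\<Union>K)" if K: "\<forall>S\<in>K. ?P S" for K
  proof -
    have "snd c ` (\<Union>K \<inter> fst c) = (\<Union>S\<in>K. snd c ` (S \<inter> fst c))" for c :: "'a chart"
      by auto
    then show ?thesis
      using K by (auto intro!: openin_Union)
  qed
  have "istopology ?P"
    unfolding istopology_def using int un by simp
  then show ?thesis
    unfolding mtop_def by (simp add: topology_inverse')
qed

lemma mfd_plotD:
  assumes "mfd_plot X n U \<phi>"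
  shows "openin (Euclidean_space n) U" "x \<in> U \<Longrightarrow> \<phi> x \<in> pts X"
    "c \<in> atlas X \<Longrightarrow> smooth_Rn n {x \<in> U. \<phi> x \<in> fst c} (mdim X) (snd c \<circ> \<phi>)"
  using assms by (auto simp: mfd_plot_def)

lemma mfd_plot_cong:
  assumes "mfd_plot X n U \<phi>" "\<And>x. x \<in> U \<Longrightarrow> \<phi> x = \<psi> x"
  shows "mfd_plot X n U \<psi>"
  unfolding mfd_plot_def
proof (intro conjI ballI)
  show "openin (Euclidean_space n) U" by (rule mfd_plotD(1)[OF assms(1)])
  show "\<psi> ` U \<subseteq> pts X" using mfd_plotD(2)[OF assms(1)] assms(2) by fastforce
  fix c assume c: "c \<in> atlas X"
  have "{x \<in> U. \<psi> x \<in> fst c} = {x \<in> U. \<phi> x \<in> fst c}"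
    using assms(2) by auto
  then show "smooth_Rn n {x \<in> U. \<psi> x \<in> fst c} (mdim X) (snd c \<circ> \<psi>)"
    using smooth_Rn_cong[OF mfd_plotD(3)[OF assms(1) c]] assms(2) by simp
qed

lemma mfd_plot_reparam:
  assumes \<phi>: "mfd_plot X n U \<phi>" and h: "smooth_Rn m V n h" and hU: "h ` V \<subseteq> U"
  shows "mfd_plot X m V (\<phi> \<circ> h)"
  unfolding mfd_plot_def
proof (intro conjI ballI)
  show "openin (Euclidean_space m) V" by (rule smooth_RnD(1)[OF h])
  show "(\<phi> \<circ> h) ` V \<subseteq> pts X" using mfd_plotD(2)[OF \<phi>] hU by auto
  fix c assume c: "c \<in> atlas X"
  have "{x \<in> V. (\<phi> \<circ> h) x \<in> fst c} = {x \<in> V. h x \<in> {x \<in> U. \<phi> x \<in> fst c}}"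
    using hU by auto
  then show "smooth_Rn m {x \<in> V. (\<phi> \<circ> h) x \<in> fst c} (mdim X) (snd c \<circ> (\<phi> \<circ> h))"
    using smooth_Rn_comp[OF h mfd_plotD(3)[OF \<phi> c]] by (simp add: comp_assoc)
qed

lemma mfd_plot_subset:
  assumes "mfd_plot X n U \<phi>" "openin (Euclidean_space n) U'" "U' \<subseteq> U"
  shows "mfd_plot X n U' \<phi>"
  using mfd_plot_reparam[OF assms(1) smooth_Rn_id[OF assms(2)]] assms(3) by (simp add: o_def)

lemma mfd_plot_preimage:
  assumes X: "charted X" and \<phi>: "mfd_plot X n U \<phi>" and W: "openin (mtop X) W"
  shows "openin (Euclidean_space n) {x \<in> U. \<phi> x \<in> W}"
proof -
  let ?S = "\<lambda>c. {x \<in> {x \<in> U. \<phi> x \<in> fst c}. (snd c \<circ> \<phi>) x \<in> snd c ` (W \<inter> fst c)}"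
  have "openin (Euclidean_space n) (?S c)" if c: "c \<in> atlas X" for c
    using W c smooth_RnD[OF mfd_plotD(3)[OF \<phi> c]]
    by (intro openin_Esp_preimage[where m = "mdim X"]) (auto simp: openin_mtop[OF X])
  moreover have "{x \<in> U. \<phi> x \<in> W} = (\<Union>c\<in>atlas X. ?S c)"
  proof (intro equalityI subsetI)
    fix x assume x: "x \<in> {x \<in> U. \<phi> x \<in> W}"
    then obtain c where "c \<in> atlas X" "\<phi> x \<in> fst c"
      using chart_at[OF X mfd_plotD(2)[OF \<phi>]] by blast
    then show "x \<in> (\<Union>c\<in>atlas X. ?S c)" using x by auto
  next
    fix x assume "x \<in> (\<Union>c\<in>atlas X. ?S c)"
    then obtain c w where "c \<in> atlas X" "x \<in> U" "\<phi> x \<in> fst c" "w \<in> W" "w \<in> fst c" "snd c (\<phi> x) = snd c w"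
      by auto
    then have "\<phi> x = w"
      using X by (auto simp: charted_def dest: inj_onD)
    then show "x \<in> {x \<in> U. \<phi> x \<in> W}" using \<open>x \<in> U\<close> \<open>w \<in> W\<close> by simp
  qed
  ultimately show ?thesis by auto
qed

lemma smooth_on_iff_plots:
  assumes X: "charted X"
  shows "smooth_on X W Y f \<longleftrightarrow> openin (mtop X) W \<and> f ` W \<subseteq> pts Y \<and>
     (\<forall>c\<in>atlas X. mfd_plot Y (mdim X) (snd c ` (W \<inter> fst c)) (f \<circ> chart_inv c))"
proof -
  have eq: "snd c ` {x \<in> W \<inter> fst c. f x \<in> fst d} = {z \<in> snd c ` (W \<inter> fst c). (f \<circ> chart_inv c) z \<in> fst d}"
    if "c \<in> atlas X" for c d
    using chart_inv_left[OF X that] by auto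
  have im: "f ` W \<subseteq> pts Y \<Longrightarrow> c \<in> atlas X \<Longrightarrow> (f \<circ> chart_inv c) ` (snd c ` (W \<inter> fst c)) \<subseteq> pts Y" for c
    using chart_inv_left[OF X, of c] by auto
  have "(\<forall>d\<in>atlas Y. smooth_Rn (mdim X) (snd c ` {x \<in> W \<inter> fst c. f x \<in> fst d}) (mdim Y) (snd d \<circ> f \<circ> chart_inv c))
      \<longleftrightarrow> mfd_plot Y (mdim X) (snd c ` (W \<inter> fst c)) (f \<circ> chart_inv c)"
    if "openin (mtop X) W" "f ` W \<subseteq> pts Y" "c \<in> atlas X" for c
    using that im[OF that(2,3)] unfolding eq[OF that(3)]
    by (simp add: mfd_plot_def openin_mtop[OF X] comp_assoc)
  then show ?thesis
    unfolding smooth_on_def by (intro conj_cong refl ball_cong) simp_all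
qed

lemma smooth_onD:
  assumes "smooth_on X W Y f"
  shows "openin (mtop X) W" "x \<in> W \<Longrightarrow> f x \<in> pts Y"
    "c \<in> atlas X \<Longrightarrow> d \<in> atlas Y \<Longrightarrow>
       smooth_Rn (mdim X) (snd c ` {x \<in> W \<inter> fst c. f x \<in> fst d}) (mdim Y) (snd d \<circ> f \<circ> chart_inv c)"
  using assms by (auto simp: smooth_on_def)

text \<open>Smoothness is local in the parameter, so near a given parameter the plot may be read in one
  chart of \<open>X\<close>, where the composite is a composite of coordinate expressions.\<close>

lemma mfd_plot_comp:
  assumes X: "charted X" and \<phi>: "mfd_plot X n U \<phi>" and f: "smooth_on X W Y f" and W: "\<phi> ` U \<subseteq> W"
  shows "mfd_plot Y n U (f \<circ> \<phi>)"
  unfolding mfd_plot_def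
proof (intro conjI ballI)
  show "openin (Euclidean_space n) U" by (rule mfd_plotD(1)[OF \<phi>])
  show "(f \<circ> \<phi>) ` U \<subseteq> pts Y" using smooth_onD(2)[OF f] W by auto
  fix d assume d: "d \<in> atlas Y"
  show "smooth_Rn n {x \<in> U. (f \<circ> \<phi>) x \<in> fst d} (mdim Y) (snd d \<circ> (f \<circ> \<phi>))"
  proof (rule smooth_Rn_local)
    fix x assume x: "x \<in> {x \<in> U. (f \<circ> \<phi>) x \<in> fst d}"
    then obtain c where c: "c \<in> atlas X" "\<phi> x \<in> fst c"
      using chart_at[OF X mfd_plotD(2)[OF \<phi>]] by blast
    define V where "V = {y \<in> {y \<in> U. \<phi> y \<in> fst c}. (snd c \<circ> \<phi>) y \<in> snd c ` {x \<in> W \<inter> fst c. f x \<in> fst d}}"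
    have V: "y \<in> V \<Longrightarrow> y \<in> U \<and> \<phi> y \<in> fst c \<and> f (\<phi> y) \<in> fst d" for y
      using X c(1) by (auto simp: V_def charted_def dest: inj_onD)
    have "smooth_Rn n V (mdim Y) ((snd d \<circ> f \<circ> chart_inv c) \<circ> (snd c \<circ> \<phi>))"
      unfolding V_def by (rule smooth_Rn_comp[OF mfd_plotD(3)[OF \<phi> c(1)] smooth_onD(3)[OF f c(1) d]])
    then have "smooth_Rn n V (mdim Y) (snd d \<circ> (f \<circ> \<phi>))"
      by (rule smooth_Rn_cong) (simp add: chart_inv_left[OF X c(1)] V)
    moreover have "x \<in> V"
      using x c W by (auto simp: V_def)
    moreover have "V \<subseteq> {x \<in> U. (f \<circ> \<phi>) x \<in> fst d}"
      using V by auto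
    ultimately show "\<exists>V. x \<in> V \<and> V \<subseteq> {x \<in> U. (f \<circ> \<phi>) x \<in> fst d} \<and> smooth_Rn n V (mdim Y) (snd d \<circ> (f \<circ> \<phi>))"
      by blast
  qed
qed

lemma smooth_on_comp:
  assumes X: "charted X" and Y: "charted Y" and f: "smooth_on X W Y f" and g: "smooth_on Y V Z g"
  shows "smooth_on X {x \<in> W. f x \<in> V} Z (g \<circ> f)"
proof -
  note fp = f[unfolded smooth_on_iff_plots[OF X]]
  have eq: "snd c ` ({x \<in> W. f x \<in> V} \<inter> fst c) = {z \<in> snd c ` (W \<inter> fst c). (f \<circ> chart_inv c) z \<in> V}"
    if "c \<in> atlas X" for c
    using chart_inv_left[OF X that] by auto
  have o: "openin (Euclidean_space (mdim X)) (snd c ` ({x \<in> W. f x \<in> V} \<inter> fst c))" if "c \<in> atlas X" for c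
    unfolding eq[OF that] using mfd_plot_preimage[OF Y _ smooth_onD(1)[OF g]] fp that by blast
  have "mfd_plot Z (mdim X) (snd c ` ({x \<in> W. f x \<in> V} \<inter> fst c)) ((g \<circ> f) \<circ> chart_inv c)"
    if c: "c \<in> atlas X" for c
  proof -
    have "mfd_plot Y (mdim X) (snd c ` ({x \<in> W. f x \<in> V} \<inter> fst c)) (f \<circ> chart_inv c)"
      by (rule mfd_plot_subset[of _ _ "snd c ` (W \<inter> fst c)"]) (use fp c o in auto)
    moreover have "(f \<circ> chart_inv c) ` (snd c ` ({x \<in> W. f x \<in> V} \<inter> fst c)) \<subseteq> V"
      using chart_inv_left[OF X c] by auto
    ultimately show ?thesis
      using mfd_plot_comp[OF Y _ g] by (simp only: comp_assoc)
  qed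
  moreover have "openin (mtop X) {x \<in> W. f x \<in> V}"
    using o smooth_onD(1)[OF f] by (auto simp: openin_mtop[OF X])
  ultimately show ?thesis
    using smooth_onD(2)[OF g] by (auto simp: smooth_on_iff_plots[OF X])
qed

lemma smooth_atlas_open:
  assumes "smooth_atlas X" "c \<in> atlas X"
  shows "openin (Euclidean_space (mdim X)) (snd c ` fst c)"
proof -
  have "mfd_plot X (mdim X) (snd c ` fst c) (chart_inv c)"
    using assms by (simp add: smooth_atlas_def)
  then show ?thesis by (rule mfd_plotD(1))
qed

lemma smooth_atlas_coords:
  "smooth_atlas X \<Longrightarrow> c \<in> atlas X \<Longrightarrow> x \<in> fst c \<Longrightarrow> snd c x \<in> Esp (mdim X)"
  by (rule subsetD[OF openin_subset[OF smooth_atlas_open]]) auto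

lemma smooth_atlas_transition:
  assumes X: "smooth_atlas X" and c: "c \<in> atlas X" "d \<in> atlas X"
  shows "smooth_Rn (mdim X) (snd c ` (fst c \<inter> fst d)) (mdim X) (snd d \<circ> chart_inv c)"
proof -
  have "mfd_plot X (mdim X) (snd c ` fst c) (chart_inv c)"
    using X c by (simp add: smooth_atlas_def)
  note this[THEN mfd_plotD(3), OF c(2)]
  moreover have "{z \<in> snd c ` fst c. chart_inv c z \<in> fst d} = snd c ` (fst c \<inter> fst d)"
    using chart_inv_left[OF smooth_atlas_charted[OF X] c(1)] by auto
  ultimately show ?thesis by simp
qed

lemma manifold_smooth_atlas:
  assumes "manifold X"
  shows "smooth_atlas X"
proof -
  have X: "charted X"
    using assms by (auto simp: manifold_def charted_def)
  have "mfd_plot X (mdim X) (snd c ` fst c) (chart_inv c)" if c: "c \<in> atlas X" for c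
  proof -
    have "{z \<in> snd c ` fst c. chart_inv c z \<in> fst d} = snd c ` (fst c \<inter> fst d)" for d :: "'a chart"
      using chart_inv_left[OF X c] by auto
    moreover have "\<forall>d\<in>atlas X. smooth_Rn (mdim X) (snd c ` (fst c \<inter> fst d)) (mdim X) (snd d \<circ> chart_inv c)"
      and "openin (Euclidean_space (mdim X)) (snd c ` fst c)"
      using assms c unfolding manifold_def by simp_all
    moreover have "chart_inv c ` (snd c ` fst c) \<subseteq> pts X"
      using chart_inv_left[OF X c] chart_pts[OF X c] by auto
    ultimately show ?thesis
      by (simp add: mfd_plot_def)
  qed
  then show ?thesis using X by (simp add: smooth_atlas_def)
qed

lemma openin_mtop_pts: "smooth_atlas X \<Longrightarrow> openin (mtop X) (pts X)"
  using smooth_atlas_open by (auto simp: openin_mtop[OF smooth_atlas_charted] smooth_atlas_charted[THEN chart_pts]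
      Int_absorb1 subset_iff)

lemma smooth_on_ident:
  assumes X: "smooth_atlas X"
  shows "smooth_map X X (\<lambda>x. x)"
proof -
  have "pts X \<inter> fst c = fst c" if "c \<in> atlas X" for c
    using chart_pts[OF smooth_atlas_charted[OF X] that] by auto
  then show ?thesis
    using X openin_mtop_pts[OF X]
    by (auto simp: smooth_on_iff_plots[OF smooth_atlas_charted[OF X]] smooth_atlas_def o_def)
qed

lemma mfd_plot_const:
  assumes Y: "smooth_atlas Y" and y: "y \<in> pts Y" and U: "openin (Euclidean_space n) U"
  shows "mfd_plot Y n U (\<lambda>x. y)"
proof -
  have "smooth_Rn n {x \<in> U. y \<in> fst c} (mdim Y) (snd c \<circ> (\<lambda>x. y))" if c: "c \<in> atlas Y" for c
    using smooth_atlas_coords[OF Y c, of y] U by (cases "y \<in> fst c") (auto simp: smooth_Rn_def Ck_const)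
  then show ?thesis
    using y U by (auto simp: mfd_plot_def)
qed

lemma smooth_on_const:
  assumes "smooth_atlas X" "smooth_atlas Y" "y \<in> pts Y"
  shows "smooth_map X Y (\<lambda>x. y)"
  using assms openin_mtop_pts[OF assms(1)] mfd_plot_const[OF assms(2,3)]
  by (auto simp: smooth_on_iff_plots[OF smooth_atlas_charted[OF assms(1)]] o_def
      openin_mtop[OF smooth_atlas_charted[OF assms(1)]])

lemma diff_apply:
  "diff X Y f x v d = (if d \<in> atlas Y \<and> f x \<in> fst d
     then Jac (mdim X) (mdim Y) (snd d \<circ> f \<circ> chart_inv (chart_at X x)) (snd (chart_at X x) x) (v (chart_at X x))
     else 0)"
  by (simp add: diff_def chart_at_def Let_def)

lemma diff_cong:
  assumes X: "charted X" and W: "openin (mtop X) W" "x \<in> W" and fg: "\<And>y. y \<in> W \<Longrightarrow> f y = g y"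
  shows "diff X Y f x v = diff X Y g x v"
proof -
  define c where "c = chart_at X x"
  have c: "c \<in> atlas X" "x \<in> fst c"
    using chart_at[OF X, of x] W openin_mtop[OF X] by (auto simp: c_def)
  have "Jac (mdim X) (mdim Y) (snd d \<circ> f \<circ> chart_inv c) (snd c x) (v c) =
      Jac (mdim X) (mdim Y) (snd d \<circ> g \<circ> chart_inv c) (snd c x) (v c)" for d
    by (rule Jac_cong[of _ "snd c ` (W \<inter> fst c)"])
      (use W c fg chart_inv_left[OF X c(1)] in \<open>auto simp: openin_mtop[OF X]\<close>)
  then show ?thesis
    by (auto simp: fun_eq_iff diff_apply c_def fg[OF W(2)])
qed

text \<open>The common core of two facts. If \<open>h\<close> is a chart of a third manifold after a smooth map, this is
  the chain rule for differentials; if \<open>h\<close> is another chart of \<open>Y\<close>, it says that the components of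
  a differential transform as those of a tangent vector.\<close>

lemma Jac_chart_comp:
  assumes X: "charted X" and Y: "charted Y" and f: "smooth_on X W Y f" and x: "x \<in> W"
    and c: "c \<in> atlas X" "x \<in> fst c" and c': "c' \<in> atlas Y" "f x \<in> fst c'"
    and h: "smooth_Rn (mdim Y) (snd c' ` A) k (h \<circ> chart_inv c')" and A: "f x \<in> A" "A \<subseteq> fst c'"
  shows "Jac (mdim X) k (h \<circ> f \<circ> chart_inv c) (snd c x) v =
    Jac (mdim Y) k (h \<circ> chart_inv c') (snd c' (f x))
      (Jac (mdim X) (mdim Y) (snd c' \<circ> f \<circ> chart_inv c) (snd c x) v)"
proof -
  let ?F = "snd c' \<circ> f \<circ> chart_inv c" and ?U = "snd c ` {x \<in> W \<inter> fst c. f x \<in> fst c'}"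
  have F: "smooth_Rn (mdim X) ?U (mdim Y) ?F"
    by (rule smooth_onD(3)[OF f c(1) c'(1)])
  have Fx: "?F (snd c x) = snd c' (f x)"
    by (simp add: chart_inv_left[OF X c])
  have xU: "snd c x \<in> ?U" "?F (snd c x) \<in> snd c' ` A"
    using x c c' A unfolding Fx by auto
  have "Jac (mdim X) k (h \<circ> f \<circ> chart_inv c) (snd c x) v = Jac (mdim X) k ((h \<circ> chart_inv c') \<circ> ?F) (snd c x) v"
  proof (rule Jac_cong[OF smooth_RnD(1)[OF smooth_Rn_comp[OF F h]]])
    show "snd c x \<in> {x \<in> ?U. ?F x \<in> snd c' ` A}"
      using xU by simp
    show "(h \<circ> f \<circ> chart_inv c) y = (h \<circ> chart_inv c' \<circ> ?F) y" if y: "y \<in> {x \<in> ?U. ?F x \<in> snd c' ` A}" for y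
    proof -
      obtain z where "y = snd c z" "z \<in> fst c" "f z \<in> fst c'"
        using y by auto
      then show ?thesis
        by (simp add: chart_inv_left[OF X c(1)] chart_inv_left[OF Y c'(1)])
    qed
  qed
  also have "\<dots> = Jac (mdim Y) k (h \<circ> chart_inv c') (?F (snd c x)) (Jac (mdim X) (mdim Y) ?F (snd c x) v)"
    by (rule Jac_comp[OF F h xU])
  finally show ?thesis unfolding Fx .
qed

lemma diff_comp:
  assumes X: "charted X" and Y: "charted Y"
    and f: "smooth_on X W Y f" "x \<in> W" and g: "smooth_on Y V Z g" "f x \<in> V"
  shows "diff X Z (g \<circ> f) x v = diff Y Z g (f x) (diff X Y f x v)"
proof
  fix d
  have c: "chart_at X x \<in> atlas X" "x \<in> fst (chart_at X x)"
    using chart_at[OF X, of x] f smooth_onD(1)[OF f(1)] openin_mtop[OF X] by auto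
  have c': "chart_at Y (f x) \<in> atlas Y" "f x \<in> fst (chart_at Y (f x))"
    using chart_at[OF Y] smooth_onD(2)[OF f] by auto
  show "diff X Z (g \<circ> f) x v d = diff Y Z g (f x) (diff X Y f x v) d"
  proof (cases "d \<in> atlas Z \<and> g (f x) \<in> fst d")
    case True
    have "{y \<in> V \<inter> fst (chart_at Y (f x)). g y \<in> fst d} \<subseteq> fst (chart_at Y (f x))"
      by auto
    then show ?thesis
      using True Jac_chart_comp[OF X Y f c c', of "{y \<in> V \<inter> fst (chart_at Y (f x)). g y \<in> fst d}" "mdim Z" "snd d \<circ> g"]
        smooth_onD(3)[OF g(1) c'(1)] c' g(2)
      by (simp add: diff_apply comp_assoc)
  next
    case False
    then show ?thesis
      by (simp only: diff_apply[of X Z] diff_apply[of Y Z] o_apply if_False)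
  qed
qed

lemma diff_tangent:
  assumes X: "charted X" and Y: "smooth_atlas Y" and f: "smooth_on X W Y f" "x \<in> W"
  shows "diff X Y f x v \<in> tangent Y (f x)"
  unfolding tangent_def
proof (intro CollectI conjI allI impI ballI)
  note YC = smooth_atlas_charted[OF Y]
  have c: "chart_at X x \<in> atlas X" "x \<in> fst (chart_at X x)"
    using chart_at[OF X, of x] f smooth_onD(1)[OF f(1)] openin_mtop[OF X] by auto
  show "diff X Y f x v c' = 0" if "\<not> (c' \<in> atlas Y \<and> f x \<in> fst c')" for c'
    using that by (auto simp: diff_apply)
  show "diff X Y f x v c' \<in> Esp (mdim Y)" if "c' \<in> atlas Y" "f x \<in> fst c'" for c'
    using that by (simp add: diff_apply Jac_in_Esp)
  show "diff X Y f x v d = Jac (mdim Y) (mdim Y) (snd d \<circ> chart_inv c') (snd c' (f x)) (diff X Y f x v c')"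
    if c': "c' \<in> atlas Y" and d: "d \<in> atlas Y" and fc': "f x \<in> fst c'" and fd: "f x \<in> fst d" for c' d
  proof -
    have eq: "diff X Y f x v e = Jac (mdim X) (mdim Y) (snd e \<circ> f \<circ> chart_inv (chart_at X x))
        (snd (chart_at X x) x) (v (chart_at X x))" if "e \<in> atlas Y" "f x \<in> fst e" for e
      using that by (simp only: diff_apply simp_thms if_True)
    show ?thesis
      unfolding eq[OF c' fc'] eq[OF d fd]
      by (rule Jac_chart_comp[OF X YC f c c' fc' smooth_atlas_transition[OF Y c' d]]) (use fc' fd in auto)
  qed
qed

lemma diff_add: "diff X Y f x (v + w) = diff X Y f x v + diff X Y f x w"
  by (auto simp: fun_eq_iff diff_apply Jac_add)

lemma diff_tscale: "diff X Y f x (tscale r v) = tscale r (diff X Y f x v)"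
  by (auto simp: fun_eq_iff diff_apply tscale_def Jac_scale)

lemma diff_zero: "diff X Y f x 0 = 0"
  by (auto simp: fun_eq_iff diff_apply)

lemma diff_ident:
  assumes X: "charted X" and x: "x \<in> pts X" and v: "v \<in> tangent X x"
  shows "diff X X (\<lambda>x. x) x v = v"
proof
  fix d
  show "diff X X (\<lambda>x. x) x v d = v d"
  proof (cases "d \<in> atlas X \<and> x \<in> fst d")
    case True
    then have "v d = Jac (mdim X) (mdim X) (snd d \<circ> chart_inv (chart_at X x)) (snd (chart_at X x) x) (v (chart_at X x))"
      using v chart_at[OF X x] unfolding tangent_def by blast
    then show ?thesis
      using True by (simp add: diff_apply o_def)
  next
    case False
    then show ?thesis
      using v unfolding tangent_def by (simp only: diff_apply if_False mem_Collect_eq simp_thms)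
  qed
qed

lemma diff_const: "diff X Y (\<lambda>x. y) x v = 0"
  by (auto simp: fun_eq_iff diff_apply o_def Jac_const)

lemma tscale_simps:
  "tscale r 0 = 0" "tscale 0 v = 0" "tscale 1 v = v" "- v = tscale (- 1) v"
  "tscale r (v + w) = tscale r v + tscale r w" "tscale (r + s) v = tscale r v + tscale s v"
  "tscale r (tscale s v) = tscale (r * s) v"
  by (auto simp: tscale_def fun_eq_iff algebra_simps)

lemma tangentD:
  assumes "v \<in> tangent X x"
  shows "\<not> (c \<in> atlas X \<and> x \<in> fst c) \<Longrightarrow> v c = 0"
    and "c \<in> atlas X \<Longrightarrow> x \<in> fst c \<Longrightarrow> v c \<in> Esp (mdim X)"
    and "c \<in> atlas X \<Longrightarrow> d \<in> atlas X \<Longrightarrow> x \<in> fst c \<Longrightarrow> x \<in> fst d \<Longrightarrow>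
        v d = Jac (mdim X) (mdim X) (snd d \<circ> chart_inv c) (snd c x) (v c)"
  using assms unfolding tangent_def by blast+

lemma tangentI:
  assumes "\<And>c. \<not> (c \<in> atlas X \<and> x \<in> fst c) \<Longrightarrow> v c = 0"
    and "\<And>c. c \<in> atlas X \<Longrightarrow> x \<in> fst c \<Longrightarrow> v c \<in> Esp (mdim X)"
    and "\<And>c d. c \<in> atlas X \<Longrightarrow> d \<in> atlas X \<Longrightarrow> x \<in> fst c \<Longrightarrow> x \<in> fst d \<Longrightarrow>
        v d = Jac (mdim X) (mdim X) (snd d \<circ> chart_inv c) (snd c x) (v c)"
  shows "v \<in> tangent X x"
  using assms unfolding tangent_def by blast

lemma tangent_zero: "0 \<in> tangent X x"
  by (rule tangentI) (simp_all add: Esp_iff)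

lemma tangent_add:
  assumes "v \<in> tangent X x" "w \<in> tangent X x"
  shows "v + w \<in> tangent X x"
proof (rule tangentI)
  fix c d assume "c \<in> atlas X" "d \<in> atlas X" "x \<in> fst c" "x \<in> fst d"
  then show "(v + w) d = Jac (mdim X) (mdim X) (snd d \<circ> chart_inv c) (snd c x) ((v + w) c)"
    using tangentD(3)[OF assms(1), of c d] tangentD(3)[OF assms(2), of c d] by (simp only: plus_fun_apply[of v w] Jac_add)
qed (use tangentD(1,2)[OF assms(1)] tangentD(1,2)[OF assms(2)] in \<open>simp_all add: Esp_iff\<close>)

lemma tangent_tscale:
  assumes "v \<in> tangent X x"
  shows "tscale r v \<in> tangent X x"
proof (rule tangentI)
  fix c d assume "c \<in> atlas X" "d \<in> atlas X" "x \<in> fst c" "x \<in> fst d"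
  then show "tscale r v d = Jac (mdim X) (mdim X) (snd d \<circ> chart_inv c) (snd c x) (tscale r v c)"
    using tangentD(3)[OF assms, of c d] by (simp only: tscale_def Jac_scale)
qed (use tangentD(1,2)[OF assms] in \<open>auto simp: Esp_iff tscale_def fun_eq_iff\<close>)

lemma tangent_minus: "v \<in> tangent X x \<Longrightarrow> w \<in> tangent X x \<Longrightarrow> v - w \<in> tangent X x"
  using tangent_add[of v X x "tscale (- 1) w"] tangent_tscale[of w X x "- 1"] tscale_simps(4)[of w]
  by (metis add_uminus_conv_diff)

lemma tangent_eqI:
  assumes "v \<in> tangent X x" "w \<in> tangent X x" "c \<in> atlas X" "x \<in> fst c" "v c = w c"
  shows "v = w"
proof
  fix d
  show "v d = w d"
    using tangentD(1,3)[OF assms(1)] tangentD(1,3)[OF assms(2)] assms(3-5)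
    by (cases "d \<in> atlas X \<and> x \<in> fst d") metis+
qed

lemma tangent_bundle_atlas:
  "atlas (tangent_bundle X) =
    (\<lambda>c. (Sigma (fst c) (tangent X), \<lambda>(x, v). coord_append (mdim X) (snd c x) (v c))) ` atlas X"
  unfolding tangent_bundle_def by (simp only: mfd.simps setcompr_eq_image Collect_mem_eq)

text \<open>A tangent vector is determined by its components in a single chart, so the charts of the
  tangent bundle are injective.\<close>

lemma tangent_bundle_charted:
  assumes X: "smooth_atlas X"
  shows "charted (tangent_bundle X)"
proof -
  note XC = smooth_atlas_charted[OF X]
  have cov: "(\<Union>c\<in>atlas (tangent_bundle X). fst c) = pts (tangent_bundle X)"
  proof -
    have "(\<Union>c\<in>atlas (tangent_bundle X). fst c) = (\<Union>c\<in>atlas X. Sigma (fst c) (tangent X))"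
      by (simp add: tangent_bundle_atlas)
    also have "\<dots> = Sigma (\<Union>c\<in>atlas X. fst c) (tangent X)"
      by blast
    finally show ?thesis
      using XC by (simp add: tangent_bundle_def charted_def)
  qed
  have "inj_on (\<lambda>(x, v). coord_append (mdim X) (snd c x) (v c)) (Sigma (fst c) (tangent X))"
    if c: "c \<in> atlas X" for c
  proof (rule inj_onI, clarify)
    fix x v y w
    assume x: "x \<in> fst c" "v \<in> tangent X x" and y: "y \<in> fst c" "w \<in> tangent X y"
      and eq: "coord_append (mdim X) (snd c x) (v c) = coord_append (mdim X) (snd c y) (w c)"
    have "snd c x i = snd c y i" for i
      using fun_cong[OF eq, of i] smooth_atlas_coords[OF X c x(1)] smooth_atlas_coords[OF X c y(1)]
      by (cases "i < mdim X") (auto simp: coord_append_def Esp_iff)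
    then have "snd c x = snd c y" ..
    then have xy: "x = y"
      using XC c x(1) y(1) unfolding charted_def by (blast dest: inj_onD)
    have "v c i = w c i" for i
      using fun_cong[OF eq, of "i + mdim X"] by (simp add: coord_append_def)
    then have "v c = w c" ..
    then have "v = w"
      using x y xy c by (intro tangent_eqI[of v X x w c]) simp_all
    then show "x = y \<and> v = w" using xy by simp
  qed
  then show ?thesis
    using cov unfolding charted_def by (simp add: tangent_bundle_atlas)
qed


section \<open>Products of manifolds\<close>

definition prod_chart :: "nat \<Rightarrow> 'a chart \<Rightarrow> 'b chart \<Rightarrow> ('a \<times> 'b) chart" where
  "prod_chart n c d = (fst c \<times> fst d, \<lambda>(x, y). coord_append n (snd c x) (snd d y))"

definition coords_fst :: "nat \<Rightarrow> (nat \<Rightarrow> real) \<Rightarrow> nat \<Rightarrow> real" where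
  "coords_fst n z = (\<lambda>j. if j < n then z j else 0)"

definition coords_snd :: "nat \<Rightarrow> nat \<Rightarrow> (nat \<Rightarrow> real) \<Rightarrow> nat \<Rightarrow> real" where
  "coords_snd n m z = (\<lambda>j. if j < m then z (j + n) else 0)"

lemma prod_mfd_atlas: "atlas (prod_mfd X Y) = (\<lambda>(c, d). prod_chart (mdim X) c d) ` (atlas X \<times> atlas Y)"
proof -
  have "atlas (prod_mfd X Y) = {prod_chart (mdim X) c d |c d. c \<in> atlas X \<and> d \<in> atlas Y}"
    by (simp only: prod_mfd_def mfd.simps prod_chart_def)
  also have "\<dots> = (\<lambda>(c, d). prod_chart (mdim X) c d) ` (atlas X \<times> atlas Y)"
  proof (intro equalityI subsetI)
    fix e assume "e \<in> {prod_chart (mdim X) c d |c d. c \<in> atlas X \<and> d \<in> atlas Y}"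
    then obtain c d where "c \<in> atlas X" "d \<in> atlas Y" "e = prod_chart (mdim X) c d"
      by blast
    then show "e \<in> (\<lambda>(c, d). prod_chart (mdim X) c d) ` (atlas X \<times> atlas Y)"
      by (intro image_eqI[of _ _ "(c, d)"]) simp_all
  qed auto
  finally show ?thesis .
qed

lemma prod_mfd_simps [simp]:
  "pts (prod_mfd X Y) = pts X \<times> pts Y" "mdim (prod_mfd X Y) = mdim X + mdim Y"
  by (simp_all add: prod_mfd_def)

lemma prod_chart_simps [simp]:
  "fst (prod_chart n c d) = fst c \<times> fst d"
  "snd (prod_chart n c d) (x, y) = coord_append n (snd c x) (snd d y)"
  by (simp_all add: prod_chart_def)

lemma prod_mfd_atlasE:
  assumes "e \<in> atlas (prod_mfd X Y)"
  obtains c d where "c \<in> atlas X" "d \<in> atlas Y" "e = prod_chart (mdim X) c d"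
  using assms by (auto simp: prod_mfd_atlas)

lemma coord_append_simps:
  "a \<in> Esp n \<Longrightarrow> b \<in> Esp m \<Longrightarrow> coord_append n a b \<in> Esp (n + m)"
  "a \<in> Esp n \<Longrightarrow> coords_fst n (coord_append n a b) = a"
  "b \<in> Esp m \<Longrightarrow> coords_snd n m (coord_append n a b) = b"
  by (auto simp: coord_append_def coords_fst_def coords_snd_def Esp_iff fun_eq_iff)

lemma coord_append_split:
  assumes "z \<in> Esp (n + m)"
  shows "coord_append n (coords_fst n z) (coords_snd n m z) = z"
  using assms by (auto simp: coord_append_def coords_fst_def coords_snd_def Esp_iff fun_eq_iff)

lemma smooth_coords:
  "smooth_Rn (n + m) (Esp (n + m)) n (coords_fst n)"
  "smooth_Rn (n + m) (Esp (n + m)) m (coords_snd n m)"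
  by (auto simp: smooth_Rn_def coords_fst_def coords_snd_def Esp_iff Ck_coord)

lemma smooth_Rn_append:
  assumes "smooth_Rn k U n f" "smooth_Rn k U m g"
  shows "smooth_Rn k U (n + m) (\<lambda>x. coord_append n (f x) (g x))"
  unfolding smooth_Rn_def
proof (intro conjI allI impI)
  show "openin (Euclidean_space k) U" by (rule smooth_RnD(1)[OF assms(1)])
  show "(\<lambda>x. coord_append n (f x) (g x)) ` U \<subseteq> Esp (n + m)"
    using coord_append_simps(1) smooth_RnD(2)[OF assms(1)] smooth_RnD(2)[OF assms(2)] by (intro image_subsetI) simp
  show "Ck l k U (\<lambda>x. coord_append n (f x) (g x) j)" if "j < n + m" for j l
    using smooth_RnD(3)[OF assms(1), of j] smooth_RnD(3)[OF assms(2), of "j - n"] that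
    by (cases "j < n") (simp_all add: coord_append_def)
qed

lemma mfd_plot_pair:
  assumes f: "mfd_plot X k U f" and g: "mfd_plot Y k U g"
  shows "mfd_plot (prod_mfd X Y) k U (\<lambda>x. (f x, g x))"
  unfolding mfd_plot_def
proof (intro conjI ballI)
  show "openin (Euclidean_space k) U" by (rule mfd_plotD(1)[OF f])
  show "(\<lambda>x. (f x, g x)) ` U \<subseteq> pts (prod_mfd X Y)"
    using mfd_plotD(2)[OF f] mfd_plotD(2)[OF g] by auto
  fix e assume "e \<in> atlas (prod_mfd X Y)"
  then obtain c d where c: "c \<in> atlas X" and d: "d \<in> atlas Y" and e: "e = prod_chart (mdim X) c d"
    by (rule prod_mfd_atlasE)
  let ?U = "{x \<in> U. f x \<in> fst c} \<inter> {x \<in> U. g x \<in> fst d}"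
  note sf = mfd_plotD(3)[OF f c] and sg = mfd_plotD(3)[OF g d]
  have o: "openin (Euclidean_space k) ?U"
    by (rule openin_Int[OF smooth_RnD(1)[OF sf] smooth_RnD(1)[OF sg]])
  have "smooth_Rn k ?U (mdim X + mdim Y) (\<lambda>x. coord_append (mdim X) ((snd c \<circ> f) x) ((snd d \<circ> g) x))"
    by (intro smooth_Rn_append smooth_Rn_subset[OF sf o] smooth_Rn_subset[OF sg o]) auto
  moreover have "?U = {x \<in> U. (f x, g x) \<in> fst e}"
    unfolding e by auto
  moreover have "(\<lambda>x. coord_append (mdim X) ((snd c \<circ> f) x) ((snd d \<circ> g) x)) = snd e \<circ> (\<lambda>x. (f x, g x))"
    unfolding e by (simp add: fun_eq_iff)
  ultimately show "smooth_Rn k {x \<in> U. (f x, g x) \<in> fst e} (mdim (prod_mfd X Y)) (snd e \<circ> (\<lambda>x. (f x, g x)))"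
    by simp
qed

lemma prod_charted:
  assumes X: "smooth_atlas X" and Y: "smooth_atlas Y"
  shows "charted (prod_mfd X Y)"
  unfolding charted_def
proof (intro conjI ballI)
  have "(\<Union>e\<in>atlas (prod_mfd X Y). fst e) = (\<Union>c\<in>atlas X. fst c) \<times> (\<Union>d\<in>atlas Y. fst d)"
  proof (rule set_eqI)
    fix z :: "'a \<times> 'b"
    have "z \<in> (\<Union>e\<in>atlas (prod_mfd X Y). fst e) \<longleftrightarrow>
        (\<exists>k\<in>atlas X \<times> atlas Y. z \<in> fst (case k of (c, d) \<Rightarrow> prod_chart (mdim X) c d))"
      unfolding prod_mfd_atlas by (simp only: UN_iff bex_simps)
    also have "\<dots> \<longleftrightarrow> (\<exists>c\<in>atlas X. \<exists>d\<in>atlas Y. z \<in> fst c \<times> fst d)"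
      by (simp only: split_paired_Bex_Sigma split prod_chart_simps)
    also have "\<dots> \<longleftrightarrow> z \<in> (\<Union>c\<in>atlas X. fst c) \<times> (\<Union>d\<in>atlas Y. fst d)"
      unfolding mem_Times_iff by blast
    finally show "z \<in> (\<Union>e\<in>atlas (prod_mfd X Y). fst e) \<longleftrightarrow> z \<in> (\<Union>c\<in>atlas X. fst c) \<times> (\<Union>d\<in>atlas Y. fst d)" .
  qed
  then show "(\<Union>e\<in>atlas (prod_mfd X Y). fst e) = pts (prod_mfd X Y)"
    using X Y by (simp add: smooth_atlas_def charted_def)
  fix e assume "e \<in> atlas (prod_mfd X Y)"
  then obtain c d where c: "c \<in> atlas X" and d: "d \<in> atlas Y" and e: "e = prod_chart (mdim X) c d"
    by (rule prod_mfd_atlasE)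
  show "inj_on (snd e) (fst e)"
  proof (rule inj_onI, clarsimp simp: e)
    fix x y x' y'
    assume a: "x \<in> fst c" "y \<in> fst d" "x' \<in> fst c" "y' \<in> fst d"
      and eq: "coord_append (mdim X) (snd c x) (snd d y) = coord_append (mdim X) (snd c x') (snd d y')"
    have "snd c x = snd c x'" "snd d y = snd d y'"
      using arg_cong[OF eq, of "coords_fst (mdim X)"] arg_cong[OF eq, of "coords_snd (mdim X) (mdim Y)"] a
        smooth_atlas_coords[OF X c] smooth_atlas_coords[OF Y d] by (simp_all add: coord_append_simps)
    then show "x = x' \<and> y = y'"
      using X Y a c d unfolding smooth_atlas_def charted_def by (metis inj_onD)
  qed
qed

lemma prod_chart_image:
  assumes X: "smooth_atlas X" "c \<in> atlas X" and Y: "smooth_atlas Y" "d \<in> atlas Y"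
  shows "snd (prod_chart (mdim X) c d) ` (fst c \<times> fst d) =
    {z \<in> Esp (mdim X + mdim Y). coords_fst (mdim X) z \<in> snd c ` fst c \<and> coords_snd (mdim X) (mdim Y) z \<in> snd d ` fst d}"
    (is "?L = ?R")
proof (intro equalityI subsetI)
  fix z assume "z \<in> ?L"
  then show "z \<in> ?R"
    using smooth_atlas_coords[OF X] smooth_atlas_coords[OF Y] by (auto simp: coord_append_simps)
next
  fix z assume z: "z \<in> ?R"
  then obtain x y where "x \<in> fst c" "y \<in> fst d" "coords_fst (mdim X) z = snd c x" "coords_snd (mdim X) (mdim Y) z = snd d y"
    by auto
  then have "z = snd (prod_chart (mdim X) c d) (x, y)"
    using coord_append_split[of z "mdim X" "mdim Y"] z by simp
  then show "z \<in> ?L" using \<open>x \<in> fst c\<close> \<open>y \<in> fst d\<close> by blast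
qed

lemma prod_chart_inv:
  assumes X: "smooth_atlas X" "c \<in> atlas X" and Y: "smooth_atlas Y" "d \<in> atlas Y"
    and z: "z \<in> snd (prod_chart (mdim X) c d) ` (fst c \<times> fst d)"
  shows "chart_inv (prod_chart (mdim X) c d) z =
    (chart_inv c (coords_fst (mdim X) z), chart_inv d (coords_snd (mdim X) (mdim Y) z))"
proof -
  have e: "prod_chart (mdim X) c d \<in> atlas (prod_mfd X Y)"
    using X Y unfolding prod_mfd_atlas by blast
  obtain x y where xy: "x \<in> fst c" "y \<in> fst d" "z = snd (prod_chart (mdim X) c d) (x, y)"
    using z by auto
  have "chart_inv (prod_chart (mdim X) c d) z = (x, y)"
    using chart_inv_left[OF prod_charted[OF X(1) Y(1)] e, of "(x, y)"] xy by simp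
  then show ?thesis
    using xy smooth_atlas_coords[OF X] smooth_atlas_coords[OF Y]
      chart_inv_left[OF smooth_atlas_charted[OF X(1)] X(2)] chart_inv_left[OF smooth_atlas_charted[OF Y(1)] Y(2)]
    by (simp add: coord_append_simps)
qed

lemma prod_chart_plots:
  assumes X: "smooth_atlas X" "c \<in> atlas X" and Y: "smooth_atlas Y" "d \<in> atlas Y"
  defines "O' \<equiv> snd (prod_chart (mdim X) c d) ` (fst c \<times> fst d)"
  shows "mfd_plot X (mdim X + mdim Y) O' (chart_inv c \<circ> coords_fst (mdim X))"
    "mfd_plot Y (mdim X + mdim Y) O' (chart_inv d \<circ> coords_snd (mdim X) (mdim Y))"
proof -
  let ?n = "mdim X" and ?m = "mdim Y"
  let ?A = "{z \<in> Esp (?n + ?m). coords_fst ?n z \<in> snd c ` fst c}"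
  let ?B = "{z \<in> Esp (?n + ?m). coords_snd ?n ?m z \<in> snd d ` fst d}"
  have A: "openin (Euclidean_space (?n + ?m)) ?A"
    using smooth_RnD[OF smooth_coords(1)[of ?n ?m]] by (intro openin_Esp_preimage[OF _ smooth_atlas_open[OF X]]) auto
  have B: "openin (Euclidean_space (?n + ?m)) ?B"
    using smooth_RnD[OF smooth_coords(2)[of ?n ?m]] by (intro openin_Esp_preimage[OF _ smooth_atlas_open[OF Y]]) auto
  have O': "O' = ?A \<inter> ?B"
    unfolding O'_def prod_chart_image[OF X Y] by blast
  have o: "openin (Euclidean_space (?n + ?m)) O'"
    unfolding O' by (rule openin_Int[OF A B])
  have E: "O' \<subseteq> Esp (?n + ?m)" unfolding O' by blast
  have cp: "mfd_plot X ?n (snd c ` fst c) (chart_inv c)" and dp: "mfd_plot Y ?m (snd d ` fst d) (chart_inv d)"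
    using X Y by (simp_all add: smooth_atlas_def)
  show "mfd_plot X (?n + ?m) O' (chart_inv c \<circ> coords_fst ?n)"
    by (rule mfd_plot_reparam[OF cp smooth_Rn_subset[OF smooth_coords(1) o E]]) (auto simp: O')
  show "mfd_plot Y (?n + ?m) O' (chart_inv d \<circ> coords_snd ?n ?m)"
    by (rule mfd_plot_reparam[OF dp smooth_Rn_subset[OF smooth_coords(2) o E]]) (auto simp: O')
qed

lemma prod_smooth_atlas:
  assumes X: "smooth_atlas X" and Y: "smooth_atlas Y"
  shows "smooth_atlas (prod_mfd X Y)"
  unfolding smooth_atlas_def
proof (intro conjI ballI prod_charted X Y)
  fix e assume "e \<in> atlas (prod_mfd X Y)"
  then obtain c d where c: "c \<in> atlas X" and d: "d \<in> atlas Y" and e: "e = prod_chart (mdim X) c d"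
    by (rule prod_mfd_atlasE)
  have "mfd_plot (prod_mfd X Y) (mdim X + mdim Y) (snd e ` (fst c \<times> fst d))
      (\<lambda>z. ((chart_inv c \<circ> coords_fst (mdim X)) z, (chart_inv d \<circ> coords_snd (mdim X) (mdim Y)) z))"
    unfolding e by (intro mfd_plot_pair prod_chart_plots[OF X c Y d])
  then have "mfd_plot (prod_mfd X Y) (mdim X + mdim Y) (snd e ` (fst c \<times> fst d)) (chart_inv e)"
    by (rule mfd_plot_cong) (simp add: e prod_chart_inv[OF X c Y d])
  then show "mfd_plot (prod_mfd X Y) (mdim (prod_mfd X Y)) (snd e ` fst e) (chart_inv e)"
    by (simp add: e)
qed

lemma smooth_fst_snd:
  assumes X: "smooth_atlas X" and Y: "smooth_atlas Y"
  shows "smooth_map (prod_mfd X Y) X fst" "smooth_map (prod_mfd X Y) Y snd"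
proof -
  have *: "mfd_plot X (mdim X + mdim Y) (snd e ` (pts X \<times> pts Y \<inter> fst e)) (fst \<circ> chart_inv e) \<and>
      mfd_plot Y (mdim X + mdim Y) (snd e ` (pts X \<times> pts Y \<inter> fst e)) (snd \<circ> chart_inv e)"
    if e_in: "e \<in> atlas (prod_mfd X Y)" for e
  proof -
    obtain c d where c: "c \<in> atlas X" and d: "d \<in> atlas Y" and e: "e = prod_chart (mdim X) c d"
      using prod_mfd_atlasE[OF e_in] by metis
    have eq: "pts X \<times> pts Y \<inter> fst e = fst c \<times> fst d"
      using chart_pts[OF smooth_atlas_charted[OF X] c] chart_pts[OF smooth_atlas_charted[OF Y] d]
      by (auto simp: e)
    show ?thesis
      unfolding eq
    proof
      show "mfd_plot X (mdim X + mdim Y) (snd e ` (fst c \<times> fst d)) (fst \<circ> chart_inv e)"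
        by (rule mfd_plot_cong[OF prod_chart_plots(1)[OF X c Y d, folded e]])
          (simp add: e prod_chart_inv[OF X c Y d])
      show "mfd_plot Y (mdim X + mdim Y) (snd e ` (fst c \<times> fst d)) (snd \<circ> chart_inv e)"
        by (rule mfd_plot_cong[OF prod_chart_plots(2)[OF X c Y d, folded e]])
          (simp add: e prod_chart_inv[OF X c Y d])
    qed
  qed
  show "smooth_map (prod_mfd X Y) X fst" "smooth_map (prod_mfd X Y) Y snd"
    using * openin_mtop_pts[OF prod_smooth_atlas[OF X Y]]
    unfolding smooth_on_iff_plots[OF prod_charted[OF X Y]] by auto
qed

lemma smooth_on_pair:
  assumes X: "charted X" and f: "smooth_on X W Y f" and g: "smooth_on X W Z g"
  shows "smooth_on X W (prod_mfd Y Z) (\<lambda>x. (f x, g x))"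
  unfolding smooth_on_iff_plots[OF X]
proof (intro conjI ballI)
  show "openin (mtop X) W" by (rule smooth_onD(1)[OF f])
  show "(\<lambda>x. (f x, g x)) ` W \<subseteq> pts (prod_mfd Y Z)"
    using smooth_onD(2)[OF f] smooth_onD(2)[OF g] by auto
  fix c assume "c \<in> atlas X"
  then have "mfd_plot (prod_mfd Y Z) (mdim X) (snd c ` (W \<inter> fst c)) (\<lambda>x. ((f \<circ> chart_inv c) x, (g \<circ> chart_inv c) x))"
    using f g unfolding smooth_on_iff_plots[OF X] by (intro mfd_plot_pair) blast+
  then show "mfd_plot (prod_mfd Y Z) (mdim X) (snd c ` (W \<inter> fst c)) ((\<lambda>x. (f x, g x)) \<circ> chart_inv c)"
    by (simp add: o_def)
qed

text \<open>In a product chart the differentials of the two projections are the two blocks of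
  coordinates, so together they determine a tangent vector.\<close>

lemma prod_tangent_eqI:
  assumes X: "smooth_atlas X" and Y: "smooth_atlas Y" and xy: "x \<in> pts X" "y \<in> pts Y"
    and z: "z \<in> tangent (prod_mfd X Y) (x, y)" "z' \<in> tangent (prod_mfd X Y) (x, y)"
    and eq: "diff (prod_mfd X Y) X fst (x, y) z = diff (prod_mfd X Y) X fst (x, y) z'"
      "diff (prod_mfd X Y) Y snd (x, y) z = diff (prod_mfd X Y) Y snd (x, y) z'"
  shows "z = z'"
proof -
  define e where "e = chart_at (prod_mfd X Y) (x, y)"
  have e: "e \<in> atlas (prod_mfd X Y)" "(x, y) \<in> fst e"
    using chart_at[OF prod_charted[OF X Y], of "(x, y)"] xy by (auto simp: e_def)
  obtain c d where c: "c \<in> atlas X" and d: "d \<in> atlas Y" and ecd: "e = prod_chart (mdim X) c d"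
    using e(1) by (rule prod_mfd_atlasE)
  have xc: "x \<in> fst c" "y \<in> fst d"
    using e(2) by (auto simp: ecd)
  have o: "openin (Euclidean_space (mdim X + mdim Y)) (snd e ` (fst c \<times> fst d))"
    using smooth_atlas_open[OF prod_smooth_atlas[OF X Y] e(1)] by (simp add: ecd)
  have inO: "snd e (x, y) \<in> snd e ` (fst c \<times> fst d)"
    using xc by blast
  have im: "w \<in> snd e ` (fst c \<times> fst d) \<Longrightarrow>
      coords_fst (mdim X) w \<in> snd c ` fst c \<and> coords_snd (mdim X) (mdim Y) w \<in> snd d ` fst d" for w
    using prod_chart_image[OF X c Y d] by (simp add: ecd)
  have l: "snd c (chart_inv c a) = a" if "a \<in> snd c ` fst c" for a
    using that chart_inv_left[OF smooth_atlas_charted[OF X] c] by auto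
  have r: "snd d (chart_inv d a) = a" if "a \<in> snd d ` fst d" for a
    using that chart_inv_left[OF smooth_atlas_charted[OF Y] d] by auto
  have 1: "diff (prod_mfd X Y) X fst (x, y) w c = coords_fst (mdim X) (w e)"
    if "w \<in> tangent (prod_mfd X Y) (x, y)" for w
  proof -
    have E: "w e \<in> Esp (mdim X + mdim Y)"
      using tangentD(2)[OF that e] by simp
    have "diff (prod_mfd X Y) X fst (x, y) w c
        = Jac (mdim X + mdim Y) (mdim X) (snd c \<circ> fst \<circ> chart_inv e) (snd e (x, y)) (w e)"
      using c xc by (simp add: diff_apply e_def)
    also have "\<dots> = Jac (mdim X + mdim Y) (mdim X) (coords_fst (mdim X)) (snd e (x, y)) (w e)"
      by (rule Jac_cong[OF o inO]) (use im l in \<open>simp add: ecd prod_chart_inv[OF X c Y d]\<close>)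
    also have "\<dots> = coords_fst (mdim X) (w e)"
      using Jac_coords[OF E, of "mdim X" "\<lambda>j. j"] by (simp add: coords_fst_def[abs_def])
    finally show ?thesis .
  qed
  have 2: "diff (prod_mfd X Y) Y snd (x, y) w d = coords_snd (mdim X) (mdim Y) (w e)"
    if "w \<in> tangent (prod_mfd X Y) (x, y)" for w
  proof -
    have E: "w e \<in> Esp (mdim X + mdim Y)"
      using tangentD(2)[OF that e] by simp
    have "diff (prod_mfd X Y) Y snd (x, y) w d
        = Jac (mdim X + mdim Y) (mdim Y) (snd d \<circ> snd \<circ> chart_inv e) (snd e (x, y)) (w e)"
      using d xc by (simp add: diff_apply e_def)
    also have "\<dots> = Jac (mdim X + mdim Y) (mdim Y) (coords_snd (mdim X) (mdim Y)) (snd e (x, y)) (w e)"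
      by (rule Jac_cong[OF o inO]) (use im r in \<open>simp add: ecd prod_chart_inv[OF X c Y d]\<close>)
    also have "\<dots> = coords_snd (mdim X) (mdim Y) (w e)"
      using Jac_coords[OF E, of "mdim Y" "\<lambda>j. j + mdim X"] by (simp add: coords_snd_def[abs_def])
    finally show ?thesis .
  qed
  have "w e = coord_append (mdim X) (coords_fst (mdim X) (w e)) (coords_snd (mdim X) (mdim Y) (w e))"
    if "w \<in> tangent (prod_mfd X Y) (x, y)" for w
    using coord_append_split[of "w e" "mdim X" "mdim Y"] tangentD(2)[OF that e] by simp
  then have "z e = z' e"
    using 1 2 z eq by metis
  then show ?thesis
    by (rule tangent_eqI[OF z e])
qed

lemma tpair:
  assumes X: "smooth_atlas X" and Y: "smooth_atlas Y" and xy: "x \<in> pts X" "y \<in> pts Y"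
    and u: "u \<in> tangent X x" and w: "w \<in> tangent Y y"
  shows "tpair X Y x y u w \<in> tangent (prod_mfd X Y) (x, y)"
    "diff (prod_mfd X Y) X fst (x, y) (tpair X Y x y u w) = u"
    "diff (prod_mfd X Y) Y snd (x, y) (tpair X Y x y u w) = w"
proof -
  note XC = smooth_atlas_charted[OF X] and YC = smooth_atlas_charted[OF Y]
    and P = prod_smooth_atlas[OF X Y] and PC = prod_charted[OF X Y]
  let ?i = "\<lambda>x. (x, y)" and ?j = "\<lambda>y. (x, y)"
  have i: "smooth_map X (prod_mfd X Y) ?i"
    by (rule smooth_on_pair[OF XC smooth_on_ident[OF X] smooth_on_const[OF X Y xy(2)]])
  have j: "smooth_map Y (prod_mfd X Y) ?j"
    by (rule smooth_on_pair[OF YC smooth_on_const[OF Y X xy(1)] smooth_on_ident[OF Y]])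
  let ?z = "diff X (prod_mfd X Y) ?i x u + diff Y (prod_mfd X Y) ?j y w"
  have xyp: "(x, y) \<in> pts (prod_mfd X Y)" using xy by simp
  have z: "?z \<in> tangent (prod_mfd X Y) (x, y)"
    by (intro tangent_add diff_tangent[OF XC P i xy(1)] diff_tangent[OF YC P j xy(2)])
  have a: "diff (prod_mfd X Y) X fst (x, y) (diff X (prod_mfd X Y) ?i x u) = u"
    using diff_comp[OF XC PC i xy(1) smooth_fst_snd(1)[OF X Y] xyp, of u] diff_ident[OF XC xy(1) u]
    by (simp add: o_def)
  have b: "diff (prod_mfd X Y) X fst (x, y) (diff Y (prod_mfd X Y) ?j y w) = 0"
    using diff_comp[OF YC PC j xy(2) smooth_fst_snd(1)[OF X Y] xyp, of w] by (simp add: o_def diff_const)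
  have c: "diff (prod_mfd X Y) Y snd (x, y) (diff X (prod_mfd X Y) ?i x u) = 0"
    using diff_comp[OF XC PC i xy(1) smooth_fst_snd(2)[OF X Y] xyp, of u] by (simp add: o_def diff_const)
  have d: "diff (prod_mfd X Y) Y snd (x, y) (diff Y (prod_mfd X Y) ?j y w) = w"
    using diff_comp[OF YC PC j xy(2) smooth_fst_snd(2)[OF X Y] xyp, of w] diff_ident[OF YC xy(2) w]
    by (simp add: o_def)
  have "\<exists>!z. z \<in> tangent (prod_mfd X Y) (x, y) \<and>
      diff (prod_mfd X Y) X fst (x, y) z = u \<and> diff (prod_mfd X Y) Y snd (x, y) z = w"
  proof (rule ex1I[of _ ?z])
    show "?z \<in> tangent (prod_mfd X Y) (x, y) \<and>
        diff (prod_mfd X Y) X fst (x, y) ?z = u \<and> diff (prod_mfd X Y) Y snd (x, y) ?z = w"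
      using z by (simp add: diff_add a b c d)
  next
    fix z' assume "z' \<in> tangent (prod_mfd X Y) (x, y) \<and>
        diff (prod_mfd X Y) X fst (x, y) z' = u \<and> diff (prod_mfd X Y) Y snd (x, y) z' = w"
    then show "z' = ?z"
      using z by (intro prod_tangent_eqI[OF X Y xy]) (simp_all add: diff_add a b c d)
  qed
  from theI'[OF this]
  show "tpair X Y x y u w \<in> tangent (prod_mfd X Y) (x, y)"
    "diff (prod_mfd X Y) X fst (x, y) (tpair X Y x y u w) = u"
    "diff (prod_mfd X Y) Y snd (x, y) (tpair X Y x y u w) = w"
    unfolding tpair_def by simp_all
qed

lemma tpair_eq:
  assumes "smooth_atlas X" "smooth_atlas Y" "x \<in> pts X" "y \<in> pts Y"
    and "u \<in> tangent X x" "w \<in> tangent Y y" "z \<in> tangent (prod_mfd X Y) (x, y)"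
    and "diff (prod_mfd X Y) X fst (x, y) z = u" "diff (prod_mfd X Y) Y snd (x, y) z = w"
  shows "tpair X Y x y u w = z"
  using tpair[OF assms(1-6)] assms(7-9) by (intro prod_tangent_eqI[OF assms(1-4)]) simp_all

lemma tpair_add:
  assumes "smooth_atlas X" "smooth_atlas Y" "x \<in> pts X" "y \<in> pts Y"
    and "u \<in> tangent X x" "w \<in> tangent Y y" "u' \<in> tangent X x" "w' \<in> tangent Y y"
  shows "tpair X Y x y (u + u') (w + w') = tpair X Y x y u w + tpair X Y x y u' w'"
  using tpair[OF assms(1-6)] tpair[OF assms(1-4,7-8)]
  by (intro tpair_eq assms tangent_add) (simp_all add: diff_add)

lemma tpair_tscale:
  assumes "smooth_atlas X" "smooth_atlas Y" "x \<in> pts X" "y \<in> pts Y"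
    and "u \<in> tangent X x" "w \<in> tangent Y y"
  shows "tpair X Y x y (tscale r u) (tscale r w) = tscale r (tpair X Y x y u w)"
  using tpair[OF assms]
  by (intro tpair_eq assms tangent_tscale) (simp_all add: diff_tscale)


section \<open>The linear maps of a connection pair\<close>

text \<open>The differential along a submanifold is that of one fixed smooth extension, whatever the
  tangent vector; all that is used of it (its linearity and where its values lie) holds for every
  extension.\<close>

lemma diff_sub_extension:
  assumes "x \<in> W0" "smooth_on X W0 Y F0" "\<forall>z\<in>S \<inter> W0. F0 z = f z"
  obtains F W where "x \<in> W" "smooth_on X W Y F" "\<forall>z\<in>S \<inter> W. F z = f z"
    "diff_sub X S Y f x = diff X Y F x"
proof -
  define F where "F = (SOME F. \<exists>W. x \<in> W \<and> smooth_on X W Y F \<and> (\<forall>z\<in>S \<inter> W. F z = f z))"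
  have "\<exists>F W. x \<in> W \<and> smooth_on X W Y F \<and> (\<forall>z\<in>S \<inter> W. F z = f z)"
    using assms by blast
  then have "\<exists>W. x \<in> W \<and> smooth_on X W Y F \<and> (\<forall>z\<in>S \<inter> W. F z = f z)"
    unfolding F_def by (rule someI_ex)
  then show ?thesis
    using that[of _ F] by (auto simp: diff_sub_def F_def fun_eq_iff)
qed

locale bundle_with_connection =
  fixes B :: "('a, 'b, 'p, 'm) pbundle" and \<omega> :: "'p \<Rightarrow> 'p tvec \<Rightarrow> 'b tvec" and H :: "'b \<Rightarrow> 'b tvec set"
  assumes lie: "lie_groupoid (gpd B)" and principal: "principal_bundle B"
    and connection: "connection_pair B \<omega> H"
begin

abbreviation "Ob \<equiv> X0 (gpd B)"
abbreviation "Ar \<equiv> X1 (gpd B)"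
abbreviation "src \<equiv> gsrc (gpd B)"
abbreviation "tgt \<equiv> gtgt (gpd B)"
abbreviation "unit \<equiv> gunit (gpd B)"
abbreviation "inver \<equiv> ginv (gpd B)"
abbreviation "mul \<equiv> gmult (gpd B)"
abbreviation "Tot \<equiv> tot B"
abbreviation "anc \<equiv> anchor B"

lemma lie_parts:
  "manifold Ob" "manifold Ar" "submersion Ar Ob src" "submersion Ar Ob tgt"
  "smooth_map Ob Ar unit" "smooth_map Ar Ar inver"
  "smooth_sub (prod_mfd Ar Ar) {(g, h). g \<in> pts Ar \<and> h \<in> pts Ar \<and> src g = tgt h} Ar (\<lambda>(g, h). mul g h)"
  "\<forall>g\<in>pts Ar. \<forall>h\<in>pts Ar. src g = tgt h \<longrightarrow> src (mul g h) = src h \<and> tgt (mul g h) = tgt g"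
  "\<forall>g\<in>pts Ar. \<forall>h\<in>pts Ar. \<forall>k\<in>pts Ar. src g = tgt h \<longrightarrow> src h = tgt k \<longrightarrow>
     mul (mul g h) k = mul g (mul h k)"
  "\<forall>x\<in>pts Ob. src (unit x) = x \<and> tgt (unit x) = x"
  "\<forall>g\<in>pts Ar. mul (unit (tgt g)) g = g \<and> mul g (unit (src g)) = g"
  "\<forall>g\<in>pts Ar. src (inver g) = tgt g \<and> tgt (inver g) = src g \<and>
     mul g (inver g) = unit (tgt g) \<and> mul (inver g) g = unit (src g)"
  by ((insert lie[unfolded lie_groupoid_def], elim conjE, assumption)[1])+

lemma bundle_parts:
  "manifold Tot" "\<forall>(p, g)\<in>act_dom B. proj B (act B p g) = proj B p"
  "bij_betw (\<lambda>(p, g). (p, act B p g)) (act_dom B)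
     {(p, q). p \<in> pts Tot \<and> q \<in> pts Tot \<and> proj B p = proj B q}"
  "smooth_map Tot Ob anc"
  "smooth_sub (prod_mfd Tot Ar) (act_dom B) Tot (\<lambda>(p, g). act B p g)"
  "\<forall>(p, g)\<in>act_dom B. anc (act B p g) = src g"
  "\<forall>(p, g)\<in>act_dom B. \<forall>h\<in>pts Ar. src g = tgt h \<longrightarrow> act B (act B p g) h = act B p (mul g h)"
  "\<forall>p\<in>pts Tot. act B p (unit (anc p)) = p"
  by ((insert principal[unfolded principal_bundle_def right_action_def Let_def], elim conjE, assumption)[1])+

lemma connection_parts:
  "ehresmann (gpd B) H"
  "\<forall>p\<in>pts Tot. \<forall>u\<in>tangent Tot p. \<omega> p u \<in> alg (gpd B) (anc p)"
  "\<forall>p\<in>pts Tot. \<forall>u\<in>tangent Tot p. \<forall>u'\<in>tangent Tot p. \<omega> p (u + u') = \<omega> p u + \<omega> p u'"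
  "\<forall>p\<in>pts Tot. \<forall>u\<in>tangent Tot p. \<forall>r. \<omega> p (tscale r u) = tscale r (\<omega> p u)"
  "smooth_map (tangent_bundle Tot) (tangent_bundle Ar) (\<lambda>(p, u). (unit (anc p), \<omega> p u))"
  "\<forall>(p, g)\<in>act_dom B. \<forall>u\<in>tangent Tot p.
     \<omega> (act B p g) (tau B H p g u) = lam0 (gpd B) H (inver g) (\<omega> p u)"
  "\<forall>p\<in>pts Tot. \<forall>\<alpha>\<in>alg (gpd B) (anc p). \<omega> p (ddelta B p \<alpha>) = \<alpha>"
  by ((insert connection[unfolded connection_pair_def Let_def], elim conjE, assumption)[1])+

lemma ehresmann_parts:
  "smooth_subbundle Ar H"
  "\<forall>g\<in>pts Ar. H g \<subseteq> tangent Ar g \<and> (\<forall>w\<in>tangent Ar g. \<exists>!(a, b). a \<in> H g \<and> b \<in> tangent Ar g \<and>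
     diff Ar Ob src g b = 0 \<and> w = a + b)"
  "\<forall>x\<in>pts Ob. H (unit x) = diff Ob Ar unit x ` tangent Ob x"
  by ((insert connection_parts(1)[unfolded ehresmann_def], elim conjE, assumption)[1])+

lemmas atlases = lie_parts(1,2)[THEN manifold_smooth_atlas] bundle_parts(1)[THEN manifold_smooth_atlas]

lemmas charts = atlases[THEN smooth_atlas_charted]

lemmas smooth_structure = lie_parts(3)[unfolded submersion_def, THEN conjunct1]
  lie_parts(4)[unfolded submersion_def, THEN conjunct1] lie_parts(5,6) bundle_parts(4)

lemma gpd_closed:
  "g \<in> pts Ar \<Longrightarrow> src g \<in> pts Ob" "g \<in> pts Ar \<Longrightarrow> tgt g \<in> pts Ob" "x \<in> pts Ob \<Longrightarrow> unit x \<in> pts Ar"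
  "g \<in> pts Ar \<Longrightarrow> inver g \<in> pts Ar" "p \<in> pts Tot \<Longrightarrow> anc p \<in> pts Ob"
  by (rule smooth_structure[THEN smooth_onD(2)], assumption)+

lemma mult_closed:
  assumes "g \<in> pts Ar" "h \<in> pts Ar" "src g = tgt h"
  shows "mul g h \<in> pts Ar"
proof -
  have "(\<lambda>(g, h). mul g h) ` {(g, h). g \<in> pts Ar \<and> h \<in> pts Ar \<and> src g = tgt h} \<subseteq> pts Ar"
    using lie_parts(7) by (simp add: smooth_sub_def)
  then show ?thesis using assms by auto
qed

lemma gpd_laws:
  "g \<in> pts Ar \<Longrightarrow> h \<in> pts Ar \<Longrightarrow> src g = tgt h \<Longrightarrow> src (mul g h) = src h"
  "g \<in> pts Ar \<Longrightarrow> h \<in> pts Ar \<Longrightarrow> src g = tgt h \<Longrightarrow> tgt (mul g h) = tgt g"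
  "x \<in> pts Ob \<Longrightarrow> src (unit x) = x" "x \<in> pts Ob \<Longrightarrow> tgt (unit x) = x"
  "g \<in> pts Ar \<Longrightarrow> mul (unit (tgt g)) g = g" "g \<in> pts Ar \<Longrightarrow> mul g (unit (src g)) = g"
  "g \<in> pts Ar \<Longrightarrow> src (inver g) = tgt g" "g \<in> pts Ar \<Longrightarrow> tgt (inver g) = src g"
  "g \<in> pts Ar \<Longrightarrow> mul g (inver g) = unit (tgt g)" "g \<in> pts Ar \<Longrightarrow> mul (inver g) g = unit (src g)"
  using lie_parts(8,10-12) by simp_all

lemma mult_assoc:
  "g \<in> pts Ar \<Longrightarrow> h \<in> pts Ar \<Longrightarrow> k \<in> pts Ar \<Longrightarrow> src g = tgt h \<Longrightarrow> src h = tgt k \<Longrightarrow>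
    mul (mul g h) k = mul g (mul h k)"
  using lie_parts(9) by blast

lemma inverse_unique:
  assumes g: "g \<in> pts Ar" and h: "h \<in> pts Ar" and c: "src g = tgt h" and gh: "mul g h = unit (tgt g)"
  shows "h = inver g"
proof -
  have "h = mul (mul (inver g) g) h"
    using gpd_laws(5)[OF h] gpd_laws(10)[OF g] c by simp
  also have "\<dots> = mul (inver g) (mul g h)"
    by (rule mult_assoc) (use g h c gpd_closed gpd_laws(7) in auto)
  also have "\<dots> = mul (inver g) (unit (src (inver g)))"
    using gh gpd_laws(7)[OF g] by simp
  also have "\<dots> = inver g"
    by (rule gpd_laws(6)[OF gpd_closed(4)[OF g]])
  finally show ?thesis .
qed

lemma inverse_inverse: "g \<in> pts Ar \<Longrightarrow> inver (inver g) = g"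
  using inverse_unique[of "inver g" g] gpd_closed gpd_laws by simp

lemma inverse_unit:
  assumes x: "x \<in> pts Ob"
  shows "inver (unit x) = unit x"
proof -
  have "mul (unit x) (unit x) = unit x"
    using gpd_laws(5)[OF gpd_closed(3)[OF x]] gpd_laws(4)[OF x] by simp
  then show ?thesis
    using inverse_unique[of "unit x" "unit x"] gpd_closed(3)[OF x] gpd_laws(3,4)[OF x] by simp
qed

lemma inverse_mult:
  assumes g: "g \<in> pts Ar" and h: "h \<in> pts Ar" and c: "src g = tgt h"
  shows "inver (mul g h) = mul (inver h) (inver g)"
proof (rule inverse_unique[symmetric])
  note cl = gpd_closed(4)[OF g] gpd_closed(4)[OF h] mult_closed[OF g h c]
  have ci: "src (inver h) = tgt (inver g)" "src h = tgt (inver h)"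
    using gpd_laws(7,8) g h c by simp_all
  note m = mult_closed[OF cl(2,1) ci(1)]
  have tm: "tgt (mul (inver h) (inver g)) = src h"
    using gpd_laws(2)[OF cl(2,1) ci(1)] ci by simp
  show "mul g h \<in> pts Ar" "mul (inver h) (inver g) \<in> pts Ar" by fact+
  show "src (mul g h) = tgt (mul (inver h) (inver g))"
    using gpd_laws(1)[OF g h c] tm by simp
  have "mul (mul g h) (mul (inver h) (inver g)) = mul g (mul h (mul (inver h) (inver g)))"
    by (rule mult_assoc[OF g h m c]) (simp add: tm)
  also have "mul h (mul (inver h) (inver g)) = mul (mul h (inver h)) (inver g)"
    by (rule mult_assoc[symmetric, OF h cl(2,1)]) (use ci in simp_all)
  also have "\<dots> = inver g"
    using gpd_laws(9)[OF h] gpd_laws(5)[OF cl(1)] gpd_laws(8)[OF g] c by simp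
  also have "mul g (inver g) = unit (tgt (mul g h))"
    using gpd_laws(9)[OF g] gpd_laws(2)[OF g h c] by simp
  finally show "mul (mul g h) (mul (inver h) (inver g)) = unit (tgt (mul g h))" .
qed

lemma act_domD:
  assumes "(p, g) \<in> act_dom B"
  shows "p \<in> pts Tot" "g \<in> pts Ar" "anc p = tgt g"
  using assms by (simp_all add: act_dom_def)

lemma act_laws:
  assumes "(p, g) \<in> act_dom B"
  shows "act B p g \<in> pts Tot" "anc (act B p g) = src g"
    "h \<in> pts Ar \<Longrightarrow> src g = tgt h \<Longrightarrow> act B (act B p g) h = act B p (mul g h)"
    "proj B (act B p g) = proj B p"
proof -
  have "(\<lambda>(p, g). act B p g) ` act_dom B \<subseteq> pts Tot"
    using bundle_parts(5) by (simp add: smooth_sub_def)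
  then show "act B p g \<in> pts Tot"
    using assms by auto
  show "anc (act B p g) = src g" "proj B (act B p g) = proj B p"
    "h \<in> pts Ar \<Longrightarrow> src g = tgt h \<Longrightarrow> act B (act B p g) h = act B p (mul g h)"
    using bundle_parts(2,6,7) assms by fast+
qed

lemma act_unit: "p \<in> pts Tot \<Longrightarrow> act B p (unit (anc p)) = p"
  using bundle_parts(8) by simp

lemma act_dom_unit: "p \<in> pts Tot \<Longrightarrow> (p, unit (anc p)) \<in> act_dom B"
  using gpd_closed gpd_laws by (simp add: act_dom_def)

lemma act_dom_mult:
  assumes "(p, g) \<in> act_dom B" "h \<in> pts Ar" "src g = tgt h"
  shows "(act B p g, h) \<in> act_dom B" "(p, mul g h) \<in> act_dom B"
  using act_domD[OF assms(1)] act_laws[OF assms(1)] assms(2,3) mult_closed gpd_laws(2)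
  by (simp_all add: act_dom_def)

lemma act_dom_inverse:
  assumes "(p, g) \<in> act_dom B"
  shows "(act B p g, inver g) \<in> act_dom B" "act B (act B p g) (inver g) = p"
proof -
  note d = act_domD[OF assms]
  have c: "inver g \<in> pts Ar" "src g = tgt (inver g)"
    using gpd_closed(4) gpd_laws(8) d(2) by simp_all
  show "(act B p g, inver g) \<in> act_dom B"
    by (rule act_dom_mult(1)[OF assms c])
  show "act B (act B p g) (inver g) = p"
    using act_laws(3)[OF assms c] gpd_laws(9)[OF d(2)] d(3) act_unit[OF d(1)] by simp
qed

lemma act_free:
  assumes "(p, g) \<in> act_dom B" "(p, h) \<in> act_dom B" "act B p g = act B p h"
  shows "g = h"
  using inj_onD[OF bij_betw_imp_inj_on[OF bundle_parts(3)], of "(p, g)" "(p, h)"] assms by simp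

lemma act_transitive:
  assumes "p \<in> pts Tot" "q \<in> pts Tot" "proj B p = proj B q"
  obtains g where "(p, g) \<in> act_dom B" "act B p g = q"
proof -
  have "(p, q) \<in> (\<lambda>(p, g). (p, act B p g)) ` act_dom B"
    using bij_betw_imp_surj_on[OF bundle_parts(3)] assms by blast
  then show ?thesis using that by auto
qed

lemma H_tangent: "g \<in> pts Ar \<Longrightarrow> w \<in> H g \<Longrightarrow> w \<in> tangent Ar g"
  using ehresmann_parts(2) by blast

text \<open>A smooth subbundle is given fibrewise as the image of a coordinate space under the linear map
  of a local frame.\<close>

lemma H_linear:
  assumes g: "g \<in> pts Ar" and a: "a \<in> H g"
  shows "b \<in> H g \<Longrightarrow> a + b \<in> H g" "tscale c a \<in> H g"
proof -
  obtain k where k: "\<forall>x\<in>pts Ar. \<exists>W Y. x \<in> W \<and> openin (mtop Ar) W \<and>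
     (\<forall>i<k. (\<forall>y\<in>W. Y i y \<in> tangent Ar y) \<and> smooth_on Ar W (tangent_bundle Ar) (\<lambda>y. (y, Y i y))) \<and>
     (\<forall>y\<in>W. bij_betw (\<lambda>r. \<Sum>i<k. tscale (r i) (Y i y)) (Esp k) (H y))"
    using ehresmann_parts(1) unfolding smooth_subbundle_def by blast
  then obtain Y where "bij_betw (\<lambda>r. \<Sum>i<k. tscale (r i) (Y i g)) (Esp k) (H g)"
    using g by blast
  then have H: "H g = (\<lambda>r. \<Sum>i<k. tscale (r i) (Y i g)) ` Esp k"
    by (simp add: bij_betw_imp_surj_on)
  obtain r where r: "r \<in> Esp k" "a = (\<Sum>i<k. tscale (r i) (Y i g))"
    using a unfolding H by blast
  show "a + b \<in> H g" if b: "b \<in> H g"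
  proof -
    obtain s where s: "s \<in> Esp k" "b = (\<Sum>i<k. tscale (s i) (Y i g))"
      using b unfolding H by blast
    have "a + b = (\<Sum>i<k. tscale ((r + s) i) (Y i g))"
      by (simp add: r s sum.distrib[symmetric] tscale_simps(6))
    moreover have "r + s \<in> Esp k"
      using r s by (simp add: Esp_iff)
    ultimately show ?thesis unfolding H by blast
  qed
  have "tscale c (\<Sum>i<n. f i) = (\<Sum>i<n. tscale c (f i))" for f :: "nat \<Rightarrow> 'b tvec" and n :: nat
    by (induction n) (simp_all only: sum.lessThan_Suc lessThan_0 sum.empty tscale_simps)
  then have "tscale c a = (\<Sum>i<k. tscale ((\<lambda>i. c * r i) i) (Y i g))"
    by (simp add: r tscale_simps)
  moreover have "(\<lambda>i. c * r i) \<in> Esp k"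
    using r by (simp add: Esp_iff)
  ultimately show "tscale c a \<in> H g"
    unfolding H by (intro image_eqI[of _ _ "\<lambda>i. c * r i"])
qed

abbreviation "dsrc \<equiv> diff Ar Ob src"

text \<open>Existence comes from the splitting of a preimage under the submersion \<open>src\<close>, uniqueness from
  comparing the decompositions \<open>w + 0\<close> and \<open>w' + (w - w')\<close>.\<close>

lemma hlift_ex1:
  assumes g: "g \<in> pts Ar" and v: "v \<in> tangent Ob (src g)"
  shows "\<exists>!w. w \<in> H g \<and> dsrc g w = v"
proof -
  have "dsrc g ` tangent Ar g = tangent Ob (src g)"
    using lie_parts(3) g unfolding submersion_def by simp
  then have "v \<in> dsrc g ` tangent Ar g"
    using v by simp
  then obtain w where w: "w \<in> tangent Ar g" "dsrc g w = v"
    by auto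
  have dec: "\<exists>!(a, b). a \<in> H g \<and> b \<in> tangent Ar g \<and> dsrc g b = 0 \<and> w = a + b" if "w \<in> tangent Ar g" for w
    using bspec[OF bspec[OF ehresmann_parts(2) g, THEN conjunct2] that] .
  obtain a b where ab: "a \<in> H g" "dsrc g b = 0" "w = a + b"
    using ex1_implies_ex[OF dec[OF w(1)]] by auto
  have va: "dsrc g a = v"
    using diff_add[of Ar Ob src g a b] ab(2,3) w(2) by simp
  show ?thesis
  proof (rule ex1I)
    show "a \<in> H g \<and> dsrc g a = v"
      using ab va by simp
  next
    fix a' assume a': "a' \<in> H g \<and> dsrc g a' = v"
    have "dsrc g a' + dsrc g (a - a') = dsrc g a"
      unfolding diff_add[symmetric] by simp
    then have k: "dsrc g (a - a') = 0"
      using a' va by (simp only: add_cancel_left_right)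
    have T: "a \<in> tangent Ar g" "a - a' \<in> tangent Ar g"
      using H_tangent[OF g ab(1)] H_tangent[OF g, of a'] a' by (simp_all add: tangent_minus)
    have uniq: "Ex1 P \<Longrightarrow> P x \<Longrightarrow> P y \<Longrightarrow> x = y" for P :: "'b tvec \<times> 'b tvec \<Rightarrow> bool" and x y
      by blast
    have "(a, 0) = (a', a - a')"
      by (rule uniq[OF dec[OF T(1)]])
        (use ab(1) a' k T tangent_zero[of Ar g] diff_zero[of Ar Ob src g] in simp_all)
    then show "a' = a" by simp
  qed
qed


abbreviation "lift \<equiv> hlift (gpd B) H"

lemma hlift:
  assumes "g \<in> pts Ar" "v \<in> tangent Ob (src g)"
  shows "lift g v \<in> H g" "lift g v \<in> tangent Ar g" "dsrc g (lift g v) = v"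
  using theI'[OF hlift_ex1[OF assms]] H_tangent[OF assms(1)] unfolding hlift_def by blast+

lemma hlift_eq:
  assumes "g \<in> pts Ar" "v \<in> tangent Ob (src g)" "w \<in> H g" "dsrc g w = v"
  shows "lift g v = w"
  using hlift[OF assms(1,2)] hlift_ex1[OF assms(1,2)] assms(3,4) by blast

lemma hlift_linear:
  assumes g: "g \<in> pts Ar" and v: "v \<in> tangent Ob (src g)"
  shows "w \<in> tangent Ob (src g) \<Longrightarrow> lift g (v + w) = lift g v + lift g w"
    "lift g (tscale r v) = tscale r (lift g v)"
  using hlift[OF g v] hlift[OF g, of w] g v
  by (auto intro!: hlift_eq tangent_add tangent_tscale H_linear simp: diff_add diff_tscale)

lemma hlift_unit:
  assumes x: "x \<in> pts Ob" and v: "v \<in> tangent Ob x"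
  shows "lift (unit x) v = diff Ob Ar unit x v"
proof (rule hlift_eq)
  show "unit x \<in> pts Ar" "v \<in> tangent Ob (src (unit x))"
    using gpd_closed gpd_laws x v by simp_all
  show "diff Ob Ar unit x v \<in> H (unit x)"
    using ehresmann_parts(3) x v by simp
  have "dsrc (unit x) (diff Ob Ar unit x v) = diff Ob Ob (src \<circ> unit) x v"
    by (rule diff_comp[OF charts(1,2) smooth_structure(3) x smooth_structure(1) gpd_closed(3)[OF x], symmetric])
  also have "\<dots> = diff Ob Ob (\<lambda>x. x) x v"
    by (rule diff_cong[OF charts(1) openin_mtop_pts[OF atlases(1)] x]) (simp add: gpd_laws)
  also have "\<dots> = v" by (rule diff_ident[OF charts(1) x v])
  finally show "dsrc (unit x) (diff Ob Ar unit x v) = v" .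
qed

lemma lam1_closed:
  assumes g: "g \<in> pts Ar"
  shows "lam1 (gpd B) H g v \<in> tangent Ob (tgt g)"
  unfolding lam1_def by (rule diff_tangent[OF charts(2) atlases(1) smooth_structure(2) g])

lemma lam1_linear:
  assumes g: "g \<in> pts Ar" and v: "v \<in> tangent Ob (src g)"
  shows "w \<in> tangent Ob (src g) \<Longrightarrow> lam1 (gpd B) H g (v + w) = lam1 (gpd B) H g v + lam1 (gpd B) H g w"
    "lam1 (gpd B) H g (tscale r v) = tscale r (lam1 (gpd B) H g v)"
  using hlift_linear[OF assms] by (simp_all add: lam1_def diff_add diff_tscale)

lemma lam1_unit:
  assumes x: "x \<in> pts Ob" and v: "v \<in> tangent Ob x"
  shows "lam1 (gpd B) H (unit x) v = v"
proof -
  have "lam1 (gpd B) H (unit x) v = diff Ob Ob (tgt \<circ> unit) x v"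
    unfolding lam1_def hlift_unit[OF assms]
    by (rule diff_comp[OF charts(1,2) smooth_structure(3) x smooth_structure(2) gpd_closed(3)[OF x], symmetric])
  also have "\<dots> = diff Ob Ob (\<lambda>x. x) x v"
    by (rule diff_cong[OF charts(1) openin_mtop_pts[OF atlases(1)] x]) (simp add: gpd_laws)
  also have "\<dots> = v" by (rule diff_ident[OF charts(1) x v])
  finally show ?thesis .
qed

abbreviation "Prd \<equiv> prod_mfd Tot Ar"

lemma act_extension:
  assumes pg: "(p, g) \<in> act_dom B"
  obtains F W where "(p, g) \<in> W" "smooth_on Prd W Tot F" "\<forall>z\<in>act_dom B \<inter> W. F z = act B (fst z) (snd z)"
    "diff_sub Prd (act_dom B) Tot (\<lambda>(p, g). act B p g) (p, g) = diff Prd Tot F (p, g)"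
proof -
  obtain W0 F0 where "(p, g) \<in> W0" "smooth_on Prd W0 Tot F0" "\<forall>z\<in>act_dom B \<inter> W0. F0 z = (\<lambda>(p, g). act B p g) z"
    using pg bundle_parts(5) unfolding smooth_sub_def by meson
  then show ?thesis
    by (rule diff_sub_extension) (rule that, auto)
qed

text \<open>The component in the arrow manifold of the vector at which \<open>\<tau>\<close> differentiates the action.\<close>

definition tau_arrow :: "'p \<Rightarrow> 'b \<Rightarrow> 'p tvec \<Rightarrow> 'b tvec" where
  "tau_arrow p g u = diff Ar Ar inver (inver g) (lift (inver g) (diff Tot Ob anc p u))"

lemma tau_eq: "tau B H p g u = diff_sub Prd (act_dom B) Tot (\<lambda>(p, g). act B p g) (p, g)
    (tpair Tot Ar p g u (tau_arrow p g u))"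
  by (simp add: tau_def act_diff_def tau_arrow_def Let_def)

lemma tau_arrow:
  assumes pg: "(p, g) \<in> act_dom B" and u: "u \<in> tangent Tot p"
  shows "tau_arrow p g u \<in> tangent Ar g"
    "w \<in> tangent Tot p \<Longrightarrow> tau_arrow p g (u + w) = tau_arrow p g u + tau_arrow p g w"
    "tau_arrow p g (tscale r u) = tscale r (tau_arrow p g u)"
proof -
  note d = act_domD[OF pg]
  have g': "inver g \<in> pts Ar" by (rule gpd_closed(4)[OF d(2)])
  have da: "diff Tot Ob anc p w \<in> tangent Ob (src (inver g))" for w
    using diff_tangent[OF charts(3) atlases(1) smooth_structure(5) d(1)] gpd_laws(7)[OF d(2)] d(3) by simp
  show "tau_arrow p g u \<in> tangent Ar g"
    using diff_tangent[OF charts(2) atlases(2) smooth_structure(4) g'] inverse_inverse[OF d(2)]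
    unfolding tau_arrow_def by metis
  show "tau_arrow p g (u + w) = tau_arrow p g u + tau_arrow p g w"
    by (simp add: tau_arrow_def diff_add hlift_linear(1)[OF g' da da])
  show "tau_arrow p g (tscale r u) = tscale r (tau_arrow p g u)"
    by (simp add: tau_arrow_def diff_tscale hlift_linear(2)[OF g' da])
qed

lemma tau_closed:
  assumes pg: "(p, g) \<in> act_dom B"
  shows "tau B H p g u \<in> tangent Tot (act B p g)"
proof -
  obtain F W where F: "(p, g) \<in> W" "smooth_on Prd W Tot F" "\<forall>z\<in>act_dom B \<inter> W. F z = act B (fst z) (snd z)"
    and eq: "diff_sub Prd (act_dom B) Tot (\<lambda>(p, g). act B p g) (p, g) = diff Prd Tot F (p, g)"
    by (rule act_extension[OF pg])
  have "F (p, g) = act B p g"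
    using F pg by simp
  then show ?thesis
    using diff_tangent[OF prod_charted[OF atlases(3,2)] atlases(3) F(2,1)] unfolding tau_eq eq by simp
qed

lemma tau_linear:
  assumes pg: "(p, g) \<in> act_dom B" and u: "u \<in> tangent Tot p"
  shows "w \<in> tangent Tot p \<Longrightarrow> tau B H p g (u + w) = tau B H p g u + tau B H p g w"
    "tau B H p g (tscale r u) = tscale r (tau B H p g u)"
proof -
  note d = act_domD[OF pg]
  note t = tau_arrow[OF pg u]
  have *: "diff_sub Prd (act_dom B) Tot (\<lambda>(p, g). act B p g) (p, g) =
      diff Prd Tot (SOME F. \<exists>W. (p, g) \<in> W \<and> smooth_on Prd W Tot F \<and>
        (\<forall>z\<in>act_dom B \<inter> W. F z = (\<lambda>(p, g). act B p g) z)) (p, g)"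
    by (simp add: diff_sub_def fun_eq_iff)
  show "tau B H p g (u + w) = tau B H p g u + tau B H p g w" if w: "w \<in> tangent Tot p"
    unfolding tau_eq * t(2)[OF w] tpair_add[OF atlases(3,2) d(1,2) u t(1) w tau_arrow(1)[OF pg w]]
    by (rule diff_add)
  show "tau B H p g (tscale r u) = tscale r (tau B H p g u)"
    unfolding tau_eq * t(3) tpair_tscale[OF atlases(3,2) d(1,2) u t(1)]
    by (rule diff_tscale)
qed

text \<open>At a unit the vector in question is the differential of \<open>q \<mapsto> (q, 1)\<close> applied to \<open>u\<close>. This map
  stays inside the domain of the action, so any extension of the action composed with it is the
  identity.\<close>

lemma tau_unit:
  assumes p: "p \<in> pts Tot" and u: "u \<in> tangent Tot p"
  shows "tau B H p (unit (anc p)) u = u"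
proof -
  let ?x = "anc p" and ?e = "\<lambda>q. (q, unit (anc q))"
  have x: "?x \<in> pts Ob" and ux: "unit ?x \<in> pts Ar"
    using gpd_closed p by simp_all
  have pg: "(p, unit ?x) \<in> act_dom B" by (rule act_dom_unit[OF p])
  have e1: "smooth_map Tot Ar (unit \<circ> anc)"
  proof -
    have "{q \<in> pts Tot. anc q \<in> pts Ob} = pts Tot" using gpd_closed by auto
    then show ?thesis
      using smooth_on_comp[OF charts(3,1) smooth_structure(5,3)] by simp
  qed
  have e: "smooth_map Tot Prd ?e"
    using smooth_on_pair[OF charts(3) smooth_on_ident[OF atlases(3)] e1] by simp
  have v: "diff Tot Ob anc p u \<in> tangent Ob ?x"
    by (rule diff_tangent[OF charts(3) atlases(1) smooth_structure(5) p])
  have "tau_arrow p (unit ?x) u = diff Ar Ar inver (unit ?x) (diff Ob Ar unit ?x (diff Tot Ob anc p u))"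
    by (simp add: tau_arrow_def inverse_unit[OF x] hlift_unit[OF x v])
  also have "\<dots> = diff Ob Ar (inver \<circ> unit) ?x (diff Tot Ob anc p u)"
    by (rule diff_comp[OF charts(1,2) smooth_structure(3) x smooth_structure(4) ux, symmetric])
  also have "\<dots> = diff Ob Ar unit ?x (diff Tot Ob anc p u)"
    by (rule diff_cong[OF charts(1) openin_mtop_pts[OF atlases(1)] x]) (simp add: inverse_unit)
  also have "\<dots> = diff Tot Ar (unit \<circ> anc) p u"
    by (rule diff_comp[OF charts(3,1) smooth_structure(5) p smooth_structure(3) x, symmetric])
  finally have arrow: "tau_arrow p (unit ?x) u = diff Tot Ar (unit \<circ> anc) p u" .
  have ep: "?e p \<in> pts Prd" using p ux by simp
  have z: "tpair Tot Ar p (unit ?x) u (tau_arrow p (unit ?x) u) = diff Tot Prd ?e p u"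
  proof (rule tpair_eq[OF atlases(3,2) p ux u tau_arrow(1)[OF pg u]])
    show "diff Tot Prd ?e p u \<in> tangent Prd (p, unit ?x)"
      by (rule diff_tangent[OF charts(3) prod_smooth_atlas[OF atlases(3,2)] e p])
    show "diff Prd Tot fst (p, unit ?x) (diff Tot Prd ?e p u) = u"
      using diff_comp[OF charts(3) prod_charted[OF atlases(3,2)] e p smooth_fst_snd(1)[OF atlases(3,2)] ep, of u]
        diff_ident[OF charts(3) p u] by (simp add: o_def)
    show "diff Prd Ar snd (p, unit ?x) (diff Tot Prd ?e p u) = tau_arrow p (unit ?x) u"
      using diff_comp[OF charts(3) prod_charted[OF atlases(3,2)] e p smooth_fst_snd(2)[OF atlases(3,2)] ep, of u]
      by (simp add: arrow o_def)
  qed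
  obtain F W where F: "(p, unit ?x) \<in> W" "smooth_on Prd W Tot F" "\<forall>z\<in>act_dom B \<inter> W. F z = act B (fst z) (snd z)"
    and eq: "diff_sub Prd (act_dom B) Tot (\<lambda>(p, g). act B p g) (p, unit ?x) = diff Prd Tot F (p, unit ?x)"
    by (rule act_extension[OF pg])
  have "tau B H p (unit ?x) u = diff Tot Tot (F \<circ> ?e) p u"
    unfolding tau_eq eq z
    by (rule diff_comp[OF charts(3) prod_charted[OF atlases(3,2)] e p F(2,1), symmetric])
  also have "\<dots> = diff Tot Tot (\<lambda>q. q) p u"
  proof (rule diff_cong[OF charts(3)])
    show "openin (mtop Tot) {q \<in> pts Tot. ?e q \<in> W}"
      by (rule smooth_onD(1)[OF smooth_on_comp[OF charts(3) prod_charted[OF atlases(3,2)] e F(2)]])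
    show "p \<in> {q \<in> pts Tot. ?e q \<in> W}" using p F by simp
    show "(F \<circ> ?e) q = q" if "q \<in> {q \<in> pts Tot. ?e q \<in> W}" for q
      using that F(3) act_dom_unit[of q] act_unit[of q] by simp
  qed
  also have "\<dots> = u" by (rule diff_ident[OF charts(3) p u])
  finally show ?thesis .
qed

text \<open>A smooth extension of \<open>h \<mapsto> p h\<^sup>-\<^sup>1\<close> from the source fibre is obtained from an extension of
  the action near \<open>(p, 1)\<close>, composed with \<open>h \<mapsto> (p, h\<^sup>-\<^sup>1)\<close>.\<close>

lemma ddelta_closed:
  assumes p: "p \<in> pts Tot"
  shows "ddelta B p \<alpha> \<in> tangent Tot p"
proof -
  let ?x = "anc p" and ?e = "\<lambda>h. (p, inver h)"
  have x: "?x \<in> pts Ob" and ux: "unit ?x \<in> pts Ar"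
    using gpd_closed p by simp_all
  have e: "smooth_map Ar Prd ?e"
    by (rule smooth_on_pair[OF charts(2) smooth_on_const[OF atlases(2,3) p] smooth_structure(4)])
  obtain F W where F: "(p, unit ?x) \<in> W" "smooth_on Prd W Tot F" "\<forall>z\<in>act_dom B \<inter> W. F z = act B (fst z) (snd z)"
    by (rule act_extension[OF act_dom_unit[OF p]])
  have "unit ?x \<in> {h \<in> pts Ar. ?e h \<in> W}"
    using ux F(1) inverse_unit[OF x] by simp
  moreover have "smooth_on Ar {h \<in> pts Ar. ?e h \<in> W} Tot (F \<circ> ?e)"
    by (rule smooth_on_comp[OF charts(2) prod_charted[OF atlases(3,2)] e F(2)])
  moreover have "\<forall>h\<in>src_fibre (gpd B) ?x \<inter> {h \<in> pts Ar. ?e h \<in> W}. (F \<circ> ?e) h = act B p (inver h)"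
    using F(3) p gpd_closed(4) gpd_laws(8) by (auto simp: src_fibre_def act_dom_def)
  ultimately obtain F' W' where F': "unit ?x \<in> W'" "smooth_on Ar W' Tot F'"
      "\<forall>h\<in>src_fibre (gpd B) ?x \<inter> W'. F' h = act B p (inver h)"
    and eq: "diff_sub Ar (src_fibre (gpd B) ?x) Tot (\<lambda>h. act B p (inver h)) (unit ?x) = diff Ar Tot F' (unit ?x)"
    by (rule diff_sub_extension)
  have "F' (unit ?x) = p"
    using F'(1,3) ux gpd_laws(3)[OF x] inverse_unit[OF x] act_unit[OF p] by (simp add: src_fibre_def)
  then show ?thesis
    using diff_tangent[OF charts(2) atlases(3) F'(2,1), of \<alpha>] by (simp add: ddelta_def eq)
qed

lemma ddelta_linear:
  "ddelta B p (\<alpha> + \<beta>) = ddelta B p \<alpha> + ddelta B p \<beta>"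
  "ddelta B p (tscale r \<alpha>) = tscale r (ddelta B p \<alpha>)"
  by (simp_all add: ddelta_def diff_sub_def diff_add diff_tscale)

lemma omega:
  assumes p: "p \<in> pts Tot" and u: "u \<in> tangent Tot p"
  shows "\<omega> p u \<in> alg (gpd B) (anc p)"
    "w \<in> tangent Tot p \<Longrightarrow> \<omega> p (u + w) = \<omega> p u + \<omega> p w"
    "\<omega> p (tscale r u) = tscale r (\<omega> p u)"
  using connection_parts(2-4) p u by simp_all

lemma omega_tau:
  assumes "(p, g) \<in> act_dom B" "u \<in> tangent Tot p"
  shows "\<omega> (act B p g) (tau B H p g u) = lam0 (gpd B) H (inver g) (\<omega> p u)"
  using connection_parts(6) assms by fast

lemma omega_ddelta:
  assumes "p \<in> pts Tot" "\<alpha> \<in> alg (gpd B) (anc p)"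
  shows "\<omega> p (ddelta B p \<alpha>) = \<alpha>"
  using connection_parts(7) assms by simp

text \<open>The transport \<open>\<lambda>\<^sup>0\<close> inherits its properties from \<open>\<tau>\<close>: since \<open>\<omega>\<close> is equivariant and
  \<open>d\<delta>\<close> is a section of it, \<open>\<lambda>\<^sup>0\<close> is the composite of the linear maps \<open>d\<delta>\<close>, \<open>\<tau>\<close> and \<open>\<omega>\<close>.\<close>

lemma lam0_eq:
  assumes "(p, g) \<in> act_dom B" "\<alpha> \<in> alg (gpd B) (anc p)"
  shows "lam0 (gpd B) H (inver g) \<alpha> = \<omega> (act B p g) (tau B H p g (ddelta B p \<alpha>))"
  using omega_tau[OF assms(1) ddelta_closed] omega_ddelta[OF _ assms(2)] act_domD(1)[OF assms(1)] by simp

lemma alg_linear: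
  "0 \<in> alg (gpd B) x" "\<alpha> \<in> alg (gpd B) x \<Longrightarrow> \<beta> \<in> alg (gpd B) x \<Longrightarrow> \<alpha> + \<beta> \<in> alg (gpd B) x"
  "\<alpha> \<in> alg (gpd B) x \<Longrightarrow> tscale r \<alpha> \<in> alg (gpd B) x"
  by (simp_all add: alg_def diff_add diff_tscale diff_zero tangent_zero tangent_add tangent_tscale tscale_simps)

lemma lam0:
  assumes pg: "(p, g) \<in> act_dom B" and \<alpha>: "\<alpha> \<in> alg (gpd B) (anc p)"
  shows "lam0 (gpd B) H (inver g) \<alpha> \<in> alg (gpd B) (anc (act B p g))"
    "\<beta> \<in> alg (gpd B) (anc p) \<Longrightarrow>
      lam0 (gpd B) H (inver g) (\<alpha> + \<beta>) = lam0 (gpd B) H (inver g) \<alpha> + lam0 (gpd B) H (inver g) \<beta>"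
    "lam0 (gpd B) H (inver g) (tscale r \<alpha>) = tscale r (lam0 (gpd B) H (inver g) \<alpha>)"
proof -
  note dd = ddelta_closed[OF act_domD(1)[OF pg]]
  note om = omega[OF act_laws(1)[OF pg] tau_closed[OF pg]]
  show "lam0 (gpd B) H (inver g) \<alpha> \<in> alg (gpd B) (anc (act B p g))"
    unfolding lam0_eq[OF assms] by (rule om(1))
  show "lam0 (gpd B) H (inver g) (\<alpha> + \<beta>) = lam0 (gpd B) H (inver g) \<alpha> + lam0 (gpd B) H (inver g) \<beta>"
    if \<beta>: "\<beta> \<in> alg (gpd B) (anc p)"
    unfolding lam0_eq[OF assms] lam0_eq[OF pg \<beta>] lam0_eq[OF pg alg_linear(2)[OF \<alpha> \<beta>]]
      ddelta_linear tau_linear(1)[OF pg dd dd] by (rule om(2)[OF tau_closed[OF pg]])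
  show "lam0 (gpd B) H (inver g) (tscale r \<alpha>) = tscale r (lam0 (gpd B) H (inver g) \<alpha>)"
    unfolding lam0_eq[OF assms] lam0_eq[OF pg alg_linear(3)[OF \<alpha>]]
      ddelta_linear tau_linear(2)[OF pg dd] by (rule om(3))
qed

lemma lam0_unit:
  assumes p: "p \<in> pts Tot" and \<alpha>: "\<alpha> \<in> alg (gpd B) (anc p)"
  shows "lam0 (gpd B) H (inver (unit (anc p))) \<alpha> = \<alpha>"
  using lam0_eq[OF act_dom_unit[OF p] \<alpha>] act_unit[OF p] tau_unit[OF p ddelta_closed[OF p]] omega_ddelta[OF p \<alpha>]
  by simp

end


section \<open>Classes modulo the defect of the quasi-action\<close>

text \<open>The two summands of the objects are treated together, in the product of the fibres: the
  relation on them uses the same base points and arrows for both.\<close>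

locale quasi_action = bundle_with_connection B \<omega> H
  for B :: "('a, 'b, 'p, 'm) pbundle" and \<omega> :: "'p \<Rightarrow> 'p tvec \<Rightarrow> 'b tvec" and H :: "'b \<Rightarrow> 'b tvec set" +
  fixes Q :: "('p, 'b, 'q) qbundle"
  assumes fib_zero: "p \<in> pts (tot B) \<Longrightarrow> 0 \<in> fib Q p"
    and fib_add: "p \<in> pts (tot B) \<Longrightarrow> u \<in> fib Q p \<Longrightarrow> w \<in> fib Q p \<Longrightarrow> u + w \<in> fib Q p"
    and fib_tscale: "p \<in> pts (tot B) \<Longrightarrow> u \<in> fib Q p \<Longrightarrow> tscale r u \<in> fib Q p"
    and tr_closed: "(p, g) \<in> act_dom B \<Longrightarrow> u \<in> fib Q p \<Longrightarrow> tr Q p g u \<in> fib Q (act B p g)"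
    and tr_add: "(p, g) \<in> act_dom B \<Longrightarrow> u \<in> fib Q p \<Longrightarrow> w \<in> fib Q p \<Longrightarrow>
      tr Q p g (u + w) = tr Q p g u + tr Q p g w"
    and tr_tscale: "(p, g) \<in> act_dom B \<Longrightarrow> u \<in> fib Q p \<Longrightarrow> tr Q p g (tscale r u) = tscale r (tr Q p g u)"
    and tr_unit: "p \<in> pts (tot B) \<Longrightarrow> u \<in> fib Q p \<Longrightarrow> tr Q p (gunit (gpd B) (anchor B p)) u = u"
begin

definition Fib :: "'p \<Rightarrow> ('q tvec \<times> 'a tvec) set" where
  "Fib p = fib Q p \<times> tangent Ob (anc p)"

definition Tr :: "'p \<Rightarrow> 'b \<Rightarrow> 'q tvec \<times> 'a tvec \<Rightarrow> 'q tvec \<times> 'a tvec" where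
  "Tr p g z = (tr Q p g (fst z), lam1 (gpd B) H (inver g) (snd z))"

definition sc :: "real \<Rightarrow> 'q tvec \<times> 'a tvec \<Rightarrow> 'q tvec \<times> 'a tvec" where
  "sc r z = (tscale r (fst z), tscale r (snd z))"

lemma sc_simps: "- z = sc (- 1) z" "sc r (z + w) = sc r z + sc r w" "sc r (z - w) = sc r z - sc r w" "sc r 0 = 0"
proof -
  show m: "- z = sc (- 1) z" for z
    by (simp only: sc_def uminus_prod_def tscale_simps(4))
  show a: "sc r (z + w) = sc r z + sc r w" for z w
    by (simp only: sc_def tscale_simps(5) plus_prod_def fst_conv snd_conv)
  show "sc r (z - w) = sc r z - sc r w"
    using a[of "z - w" w] by (simp only: diff_add_cancel eq_diff_eq)
  show "sc r 0 = 0"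
    by (simp only: sc_def zero_prod_def fst_conv snd_conv tscale_simps)
qed

lemma Fib_linear:
  assumes p: "p \<in> pts Tot"
  shows "0 \<in> Fib p" "z \<in> Fib p \<Longrightarrow> w \<in> Fib p \<Longrightarrow> z + w \<in> Fib p" "z \<in> Fib p \<Longrightarrow> sc r z \<in> Fib p"
    "z \<in> Fib p \<Longrightarrow> w \<in> Fib p \<Longrightarrow> z - w \<in> Fib p"
proof -
  show "0 \<in> Fib p"
    using fib_zero[OF p] tangent_zero by (simp add: Fib_def zero_prod_def)
  show a: "z + w \<in> Fib p" if "z \<in> Fib p" "w \<in> Fib p" for z w
    using that fib_add[OF p] tangent_add by (auto simp: Fib_def)
  show s: "sc r z \<in> Fib p" if "z \<in> Fib p" for z r
    using that fib_tscale[OF p] tangent_tscale by (auto simp: Fib_def sc_def)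
  show "z - w \<in> Fib p" if "z \<in> Fib p" "w \<in> Fib p"
    using a[OF that(1) s[OF that(2), of "- 1"]] by (simp only: sc_simps(1)[symmetric] add_uminus_conv_diff)
qed

lemma Tr:
  assumes pg: "(p, g) \<in> act_dom B" and z: "z \<in> Fib p"
  shows "Tr p g z \<in> Fib (act B p g)" "w \<in> Fib p \<Longrightarrow> Tr p g (z + w) = Tr p g z + Tr p g w"
    "Tr p g (sc r z) = sc r (Tr p g z)" "w \<in> Fib p \<Longrightarrow> Tr p g (z - w) = Tr p g z - Tr p g w"
proof -
  note d = act_domD[OF pg]
  note g' = gpd_closed(4)[OF d(2)]
  have sg: "src (inver g) = anc p" and tg: "tgt (inver g) = anc (act B p g)"
    using gpd_laws(7,8)[OF d(2)] d(3) act_laws(2)[OF pg] by simp_all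
  show "Tr p g z \<in> Fib (act B p g)"
    using z tr_closed[OF pg] lam1_closed[OF g'] tg by (auto simp: Fib_def Tr_def)
  have a: "Tr p g (z + w) = Tr p g z + Tr p g w" if "z \<in> Fib p" "w \<in> Fib p" for z w
    using that tr_add[OF pg, of "fst z" "fst w"] lam1_linear(1)[OF g', of "snd z" "snd w"] sg
    by (simp add: Fib_def Tr_def mem_Times_iff plus_prod_def)
  from z show "w \<in> Fib p \<Longrightarrow> Tr p g (z + w) = Tr p g z + Tr p g w"
    by (rule a)
  show "Tr p g (sc r z) = sc r (Tr p g z)"
    using z tr_tscale[OF pg, of "fst z"] lam1_linear(2)[OF g', of "snd z"] sg
    by (simp add: Fib_def Tr_def mem_Times_iff sc_def)
  show "Tr p g (z - w) = Tr p g z - Tr p g w" if w: "w \<in> Fib p"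
    using a[OF Fib_linear(4)[OF d(1) z w] w] by simp
qed

lemma Tr_unit:
  assumes "p \<in> pts Tot" "z \<in> Fib p"
  shows "Tr p (unit (anc p)) z = z"
  using assms tr_unit[OF assms(1)] inverse_unit[OF gpd_closed(5)] lam1_unit[OF gpd_closed(5)]
  by (simp add: Tr_def Fib_def mem_Times_iff)

definition defect :: "'p \<Rightarrow> 'b \<Rightarrow> 'b \<Rightarrow> 'q tvec \<times> 'a tvec \<Rightarrow> 'q tvec \<times> 'a tvec" where
  "defect q g h z = Tr q (mul g h) z - Tr (act B q g) h (Tr q g z)"

text \<open>The span of the defects in the fibre over \<open>p\<close>: a defect at a multiple of a vector is the multiple
  of the defect, so sums of defects already form a subspace.\<close>

inductive_set N :: "'p \<Rightarrow> ('q tvec \<times> 'a tvec) set" for p :: 'p where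
  N_zero: "0 \<in> N p"
| N_defect: "x \<in> N p \<Longrightarrow> (q, g) \<in> act_dom B \<Longrightarrow> h \<in> pts Ar \<Longrightarrow> src g = tgt h \<Longrightarrow> z \<in> Fib q \<Longrightarrow>
    p = act B (act B q g) h \<Longrightarrow> x + defect q g h z \<in> N p"

lemma defect_Fib:
  assumes "(q, g) \<in> act_dom B" "h \<in> pts Ar" "src g = tgt h" "z \<in> Fib q"
  shows "defect q g h z \<in> Fib (act B (act B q g) h)"
proof -
  note m = act_dom_mult[OF assms(1-3)]
  have "Tr q (mul g h) z \<in> Fib (act B (act B q g) h)"
    using Tr(1)[OF m(2) assms(4)] act_laws(3)[OF assms(1-3)] by simp
  moreover have "Tr (act B q g) h (Tr q g z) \<in> Fib (act B (act B q g) h)"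
    by (rule Tr(1)[OF m(1) Tr(1)[OF assms(1,4)]])
  ultimately show ?thesis
    unfolding defect_def by (rule Fib_linear(4)[OF act_laws(1)[OF m(1)]])
qed

lemma defect_sc:
  assumes "(q, g) \<in> act_dom B" "h \<in> pts Ar" "src g = tgt h" "z \<in> Fib q"
  shows "defect q g h (sc r z) = sc r (defect q g h z)"
  using Tr(3)[OF act_dom_mult(2)[OF assms(1-3)] assms(4)] Tr(3)[OF assms(1,4)]
    Tr(3)[OF act_dom_mult(1)[OF assms(1-3)] Tr(1)[OF assms(1,4)]]
  by (simp add: defect_def sc_simps(3))

lemma N_single:
  assumes "(q, g) \<in> act_dom B" "h \<in> pts Ar" "src g = tgt h" "z \<in> Fib q" "p = act B (act B q g) h"
  shows "defect q g h z \<in> N p"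
  using N_defect[OF N_zero assms] by simp

lemma N_Fib: "p \<in> pts Tot \<Longrightarrow> x \<in> N p \<Longrightarrow> x \<in> Fib p"
  by (erule N.induct) (auto intro: Fib_linear defect_Fib)

lemma N_add: "y \<in> N p \<Longrightarrow> x \<in> N p \<Longrightarrow> x + y \<in> N p"
  by (induction rule: N.induct) (auto simp: add.assoc[symmetric] intro: N_defect)

lemma N_sc: "x \<in> N p \<Longrightarrow> p \<in> pts Tot \<Longrightarrow> sc r x \<in> N p"
proof (induction rule: N.induct)
  case N_zero
  then show ?case by (simp add: sc_simps N.N_zero)
next
  case (N_defect x q g h z)
  then show ?case
    using N.N_defect[of "sc r x" p q g h "sc r z"] Fib_linear(3)[OF act_domD(1)]
    by (simp add: sc_simps(2) defect_sc)
qed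

lemma N_minus: "p \<in> pts Tot \<Longrightarrow> x \<in> N p \<Longrightarrow> - x \<in> N p"
  using N_sc[of x p "- 1"] by (simp only: sc_simps(1))

text \<open>Transport by \<open>k\<close> sends the defect of \<open>(g, h)\<close> to a combination of the defects of \<open>(gh, k)\<close>,
  \<open>(g, hk)\<close> and \<open>(h, k)\<close>, as in the cocycle identity.\<close>

lemma Tr_defect:
  assumes qg: "(q, g) \<in> act_dom B" and h: "h \<in> pts Ar" "src g = tgt h" and z: "z \<in> Fib q"
    and k: "k \<in> pts Ar" "src h = tgt k"
  shows "Tr (act B (act B q g) h) k (defect q g h z) =
    defect q g (mul h k) z + defect (act B q g) h k (Tr q g z) - defect q (mul g h) k z"
proof -
  note d = act_domD[OF qg]
  note m = act_dom_mult[OF qg h]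
  note mk = act_dom_mult[OF m(1) k]
  have e: "act B (act B q g) h = act B q (mul g h)"
    by (rule act_laws(3)[OF qg h])
  have "Tr q (mul g h) z \<in> Fib (act B (act B q g) h)"
    using Tr(1)[OF m(2) z] e by simp
  then have "Tr (act B (act B q g) h) k (defect q g h z) =
      Tr (act B (act B q g) h) k (Tr q (mul g h) z) - Tr (act B (act B q g) h) k (Tr (act B q g) h (Tr q g z))"
    unfolding defect_def by (rule Tr(4)[OF mk(1) _ Tr(1)[OF m(1) Tr(1)[OF qg z]]])
  moreover have "mul (mul g h) k = mul g (mul h k)"
    by (rule mult_assoc[OF d(2) h(1) k(1) h(2) k(2)])
  ultimately show ?thesis
    by (simp add: defect_def e)
qed

lemma Tr_N:
  assumes "x \<in> N p" "(p, k) \<in> act_dom B"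
  shows "Tr p k x \<in> N (act B p k)"
  using assms
proof (induction rule: N.induct)
  case N_zero
  then have "Tr p k 0 = 0"
    using Tr(4)[of p k 0 0] Fib_linear(1) act_domD(1) by simp
  then show ?case by (simp add: N.N_zero)
next
  case (N_defect x q g h z)
  note qg = N_defect.hyps(2) and h = N_defect.hyps(3,4) and z = N_defect.hyps(5) and p = N_defect.hyps(6)
  note d = act_domD[OF N_defect.prems]
  note m = act_dom_mult[OF qg h]
  have k: "k \<in> pts Ar" "src h = tgt k"
    using d act_laws(2)[OF m(1)] p by simp_all
  have hk: "mul h k \<in> pts Ar" "src g = tgt (mul h k)" "src (mul g h) = tgt k"
    using mult_closed[OF h(1) k] gpd_laws(1)[OF act_domD(2)[OF qg] h] gpd_laws(2)[OF h(1) k] h k by simp_all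
  have e: "act B (act B q g) h = act B q (mul g h)" "act B (act B q g) (mul h k) = act B p k"
    using act_laws(3)[OF qg h] act_laws(3)[OF m(1) k] p by simp_all
  note pk = act_laws(1)[OF N_defect.prems]
  have "defect q g (mul h k) z \<in> N (act B p k)"
    by (rule N_single[OF qg hk(1,2) z]) (simp add: e)
  moreover have "defect (act B q g) h k (Tr q g z) \<in> N (act B p k)"
    by (rule N_single[OF m(1) k Tr(1)[OF qg z]]) (simp add: p)
  moreover have "- defect q (mul g h) k z \<in> N (act B p k)"
    by (rule N_minus[OF pk N_single[OF m(2) k(1) hk(3) z]]) (simp add: p e(1))
  ultimately have "Tr p k (defect q g h z) \<in> N (act B p k)"
    unfolding p Tr_defect[OF qg h z k] diff_conv_add_uminus by (intro N_add)
  moreover have "Tr p k (x + defect q g h z) = Tr p k x + Tr p k (defect q g h z)"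
    using Tr(2)[OF N_defect.prems N_Fib[OF d(1) N_defect.hyps(1)]] defect_Fib[OF qg h z] p by simp
  ultimately show ?case
    using N_add N_defect.IH[OF N_defect.prems] by simp
qed

lemma qrel_iff_N:
  "qrel B H Q (p, z) (p', z') \<longleftrightarrow> p' = p \<and> z - z' \<in> N p"
proof -
  define D where "D = (\<lambda>w. \<exists>n ps gs hs zs. (\<forall>i<n::nat. (ps i, gs i) \<in> act_dom B \<and> hs i \<in> pts Ar \<and>
     src (gs i) = tgt (hs i) \<and> zs i \<in> Fib (ps i) \<and> p = act B (act B (ps i) (gs i)) (hs i)) \<and>
     w = (\<Sum>i<n. defect (ps i) (gs i) (hs i) (zs i)))"
  have D_N: "D w \<longleftrightarrow> w \<in> N p" for w
  proof
    assume "D w"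
    then obtain n ps gs hs zs where *: "\<forall>i<n::nat. (ps i, gs i) \<in> act_dom B \<and> hs i \<in> pts Ar \<and>
       src (gs i) = tgt (hs i) \<and> zs i \<in> Fib (ps i) \<and> p = act B (act B (ps i) (gs i)) (hs i)"
      and w: "w = (\<Sum>i<n. defect (ps i) (gs i) (hs i) (zs i))"
      unfolding D_def by blast
    have "k \<le> n \<Longrightarrow> (\<Sum>i<k. defect (ps i) (gs i) (hs i) (zs i)) \<in> N p" for k
    proof (induction k)
      case (Suc k)
      then show ?case
        using N_defect[of "\<Sum>i<k. defect (ps i) (gs i) (hs i) (zs i)" p "ps k" "gs k" "hs k" "zs k"]
          *[rule_format, of k] by simp
    qed (simp add: N_zero)
    then show "w \<in> N p" using w by simp
  next
    assume "w \<in> N p"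
    then show "D w"
    proof (induction rule: N.induct)
      case N_zero
      show ?case unfolding D_def by (intro exI[of _ 0]) simp
    next
      case (N_defect x q g h z)
      then obtain n ps gs hs zs where *: "\<forall>i<n::nat. (ps i, gs i) \<in> act_dom B \<and> hs i \<in> pts Ar \<and>
         src (gs i) = tgt (hs i) \<and> zs i \<in> Fib (ps i) \<and> p = act B (act B (ps i) (gs i)) (hs i)"
        and x: "x = (\<Sum>i<n. defect (ps i) (gs i) (hs i) (zs i))"
        unfolding D_def by blast
      show ?case
        unfolding D_def
        by (intro exI[of _ "Suc n"] exI[of _ "ps(n := q)"] exI[of _ "gs(n := g)"] exI[of _ "hs(n := h)"]
            exI[of _ "zs(n := z)"])
          (use * x N_defect.hyps in \<open>auto simp: less_Suc_eq intro!: sum.cong\<close>)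
    qed
  qed
  have inv: "inver (mul g h) = mul (inver h) (inver g)"
    if "(q, g) \<in> act_dom B" "h \<in> pts Ar" "src g = tgt h" for q g h
    using inverse_mult[OF act_domD(2)[OF that(1)] that(2,3)] .
  have "qrel B H Q (p, z) (p', z') \<longleftrightarrow> p' = p \<and> D (z - z')"
  proof (cases z; cases z')
    fix u v u' v' assume zz: "z = (u, v)" "z' = (u', v')"
    have "(\<exists>ps gs hs us vs. (\<forall>i<n::nat. (ps i, gs i) \<in> act_dom B \<and> hs i \<in> pts Ar \<and> src (gs i) = tgt (hs i) \<and>
            us i \<in> fib Q (ps i) \<and> vs i \<in> tangent Ob (anc (ps i)) \<and> p = act B (act B (ps i) (gs i)) (hs i)) \<and>
         u - u' = (\<Sum>i<n. tr Q (ps i) (mul (gs i) (hs i)) (us i)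
                          - tr Q (act B (ps i) (gs i)) (hs i) (tr Q (ps i) (gs i) (us i))) \<and>
         v - v' = (\<Sum>i<n. lam1 (gpd B) H (mul (inver (hs i)) (inver (gs i))) (vs i)
                          - lam1 (gpd B) H (inver (hs i)) (lam1 (gpd B) H (inver (gs i)) (vs i)))) \<longleftrightarrow>
       (\<exists>ps gs hs zs. (\<forall>i<n. (ps i, gs i) \<in> act_dom B \<and> hs i \<in> pts Ar \<and>
         src (gs i) = tgt (hs i) \<and> zs i \<in> Fib (ps i) \<and> p = act B (act B (ps i) (gs i)) (hs i)) \<and>
         z - z' = (\<Sum>i<n. defect (ps i) (gs i) (hs i) (zs i)))" (is "?L = ?R") for n
    proof
      assume ?L
      then obtain ps gs hs us vs where 1: "\<forall>i<n. (ps i, gs i) \<in> act_dom B \<and> hs i \<in> pts Ar \<and> src (gs i) = tgt (hs i) \<and>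
            us i \<in> fib Q (ps i) \<and> vs i \<in> tangent Ob (anc (ps i)) \<and> p = act B (act B (ps i) (gs i)) (hs i)"
        and 2: "u - u' = (\<Sum>i<n. tr Q (ps i) (mul (gs i) (hs i)) (us i)
                          - tr Q (act B (ps i) (gs i)) (hs i) (tr Q (ps i) (gs i) (us i)))"
         "v - v' = (\<Sum>i<n. lam1 (gpd B) H (mul (inver (hs i)) (inver (gs i))) (vs i)
                          - lam1 (gpd B) H (inver (hs i)) (lam1 (gpd B) H (inver (gs i)) (vs i)))"
        by blast
      have I: "inver (mul (gs i) (hs i)) = mul (inver (hs i)) (inver (gs i))" if "i < n" for i
        using 1 inv that by blast
      have "z - z' = (\<Sum>i<n. defect (ps i) (gs i) (hs i) (us i, vs i))"
        unfolding zz prod_eq_iff fst_sum snd_sum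
        by (simp add: 2 defect_def Tr_def) (rule sum.cong, simp, simp add: I)
      then show ?R
        using 1 by (intro exI[of _ ps] exI[of _ gs] exI[of _ hs] exI[of _ "\<lambda>i. (us i, vs i)"]) (simp add: Fib_def)
    next
      assume ?R
      then obtain ps gs hs zs where 1: "\<forall>i<n. (ps i, gs i) \<in> act_dom B \<and> hs i \<in> pts Ar \<and>
         src (gs i) = tgt (hs i) \<and> zs i \<in> Fib (ps i) \<and> p = act B (act B (ps i) (gs i)) (hs i)"
        and 2: "z - z' = (\<Sum>i<n. defect (ps i) (gs i) (hs i) (zs i))"
        by blast
      have 3: "u - u' = (\<Sum>i<n. fst (defect (ps i) (gs i) (hs i) (zs i)))"
        "v - v' = (\<Sum>i<n. snd (defect (ps i) (gs i) (hs i) (zs i)))"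
        using arg_cong[OF 2, of fst] arg_cong[OF 2, of snd] unfolding zz fst_sum snd_sum by simp_all
      have I: "inver (mul (gs i) (hs i)) = mul (inver (hs i)) (inver (gs i))" if "i < n" for i
        using 1 inv that by blast
      show ?L
      proof (intro exI conjI)
        show "\<forall>i<n. (ps i, gs i) \<in> act_dom B \<and> hs i \<in> pts Ar \<and> src (gs i) = tgt (hs i) \<and>
            fst (zs i) \<in> fib Q (ps i) \<and> snd (zs i) \<in> tangent Ob (anc (ps i)) \<and>
            p = act B (act B (ps i) (gs i)) (hs i)"
          using 1 by (simp add: Fib_def mem_Times_iff)
      qed (unfold 3, rule sum.cong, simp, simp add: defect_def Tr_def,
          rule sum.cong, simp, simp add: defect_def Tr_def I)
    qed
    then show ?thesis
      unfolding qrel_def D_def zz Let_def split by simp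
  qed
  then show ?thesis by (simp add: D_N)
qed

end


section \<open>The groupoid of classes and its isomorphism classes\<close>

context quasi_action
begin

abbreviation "cls p z \<equiv> qcls B H Q (p, z)"

lemma qtot_iff: "(p, z) \<in> qtot B Q \<longleftrightarrow> p \<in> pts Tot \<and> z \<in> Fib p"
  by (cases z) (simp add: qtot_def Fib_def)

lemma mem_cls: "(q, w) \<in> cls p z \<longleftrightarrow> q = p \<and> p \<in> pts Tot \<and> w \<in> Fib p \<and> z - w \<in> N p"
  unfolding qcls_def mem_Collect_eq qtot_iff qrel_iff_N by blast

lemma cls_eqI:
  assumes p: "p \<in> pts Tot" and zw: "z - w \<in> N p"
  shows "cls p z = cls p w"
proof (rule set_eqI)
  fix x :: "'p \<times> 'q tvec \<times> 'a tvec"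
  obtain q y where x: "x = (q, y)" by (cases x)
  have "z - y \<in> N p \<longleftrightarrow> w - y \<in> N p"
    using N_add[OF zw, of "w - y"] N_add[OF N_minus[OF p zw], of "z - y"]
    by (auto simp: algebra_simps)
  then show "x \<in> cls p z \<longleftrightarrow> x \<in> cls p w"
    unfolding x mem_cls by blast
qed

lemma rep_cls:
  assumes p: "p \<in> pts Tot" and z: "z \<in> Fib p"
  obtains w where "rep (cls p z) = (p, w)" "w \<in> Fib p" "z - w \<in> N p"
proof -
  have "(p, z) \<in> cls p z"
    using p z by (simp add: mem_cls N_zero)
  then have "rep (cls p z) \<in> cls p z"
    unfolding rep_def by (rule someI)
  then show ?thesis
    using that by (cases "rep (cls p z)") (auto simp: mem_cls)
qed

lemma bpt_cls: "p \<in> pts Tot \<Longrightarrow> z \<in> Fib p \<Longrightarrow> bpt (cls p z) = p"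
  by (rule rep_cls[of p z]) (simp_all add: bpt_def)

lemma qobjs_iff: "C \<in> qobjs B H Q \<longleftrightarrow> (\<exists>p z. p \<in> pts Tot \<and> z \<in> Fib p \<and> C = cls p z)"
proof
  assume "C \<in> qobjs B H Q"
  then obtain x where "x \<in> qtot B Q" "C = qcls B H Q x"
    by (auto simp: qobjs_def)
  then show "\<exists>p z. p \<in> pts Tot \<and> z \<in> Fib p \<and> C = cls p z"
    using qtot_iff[of "fst x" "snd x"] by (intro exI[of _ "fst x"] exI[of _ "snd x"]) simp
next
  assume "\<exists>p z. p \<in> pts Tot \<and> z \<in> Fib p \<and> C = cls p z"
  then show "C \<in> qobjs B H Q"
    using qtot_iff by (auto simp: qobjs_def)
qed

lemma qcod_cls:
  assumes pg: "(p, g) \<in> act_dom B" and z: "z \<in> Fib p"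
  shows "qcod B H Q (cls p z, g) = cls (act B p g) (Tr p g z)"
proof -
  note p = act_domD(1)[OF pg]
  obtain w where w: "rep (cls p z) = (p, w)" "w \<in> Fib p" "z - w \<in> N p"
    by (rule rep_cls[OF p z])
  have "qcod B H Q (cls p z, g) = cls (act B p g) (Tr p g w)"
    using w(1) by (cases w) (simp add: qcod_def Tr_def)
  also have "\<dots> = cls (act B p g) (Tr p g z)"
    using Tr_N[OF w(3) pg] Tr(4)[OF pg z w(2)]
    by (intro cls_eqI[symmetric] act_laws(1)[OF pg]) simp
  finally show ?thesis .
qed

lemma qadd_cls:
  assumes p: "p \<in> pts Tot" and z: "z \<in> Fib p" "z' \<in> Fib p"
  shows "qadd B H Q (cls p z) (cls p z') = cls p (z + z')"
proof -
  obtain w where w: "rep (cls p z) = (p, w)" "w \<in> Fib p" "z - w \<in> N p"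
    by (rule rep_cls[OF p z(1)])
  obtain w' where w': "rep (cls p z') = (p, w')" "w' \<in> Fib p" "z' - w' \<in> N p"
    by (rule rep_cls[OF p z(2)])
  have "qadd B H Q (cls p z) (cls p z') = cls p (w + w')"
    using w(1) w'(1) by (cases w; cases w') (simp add: qadd_def)
  also have "\<dots> = cls p (z + z')"
    using N_add[OF w(3) w'(3)] by (intro cls_eqI[symmetric] p) (simp add: algebra_simps)
  finally show ?thesis .
qed

lemma qscale_cls:
  assumes p: "p \<in> pts Tot" and z: "z \<in> Fib p"
  shows "qscale B H Q r (cls p z) = cls p (sc r z)"
proof -
  obtain w where w: "rep (cls p z) = (p, w)" "w \<in> Fib p" "z - w \<in> N p"
    by (rule rep_cls[OF p z])
  have "qscale B H Q r (cls p z) = cls p (sc r w)"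
    using w(1) by (cases w) (simp add: qscale_def sc_def)
  also have "\<dots> = cls p (sc r z)"
    using N_sc[OF w(3) p, of r] by (intro cls_eqI[symmetric] p) (simp add: sc_simps(3))
  finally show ?thesis .
qed

text \<open>The difference of the two sides is a single defect, so on classes the quasi-action becomes an
  action.\<close>

lemma cls_Tr_mult:
  assumes pg: "(p, g) \<in> act_dom B" and h: "h \<in> pts Ar" "src g = tgt h" and z: "z \<in> Fib p"
  shows "cls (act B (act B p g) h) (Tr (act B p g) h (Tr p g z)) = cls (act B p (mul g h)) (Tr p (mul g h) z)"
  unfolding act_laws(3)[OF pg h, symmetric]
  using N_single[OF pg h z refl]
  by (intro cls_eqI[symmetric] act_laws(1)[OF act_dom_mult(1)[OF pg h]]) (simp add: defect_def)

lemma cls_Tr_inverse: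
  assumes pg: "(p, g) \<in> act_dom B" and z: "z \<in> Fib p"
  shows "cls (act B (act B p g) (inver g)) (Tr (act B p g) (inver g) (Tr p g z)) = cls p z"
proof -
  note d = act_domD[OF pg]
  have i: "inver g \<in> pts Ar" "src g = tgt (inver g)"
    using gpd_closed(4)[OF d(2)] gpd_laws(8)[OF d(2)] by simp_all
  have "mul g (inver g) = unit (anc p)"
    using gpd_laws(9)[OF d(2)] d(3) by simp
  then show ?thesis
    using cls_Tr_mult[OF pg i z] act_unit[OF d(1)] Tr_unit[OF d(1) z] by simp
qed

lemma qcat_simps:
  "Obj (qcat B H Q) = qobjs B H Q" "Arr (qcat B H Q) = qarrs B H Q" "Dom (qcat B H Q) = fst"
  "Cod (qcat B H Q) = qcod B H Q" "Idn (qcat B H Q) C = (C, unit (anc (bpt C)))"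
  "Cmp (qcat B H Q) f' f = (fst f, mul (snd f) (snd f'))"
  "ObjD (qcat B H Q) = quot_plot (qtot_plot B Q) (qcls B H Q)"
  "ArrD (qcat B H Q) n U k \<longleftrightarrow> k ` U \<subseteq> qarrs B H Q \<and>
     quot_plot (qtot_plot B Q) (qcls B H Q) n U (\<lambda>x. fst (k x)) \<and> mfd_plot Ar n U (\<lambda>x. snd (k x))"
  by (simp_all add: qcat_def Let_def)

lemma qarrs_iff:
  "(C, g) \<in> qarrs B H Q \<longleftrightarrow> (\<exists>p z. (p, g) \<in> act_dom B \<and> z \<in> Fib p \<and> C = cls p z)"
proof
  assume "(C, g) \<in> qarrs B H Q"
  then have "C \<in> qobjs B H Q" "(bpt C, g) \<in> act_dom B"
    by (simp_all add: qarrs_def)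
  then show "\<exists>p z. (p, g) \<in> act_dom B \<and> z \<in> Fib p \<and> C = cls p z"
    using bpt_cls unfolding qobjs_iff by metis
next
  assume "\<exists>p z. (p, g) \<in> act_dom B \<and> z \<in> Fib p \<and> C = cls p z"
  then obtain p z where *: "(p, g) \<in> act_dom B" "z \<in> Fib p" "C = cls p z"
    by blast
  then have "C \<in> qobjs B H Q" "bpt C = p"
    using act_domD(1)[OF *(1)] bpt_cls qobjs_iff by blast+
  then show "(C, g) \<in> qarrs B H Q"
    using *(1) by (simp add: qarrs_def)
qed

text \<open>Every arrow is invertible: transport back along the inverse arrow gives the class of the
  original vector, by the action property on classes and the unit law.\<close>

lemma isomorphic_iff:
  assumes p: "p \<in> pts Tot" and z: "z \<in> Fib p"
  shows "isomorphic (qcat B H Q) (cls p z) D \<longleftrightarrow> (\<exists>g. (p, g) \<in> act_dom B \<and> D = cls (act B p g) (Tr p g z))"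
proof
  assume "isomorphic (qcat B H Q) (cls p z) D"
  then obtain f where f: "f \<in> qarrs B H Q" "fst f = cls p z" "qcod B H Q f = D"
    unfolding isomorphic_def qcat_simps by blast
  then have "(cls p z, snd f) \<in> qarrs B H Q"
    by (metis prod.collapse)
  then have pg: "(p, snd f) \<in> act_dom B"
    using bpt_cls[OF p z] by (simp add: qarrs_def)
  have "D = qcod B H Q (cls p z, snd f)"
    using f by (metis prod.collapse)
  then show "\<exists>g. (p, g) \<in> act_dom B \<and> D = cls (act B p g) (Tr p g z)"
    using pg qcod_cls[OF pg z] by blast
next
  assume "\<exists>g. (p, g) \<in> act_dom B \<and> D = cls (act B p g) (Tr p g z)"
  then obtain g where pg: "(p, g) \<in> act_dom B" and D: "D = cls (act B p g) (Tr p g z)"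
    by blast
  note d = act_domD[OF pg]
  note q = act_laws(1)[OF pg] and z' = Tr(1)[OF pg z]
  show "isomorphic (qcat B H Q) (cls p z) D"
    unfolding isomorphic_def qcat_simps
  proof (rule bexI[of _ "(cls p z, g)"], rule bexI[of _ "(D, inver g)"], intro conjI)
    show "(cls p z, g) \<in> qarrs B H Q"
      using pg z qarrs_iff by blast
    show "(D, inver g) \<in> qarrs B H Q"
      using act_dom_inverse(1)[OF pg] z' D qarrs_iff by blast
    show "qcod B H Q (cls p z, g) = D"
      using qcod_cls[OF pg z] D by simp
    show "qcod B H Q (D, inver g) = cls p z"
      using qcod_cls[OF act_dom_inverse(1)[OF pg] z'] cls_Tr_inverse[OF pg z] D by simp
    show "(fst (cls p z, g), mul (snd (cls p z, g)) (snd (D, inver g))) = (cls p z, unit (anc (bpt (cls p z))))"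
      using gpd_laws(9)[OF d(2)] d(3) bpt_cls[OF p z] by simp
    show "(fst (D, inver g), mul (snd (D, inver g)) (snd (cls p z, g))) = (D, unit (anc (bpt D)))"
      using gpd_laws(10)[OF d(2)] bpt_cls[OF q z'] D act_laws(2)[OF pg] by simp
  qed simp_all
qed

abbreviation "iso_cls p z \<equiv> isoclass (qcat B H Q) (cls p z)"

lemma mem_isoclass:
  assumes p: "p \<in> pts Tot" and z: "z \<in> Fib p"
  shows "D \<in> iso_cls p z \<longleftrightarrow> (\<exists>g. (p, g) \<in> act_dom B \<and> D = cls (act B p g) (Tr p g z))"
  using isomorphic_iff[OF p z] act_laws(1) Tr(1)[OF _ z]
  unfolding isoclass_def qcat_simps qobjs_iff by blast

lemma isoclass_Tr:
  assumes pg: "(p, g) \<in> act_dom B" and z: "z \<in> Fib p"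
  shows "iso_cls (act B p g) (Tr p g z) = iso_cls p z"
proof (rule set_eqI)
  fix D
  note d = act_domD[OF pg]
  note q = act_laws(1)[OF pg] and z' = Tr(1)[OF pg z]
  show "D \<in> iso_cls (act B p g) (Tr p g z) \<longleftrightarrow> D \<in> iso_cls p z"
    unfolding mem_isoclass[OF q z'] mem_isoclass[OF d(1) z]
  proof
    assume "\<exists>h. (act B p g, h) \<in> act_dom B \<and> D = cls (act B (act B p g) h) (Tr (act B p g) h (Tr p g z))"
    then obtain h where h: "(act B p g, h) \<in> act_dom B" and D: "D = cls (act B (act B p g) h) (Tr (act B p g) h (Tr p g z))"
      by blast
    have c: "h \<in> pts Ar" "src g = tgt h"
      using act_domD[OF h] act_laws(2)[OF pg] by simp_all
    show "\<exists>g. (p, g) \<in> act_dom B \<and> D = cls (act B p g) (Tr p g z)"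
      using act_dom_mult(2)[OF pg c] cls_Tr_mult[OF pg c z] D by metis
  next
    assume "\<exists>k. (p, k) \<in> act_dom B \<and> D = cls (act B p k) (Tr p k z)"
    then obtain k where k: "(p, k) \<in> act_dom B" and D: "D = cls (act B p k) (Tr p k z)"
      by blast
    obtain h where h: "(act B p g, h) \<in> act_dom B" "act B (act B p g) h = act B p k"
      using act_transitive[OF q act_laws(1)[OF k]] act_laws(4)[OF pg] act_laws(4)[OF k] by metis
    have c: "h \<in> pts Ar" "src g = tgt h"
      using act_domD[OF h(1)] act_laws(2)[OF pg] by simp_all
    have "mul g h = k"
      by (rule act_free[OF act_dom_mult(2)[OF pg c] k]) (use h(2) act_laws(3)[OF pg c] in simp)
    then show "\<exists>h. (act B p g, h) \<in> act_dom B \<and> D = cls (act B (act B p g) h) (Tr (act B p g) h (Tr p g z))"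
      using h(1) D cls_Tr_mult[OF pg c z] by metis
  qed
qed

lemma some_isoclass:
  assumes p: "p \<in> pts Tot" and z: "z \<in> Fib p"
  obtains g where "(p, g) \<in> act_dom B" "(SOME C. C \<in> iso_cls p z) = cls (act B p g) (Tr p g z)"
proof -
  have "\<exists>C. C \<in> iso_cls p z"
    using mem_isoclass[OF p z] act_dom_unit[OF p] by blast
  then have "(SOME C. C \<in> iso_cls p z) \<in> iso_cls p z"
    by (rule someI_ex)
  then show ?thesis
    using that unfolding mem_isoclass[OF p z] by blast
qed

lemma conn_scale_isoclass:
  assumes p: "p \<in> pts Tot" and z: "z \<in> Fib p"
  shows "conn_scale B H Q r (iso_cls p z) = iso_cls p (sc r z)"
proof -
  obtain g where g: "(p, g) \<in> act_dom B" "(SOME C. C \<in> iso_cls p z) = cls (act B p g) (Tr p g z)"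
    by (rule some_isoclass[OF p z])
  have "conn_scale B H Q r (iso_cls p z) = iso_cls (act B p g) (Tr p g (sc r z))"
    unfolding conn_scale_def g(2) qscale_cls[OF act_laws(1)[OF g(1)] Tr(1)[OF g(1) z]] Tr(3)[OF g(1) z] ..
  also have "\<dots> = iso_cls p (sc r z)"
    by (rule isoclass_Tr[OF g(1) Fib_linear(3)[OF p z]])
  finally show ?thesis .
qed

text \<open>The representatives chosen in the definition of the sum are translates by some \<open>g\<close> and
  \<open>g'\<close>; since the action is free, the arrow joining their base points is the one for which
  everything is the translate by \<open>g'\<close> of the sum formed at \<open>pk\<close>.\<close>

lemma conn_add_isoclass:
  assumes pk: "(p, k) \<in> act_dom B" and z: "z \<in> Fib p" and w: "w \<in> Fib (act B p k)"
  shows "conn_add B H Q (iso_cls p z) (iso_cls (act B p k) w) = iso_cls (act B p k) (Tr p k z + w)"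
proof -
  let ?q = "act B p k"
  note p = act_domD(1)[OF pk] and q = act_laws(1)[OF pk]
  obtain g where g: "(p, g) \<in> act_dom B" "(SOME C. C \<in> iso_cls p z) = cls (act B p g) (Tr p g z)"
    by (rule some_isoclass[OF p z])
  obtain g' where g': "(?q, g') \<in> act_dom B" "(SOME C. C \<in> iso_cls ?q w) = cls (act B ?q g') (Tr ?q g' w)"
    by (rule some_isoclass[OF q w])
  let ?p1 = "act B p g" and ?q1 = "act B ?q g'"
  note p1 = act_laws(1)[OF g(1)] and q1 = act_laws(1)[OF g'(1)]
  note z1 = Tr(1)[OF g(1) z] and w1 = Tr(1)[OF g'(1) w] and kz = Tr(1)[OF pk z]
  obtain h where h: "(?p1, h) \<in> act_dom B" "act B ?p1 h = ?q1"
    using act_transitive[OF p1 q1] act_laws(4)[OF g(1)] act_laws(4)[OF g'(1)] act_laws(4)[OF pk] by metis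
  have the: "(THE h. (bpt (cls ?p1 (Tr p g z)), h) \<in> act_dom B \<and> act B (bpt (cls ?p1 (Tr p g z))) h = bpt (cls ?q1 (Tr ?q g' w))) = h"
    unfolding bpt_cls[OF p1 z1] bpt_cls[OF q1 w1]
    by (rule the_equality) (use h act_free in auto)
  have c: "h \<in> pts Ar" "src g = tgt h" and c': "g' \<in> pts Ar" "src k = tgt g'"
    using act_domD[OF h(1)] act_laws(2)[OF g(1)] act_domD[OF g'(1)] act_laws(2)[OF pk] by simp_all
  have gh: "mul g h = mul k g'"
    by (rule act_free[OF act_dom_mult(2)[OF g(1) c] act_dom_mult(2)[OF pk c']])
      (use h(2) act_laws(3)[OF g(1) c] act_laws(3)[OF pk c'] in simp)
  have cod: "qcod B H Q (cls ?p1 (Tr p g z), h) = cls ?q1 (Tr ?q g' (Tr p k z))"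
    using qcod_cls[OF h(1) z1] cls_Tr_mult[OF g(1) c z] cls_Tr_mult[OF pk c' z] gh by simp
  have "conn_add B H Q (iso_cls p z) (iso_cls ?q w) = iso_cls ?q1 (Tr ?q g' (Tr p k z + w))"
    unfolding conn_add_def Let_def g(2) g'(2) the cod
      qadd_cls[OF q1 Tr(1)[OF g'(1) kz] w1] Tr(2)[OF g'(1) kz w] ..
  also have "\<dots> = iso_cls ?q (Tr p k z + w)"
    by (rule isoclass_Tr[OF g'(1) Fib_linear(2)[OF q kz w]])
  finally show ?thesis .
qed

lemma qconn_iff:
  "K \<in> qconn B H Q m \<longleftrightarrow> (\<exists>p z. p \<in> pts Tot \<and> z \<in> Fib p \<and> proj B p = m \<and> K = iso_cls p z)"
  unfolding qconn_def image_iff Bex_def mem_Collect_eq qobjs_iff using bpt_cls by metis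

end


section \<open>The functor of a connection pair\<close>

context bundle_with_connection
begin

lemma At_quasi_action: "quasi_action B \<omega> H (At_q B H)"
proof unfold_locales
  fix p g u w r
  assume pg: "(p, g) \<in> act_dom B"
  show "tr (At_q B H) p g u \<in> fib (At_q B H) (act B p g)"
    using tau_closed[OF pg] by (simp add: At_q_def)
  assume u: "u \<in> fib (At_q B H) p"
  show "tr (At_q B H) p g (tscale r u) = tscale r (tr (At_q B H) p g u)"
    using tau_linear(2)[OF pg] u by (simp add: At_q_def)
  assume "w \<in> fib (At_q B H) p"
  then show "tr (At_q B H) p g (u + w) = tr (At_q B H) p g u + tr (At_q B H) p g w"
    using tau_linear(1)[OF pg] u by (simp add: At_q_def)
qed (simp_all add: At_q_def tangent_zero tangent_add tangent_tscale tau_unit)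

lemma Ad_quasi_action: "quasi_action B \<omega> H (Ad_q B H)"
proof unfold_locales
  fix p g u w r
  assume pg: "(p, g) \<in> act_dom B" and u: "u \<in> fib (Ad_q B H) p"
  show "tr (Ad_q B H) p g u \<in> fib (Ad_q B H) (act B p g)"
    using lam0(1)[OF pg] u by (simp add: Ad_q_def)
  show "tr (Ad_q B H) p g (tscale r u) = tscale r (tr (Ad_q B H) p g u)"
    using lam0(3)[OF pg] u by (simp add: Ad_q_def)
  assume "w \<in> fib (Ad_q B H) p"
  then show "tr (Ad_q B H) p g (u + w) = tr (Ad_q B H) p g u + tr (Ad_q B H) p g w"
    using lam0(2)[OF pg] u by (simp add: Ad_q_def)
qed (simp_all add: Ad_q_def alg_linear lam0_unit)

end

lemma qbundle_simps:
  "amb (At_q B H) = tot B" "pt (At_q B H) p = p" "fib (At_q B H) = tangent (tot B)" "tr (At_q B H) = tau B H"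
  "amb (Ad_q B H) = X1 (gpd B)" "pt (Ad_q B H) p = gunit (gpd B) (anchor B p)"
  "fib (Ad_q B H) p = alg (gpd B) (anchor B p)" "tr (Ad_q B H) p g = lam0 (gpd B) H (ginv (gpd B) g)"
  by (simp_all add: At_q_def Ad_q_def)

locale connection_functor = bundle_with_connection B \<omega> H +
    At: quasi_action B \<omega> H "At_q B H" + Ad: quasi_action B \<omega> H "Ad_q B H"
  for B :: "('a, 'b, 'p, 'm) pbundle" and \<omega> :: "'p \<Rightarrow> 'p tvec \<Rightarrow> 'b tvec" and H :: "'b \<Rightarrow> 'b tvec set"
begin

definition \<Phi> :: "'p \<Rightarrow> 'p tvec \<times> 'a tvec \<Rightarrow> 'b tvec \<times> 'a tvec" where
  "\<Phi> p z = (\<omega> p (fst z), snd z)"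

definition F0 :: "('a, 'p, 'p) qobj \<Rightarrow> ('a, 'p, 'b) qobj" where
  "F0 C = qcls B H (Ad_q B H) (fst (rep C), \<Phi> (fst (rep C)) (snd (rep C)))"

definition F1 :: "('a, 'p, 'p) qobj \<times> 'b \<Rightarrow> ('a, 'p, 'b) qobj \<times> 'b" where
  "F1 f = (F0 (fst f), snd f)"

lemma Fib_simps:
  "z \<in> At.Fib p \<longleftrightarrow> fst z \<in> tangent Tot p \<and> snd z \<in> tangent Ob (anc p)"
  "z' \<in> Ad.Fib p \<longleftrightarrow> fst z' \<in> alg (gpd B) (anc p) \<and> snd z' \<in> tangent Ob (anc p)"
  by (auto simp: At.Fib_def Ad.Fib_def qbundle_simps mem_Times_iff)

lemma \<Phi>_linear:
  assumes p: "p \<in> pts Tot" and z: "z \<in> At.Fib p"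
  shows "\<Phi> p z \<in> Ad.Fib p" "w \<in> At.Fib p \<Longrightarrow> \<Phi> p (z + w) = \<Phi> p z + \<Phi> p w"
    "\<Phi> p (At.sc r z) = Ad.sc r (\<Phi> p z)" "w \<in> At.Fib p \<Longrightarrow> \<Phi> p (z - w) = \<Phi> p z - \<Phi> p w"
proof -
  show "\<Phi> p z \<in> Ad.Fib p"
    using z omega(1)[OF p, of "fst z"] by (simp add: Fib_simps \<Phi>_def)
  have a: "\<Phi> p (z + w) = \<Phi> p z + \<Phi> p w" if "z \<in> At.Fib p" "w \<in> At.Fib p" for z w
    using that omega(2)[OF p, of "fst z" "fst w"] by (simp add: Fib_simps \<Phi>_def plus_prod_def)
  from z show "w \<in> At.Fib p \<Longrightarrow> \<Phi> p (z + w) = \<Phi> p z + \<Phi> p w"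
    by (rule a)
  show "\<Phi> p (At.sc r z) = Ad.sc r (\<Phi> p z)"
    using z omega(3)[OF p, of "fst z"] by (simp add: Fib_simps \<Phi>_def At.sc_def Ad.sc_def)
  show "\<Phi> p (z - w) = \<Phi> p z - \<Phi> p w" if w: "w \<in> At.Fib p"
    using a[OF At.Fib_linear(4)[OF p z w] w] by simp
qed

lemma \<Phi>_zero: "p \<in> pts Tot \<Longrightarrow> \<Phi> p 0 = 0"
  using \<Phi>_linear(4)[of p 0 0] At.Fib_linear(1) by simp

lemma \<Phi>_Tr:
  assumes pg: "(p, g) \<in> act_dom B" and z: "z \<in> At.Fib p"
  shows "\<Phi> (act B p g) (At.Tr p g z) = Ad.Tr p g (\<Phi> p z)"
  using z omega_tau[OF pg, of "fst z"]
  by (simp add: Fib_simps \<Phi>_def At.Tr_def Ad.Tr_def qbundle_simps)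

lemma \<Phi>_defect:
  assumes qg: "(q, g) \<in> act_dom B" and h: "h \<in> pts Ar" "src g = tgt h" and z: "z \<in> At.Fib q"
  shows "\<Phi> (act B (act B q g) h) (At.defect q g h z) = Ad.defect q g h (\<Phi> q z)"
proof -
  note m = act_dom_mult[OF qg h]
  have e: "act B q (mul g h) = act B (act B q g) h"
    using act_laws(3)[OF qg h] by simp
  have "At.Tr q (mul g h) z \<in> At.Fib (act B (act B q g) h)"
    using At.Tr(1)[OF m(2) z] e by simp
  moreover have "At.Tr (act B q g) h (At.Tr q g z) \<in> At.Fib (act B (act B q g) h)"
    by (rule At.Tr(1)[OF m(1) At.Tr(1)[OF qg z]])
  ultimately show ?thesis
    using \<Phi>_linear(4)[OF act_laws(1)[OF m(1)]] \<Phi>_Tr[OF m(2) z] \<Phi>_Tr[OF m(1) At.Tr(1)[OF qg z]] \<Phi>_Tr[OF qg z] e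
    by (simp add: At.defect_def Ad.defect_def)
qed

lemma \<Phi>_N: "x \<in> At.N p \<Longrightarrow> p \<in> pts Tot \<Longrightarrow> \<Phi> p x \<in> Ad.N p"
proof (induction rule: At.N.induct)
  case N_zero
  then show ?case by (simp add: \<Phi>_zero Ad.N_zero)
next
  case (N_defect x q g h z)
  note h = N_defect.hyps
  have "\<Phi> p (x + At.defect q g h z) = \<Phi> p x + Ad.defect q g h (\<Phi> q z)"
    using \<Phi>_linear(2)[OF N_defect.prems At.N_Fib[OF N_defect.prems h(1)]] At.defect_Fib[OF h(2-5)]
      \<Phi>_defect[OF h(2-5)] h(6) by simp
  then show ?case
    using Ad.N_defect[OF N_defect.IH[OF N_defect.prems] h(2-4) \<Phi>_linear(1)[OF act_domD(1)[OF h(2)] h(5)] h(6)]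
    by simp
qed

lemma F0_cls:
  assumes p: "p \<in> pts Tot" and z: "z \<in> At.Fib p"
  shows "F0 (At.cls p z) = Ad.cls p (\<Phi> p z)"
proof -
  obtain w where w: "rep (At.cls p z) = (p, w)" "w \<in> At.Fib p" "z - w \<in> At.N p"
    by (rule At.rep_cls[OF p z])
  have "\<Phi> p z - \<Phi> p w \<in> Ad.N p"
    using \<Phi>_N[OF w(3) p] \<Phi>_linear(4)[OF p z w(2)] by simp
  then show ?thesis
    using w(1) Ad.cls_eqI[OF p] by (simp add: F0_def)
qed

lemma bpt_F0:
  assumes "C \<in> qobjs B H (At_q B H)"
  shows "F0 C \<in> qobjs B H (Ad_q B H)" "bpt (F0 C) = bpt C"
proof -
  obtain p z where pz: "p \<in> pts Tot" "z \<in> At.Fib p" "C = At.cls p z"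
    using assms unfolding At.qobjs_iff by blast
  show "F0 C \<in> qobjs B H (Ad_q B H)"
    unfolding Ad.qobjs_iff using pz F0_cls \<Phi>_linear(1) by blast
  show "bpt (F0 C) = bpt C"
    using pz F0_cls[OF pz(1,2)] At.bpt_cls[OF pz(1,2)] Ad.bpt_cls[OF pz(1) \<Phi>_linear(1)[OF pz(1,2)]] by simp
qed

lemma F1_arr: "f \<in> qarrs B H (At_q B H) \<Longrightarrow> F1 f \<in> qarrs B H (Ad_q B H)"
  using bpt_F0 by (auto simp: qarrs_def F1_def)

lemma is_functor_F: "is_functor (At_gpd B H) (Ad_gpd B H) F0 F1"
  unfolding is_functor_def At_gpd_def Ad_gpd_def At.qcat_simps Ad.qcat_simps
proof (intro conjI ballI impI)
  show "F0 ` qobjs B H (At_q B H) \<subseteq> qobjs B H (Ad_q B H)"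
    using bpt_F0 by blast
  show "F1 ` qarrs B H (At_q B H) \<subseteq> qarrs B H (Ad_q B H)"
    using F1_arr by blast
  show "F1 (C, unit (anc (bpt C))) = (F0 C, unit (anc (bpt (F0 C))))" if "C \<in> qobjs B H (At_q B H)" for C
    using bpt_F0(2)[OF that] by (simp add: F1_def)
  fix f assume f: "f \<in> qarrs B H (At_q B H)"
  show "fst (F1 f) = F0 (fst f)"
    by (simp add: F1_def)
  obtain C g where Cg: "f = (C, g)" by (cases f)
  then obtain p z where pz: "(p, g) \<in> act_dom B" "z \<in> At.Fib p" "C = At.cls p z"
    using f At.qarrs_iff by blast
  note p = act_domD(1)[OF pz(1)]
  show "qcod B H (Ad_q B H) (F1 f) = F0 (qcod B H (At_q B H) f)"
    using F0_cls[OF p pz(2)] Ad.qcod_cls[OF pz(1) \<Phi>_linear(1)[OF p pz(2)]] At.qcod_cls[OF pz(1,2)]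
      F0_cls[OF act_laws(1)[OF pz(1)] At.Tr(1)[OF pz(1,2)]] \<Phi>_Tr[OF pz(1,2)]
    by (simp add: Cg F1_def pz(3))
next
  fix f f'
  show "F1 (fst f, mul (snd f) (snd f')) = (fst (F1 f), mul (snd (F1 f)) (snd (F1 f')))"
    by (simp add: F1_def)
qed

text \<open>A plot of the quotient lifts locally to the total space, where \<open>F0\<close> is the smooth map
  \<open>\<omega>\<close> on the tangent bundle of the total space.\<close>

lemma F0_plot:
  assumes "quot_plot (qtot_plot B (At_q B H)) (qcls B H (At_q B H)) n U \<phi>"
  shows "quot_plot (qtot_plot B (Ad_q B H)) (qcls B H (Ad_q B H)) n U (\<lambda>x. F0 (\<phi> x))"
  unfolding quot_plot_def
proof (intro conjI ballI)
  show "openin (Euclidean_space n) U"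
    using assms by (simp add: quot_plot_def)
  fix x assume x: "x \<in> U"
  then obtain V k where V: "x \<in> V" "V \<subseteq> U" and k: "qtot_plot B (At_q B H) n V k"
    and \<phi>: "\<forall>y\<in>V. \<phi> y = qcls B H (At_q B H) (k y)"
    using assms unfolding quot_plot_def by meson
  define k' where "k' = (\<lambda>y. (fst (k y), \<Phi> (fst (k y)) (snd (k y))))"
  have kF: "fst (k y) \<in> pts Tot" "snd (k y) \<in> At.Fib (fst (k y))" if "y \<in> V" for y
    using k that At.qtot_iff[of "fst (k y)" "snd (k y)"] unfolding qtot_plot_def by auto
  have pl: "mfd_plot Tot n V (\<lambda>x. fst (k x))"
    "mfd_plot (tangent_bundle Tot) n V (\<lambda>x. (fst (k x), fst (snd (k x))))"
    "mfd_plot (tangent_bundle Ob) n V (\<lambda>x. (anc (fst (k x)), snd (snd (k x))))"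
    using k by (simp_all add: qtot_plot_def qbundle_simps)
  have TP: "(\<lambda>x. (fst (k x), fst (snd (k x)))) ` V \<subseteq> pts (tangent_bundle Tot)"
    using mfd_plotD(2)[OF pl(2)] by blast
  have "mfd_plot (tangent_bundle Ar) n V ((\<lambda>(p, u). (unit (anc p), \<omega> p u)) \<circ> (\<lambda>x. (fst (k x), fst (snd (k x)))))"
    by (rule mfd_plot_comp[OF tangent_bundle_charted[OF atlases(3)] pl(2) connection_parts(5) TP])
  moreover have "k' ` V \<subseteq> qtot B (Ad_q B H)"
  proof (rule image_subsetI)
    fix y assume "y \<in> V"
    then show "k' y \<in> qtot B (Ad_q B H)"
      unfolding k'_def Ad.qtot_iff using kF \<Phi>_linear(1) by blast
  qed
  ultimately have "qtot_plot B (Ad_q B H) n V k'"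
    using pl by (simp add: qtot_plot_def k'_def qbundle_simps \<Phi>_def o_def)
  moreover have "F0 (\<phi> y) = qcls B H (Ad_q B H) (k' y)" if "y \<in> V" for y
    using \<phi> that F0_cls[OF kF[OF that]] by (simp add: k'_def)
  ultimately show "\<exists>V g. x \<in> V \<and> V \<subseteq> U \<and> qtot_plot B (Ad_q B H) n V g \<and> (\<forall>y\<in>V. F0 (\<phi> y) = qcls B H (Ad_q B H) (g y))"
    using V by blast
qed

lemma F0_dsmooth: "dsmooth (ObjD (qcat B H (At_q B H))) (ObjD (qcat B H (Ad_q B H))) F0"
  using F0_plot by (simp add: dsmooth_def At.qcat_simps Ad.qcat_simps o_def)

lemma F1_dsmooth: "dsmooth (ArrD (qcat B H (At_q B H))) (ArrD (qcat B H (Ad_q B H))) F1"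
proof -
  have "fst (F1 f) = F0 (fst f)" "snd (F1 f) = snd f" for f
    by (simp_all add: F1_def)
  then show ?thesis
    unfolding dsmooth_def At.qcat_simps Ad.qcat_simps o_def image_subset_iff
    using F0_plot F1_arr by simp
qed

lemma ddelta_cls:
  assumes p: "p \<in> pts Tot" and z: "z \<in> Ad.Fib p"
  shows "F0 (ddelta_obj B H (Ad.cls p z)) = Ad.cls p z"
proof -
  obtain w where w: "rep (Ad.cls p z) = (p, w)" "w \<in> Ad.Fib p" "z - w \<in> Ad.N p"
    by (rule Ad.rep_cls[OF p z])
  have d: "ddelta_obj B H (Ad.cls p z) = At.cls p (ddelta B p (fst w), snd w)"
    using w(1) by (cases w) (simp add: ddelta_obj_def)
  have F: "(ddelta B p (fst w), snd w) \<in> At.Fib p"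
    using w(2) ddelta_closed[OF p] by (simp add: Fib_simps)
  have "\<Phi> p (ddelta B p (fst w), snd w) = w"
    using w(2) omega_ddelta[OF p, of "fst w"] by (simp add: Fib_simps \<Phi>_def)
  then show ?thesis
    using F0_cls[OF p F] Ad.cls_eqI[OF p w(3)] d by simp
qed

lemma F_splits:
  "C \<in> qobjs B H (Ad_q B H) \<Longrightarrow> F0 (ddelta_obj B H C) = C"
  "f \<in> qarrs B H (Ad_q B H) \<Longrightarrow> F1 (ddelta_arr B H f) = f"
proof -
  show 1: "F0 (ddelta_obj B H C) = C" if "C \<in> qobjs B H (Ad_q B H)" for C
    using that ddelta_cls unfolding Ad.qobjs_iff by blast
  show "F1 (ddelta_arr B H f) = f" if "f \<in> qarrs B H (Ad_q B H)"
    using that 1 by (cases f) (simp add: F1_def ddelta_arr_def qarrs_def)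
qed

lemma F0_graded: "graded_bundle_map B H (At_q B H) (Ad_q B H) F0"
  unfolding graded_bundle_map_def
proof (intro conjI ballI allI impI)
  show "dsmooth (ObjD (qcat B H (At_q B H))) (ObjD (qcat B H (Ad_q B H))) F0"
    by (rule F0_dsmooth)
  fix C assume C: "C \<in> qobjs B H (At_q B H)"
  show "F0 C \<in> qobjs B H (Ad_q B H)" "bpt (F0 C) = bpt C"
    using bpt_F0[OF C] by auto
  obtain p z where pz: "p \<in> pts Tot" "z \<in> At.Fib p" "C = At.cls p z"
    using C unfolding At.qobjs_iff by blast
  note \<Phi>z = \<Phi>_linear(1)[OF pz(1,2)]
  show "F0 (qscale B H (At_q B H) r C) = qscale B H (Ad_q B H) r (F0 C)" for r
    by (simp add: pz(3) At.qscale_cls[OF pz(1,2)] F0_cls[OF pz(1,2)] Ad.qscale_cls[OF pz(1) \<Phi>z]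
        F0_cls[OF pz(1) At.Fib_linear(3)[OF pz(1,2)]] \<Phi>_linear(3)[OF pz(1,2)])
  fix C' assume C': "C' \<in> qobjs B H (At_q B H)" and b: "bpt C = bpt C'"
  obtain z' where z': "z' \<in> At.Fib p" "C' = At.cls p z'"
    using C' b pz At.bpt_cls unfolding At.qobjs_iff by metis
  show "F0 (qadd B H (At_q B H) C C') = qadd B H (Ad_q B H) (F0 C) (F0 C')"
    by (simp add: pz(3) z'(2) At.qadd_cls[OF pz(1,2) z'(1)] F0_cls[OF pz(1,2)] F0_cls[OF pz(1) z'(1)]
        Ad.qadd_cls[OF pz(1) \<Phi>z \<Phi>_linear(1)[OF pz(1) z'(1)]]
        F0_cls[OF pz(1) At.Fib_linear(2)[OF pz(1,2) z'(1)]] \<Phi>_linear(2)[OF pz(1,2) z'(1)])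
next
  fix p assume p: "p \<in> pts Tot"
  show "F0 ` qgrade_fst B H (At_q B H) p \<subseteq> qgrade_fst B H (Ad_q B H) p"
  proof (rule image_subsetI)
    fix C assume "C \<in> qgrade_fst B H (At_q B H) p"
    then obtain u where u: "u \<in> tangent Tot p" "C = At.cls p (u, 0)"
      by (auto simp: qgrade_fst_def qbundle_simps)
    then have "F0 C = Ad.cls p (\<omega> p u, 0)"
      using F0_cls[OF p, of "(u, 0)"] by (simp add: Fib_simps \<Phi>_def tangent_zero)
    then show "F0 C \<in> qgrade_fst B H (Ad_q B H) p"
      using omega(1)[OF p u(1)] by (auto simp: qgrade_fst_def qbundle_simps)
  qed
  show "F0 ` qgrade_snd B H (At_q B H) p \<subseteq> qgrade_snd B H (Ad_q B H) p"
  proof (rule image_subsetI)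
    fix C assume "C \<in> qgrade_snd B H (At_q B H) p"
    then obtain v where v: "v \<in> tangent Ob (anc p)" "C = At.cls p (0, v)"
      by (auto simp: qgrade_snd_def)
    have "\<omega> p 0 = 0"
      using \<Phi>_zero[OF p] by (simp add: \<Phi>_def zero_prod_def)
    then have "F0 C = Ad.cls p (0, v)"
      using F0_cls[OF p, of "(0, v)"] v by (simp add: Fib_simps \<Phi>_def tangent_zero)
    then show "F0 C \<in> qgrade_snd B H (Ad_q B H) p"
      using v(1) unfolding qgrade_snd_def by blast
  qed
qed

lemma induced_isoclass:
  assumes p: "p \<in> pts Tot" and z: "z \<in> At.Fib p"
  shows "induced B H (Ad_q B H) F0 (At.iso_cls p z) = Ad.iso_cls p (\<Phi> p z)"
proof -
  obtain g where g: "(p, g) \<in> act_dom B" "(SOME C. C \<in> At.iso_cls p z) = At.cls (act B p g) (At.Tr p g z)"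
    by (rule At.some_isoclass[OF p z])
  show ?thesis
    unfolding induced_def g(2) F0_cls[OF act_laws(1)[OF g(1)] At.Tr(1)[OF g(1) z]] \<Phi>_Tr[OF g(1) z]
    by (rule Ad.isoclass_Tr[OF g(1) \<Phi>_linear(1)[OF p z]])
qed

lemma induced_linear: "conn_linear B H (At_q B H) (Ad_q B H) m (induced B H (Ad_q B H) F0)"
  unfolding conn_linear_def
proof (intro conjI ballI allI image_subsetI)
  fix K assume "K \<in> qconn B H (At_q B H) m"
  then obtain p z where p: "p \<in> pts Tot" "z \<in> At.Fib p" "proj B p = m" "K = At.iso_cls p z"
    unfolding At.qconn_iff by blast
  note TK = induced_isoclass[OF p(1,2)] and \<Phi>z = \<Phi>_linear(1)[OF p(1,2)]
  show "induced B H (Ad_q B H) F0 K \<in> qconn B H (Ad_q B H) m"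
    unfolding Ad.qconn_iff p(4) TK using p \<Phi>z by blast
  show "induced B H (Ad_q B H) F0 (conn_scale B H (At_q B H) r K) =
      conn_scale B H (Ad_q B H) r (induced B H (Ad_q B H) F0 K)" for r
    unfolding p(4) TK At.conn_scale_isoclass[OF p(1,2)] Ad.conn_scale_isoclass[OF p(1) \<Phi>z]
      induced_isoclass[OF p(1) At.Fib_linear(3)[OF p(1,2)]] \<Phi>_linear(3)[OF p(1,2)] ..
  fix L assume "L \<in> qconn B H (At_q B H) m"
  then obtain q w where q: "q \<in> pts Tot" "w \<in> At.Fib q" "proj B q = m" "L = At.iso_cls q w"
    unfolding At.qconn_iff by blast
  obtain k where k: "(p, k) \<in> act_dom B" "act B p k = q"
    using act_transitive[OF p(1) q(1)] p(3) q(3) by metis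
  have w: "w \<in> At.Fib (act B p k)" using q k by simp
  note kz = At.Tr(1)[OF k(1) p(2)]
  note q' = act_laws(1)[OF k(1)]
  show "induced B H (Ad_q B H) F0 (conn_add B H (At_q B H) K L) =
      conn_add B H (Ad_q B H) (induced B H (Ad_q B H) F0 K) (induced B H (Ad_q B H) F0 L)"
    unfolding p(4) q(4) k(2)[symmetric] TK induced_isoclass[OF q' w]
      At.conn_add_isoclass[OF k(1) p(2) w] Ad.conn_add_isoclass[OF k(1) \<Phi>z \<Phi>_linear(1)[OF q' w]]
      induced_isoclass[OF q' At.Fib_linear(2)[OF q' kz w]] \<Phi>_linear(2)[OF q' kz w] \<Phi>_Tr[OF k(1) p(2)] ..
qed

lemma quasi_connection_F: "quasi_connection B H F0 F1"
  unfolding quasi_connection_def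
proof (intro conjI ballI)
  show "is_functor (At_gpd B H) (Ad_gpd B H) F0 F1" by (rule is_functor_F)
  show "graded_bundle_map B H (At_q B H) (Ad_q B H) F0" by (rule F0_graded)
  show "conn_linear B H (At_q B H) (Ad_q B H) m (induced B H (Ad_q B H) F0)" for m by (rule induced_linear)
  show "proj B (bpt (F0 C)) = proj B (bpt C)" if "C \<in> Obj (At_gpd B H)" for C
    using that bpt_F0(2) by (simp add: At_gpd_def At.qcat_simps)
  show "proj B (bpt (fst (F1 f))) = proj B (bpt (fst f))" if "f \<in> Arr (At_gpd B H)" for f
    using that bpt_F0(2) by (cases f) (simp add: At_gpd_def At.qcat_simps F1_def qarrs_def)
  show "F0 (ddelta_obj B H C) = C" if "C \<in> Obj (Ad_gpd B H)" for C
    using that F_splits(1) by (simp add: Ad_gpd_def Ad.qcat_simps)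
  show "F1 (ddelta_arr B H f) = f" if "f \<in> Arr (Ad_gpd B H)" for f
    using that F_splits(2) by (simp add: Ad_gpd_def Ad.qcat_simps)
qed

lemma F_formula:
  assumes "(p, u, v) \<in> qtot B (At_q B H)"
  shows "F0 (qcls B H (At_q B H) (p, u, v)) = qcls B H (Ad_q B H) (p, \<omega> p u, v)"
    "F1 (qcls B H (At_q B H) (p, u, v), g) = (qcls B H (Ad_q B H) (p, \<omega> p u, v), g)"
  using F0_cls[of p "(u, v)"] assms At.qtot_iff[of p "(u, v)"] by (simp_all add: \<Phi>_def F1_def)

end

theorem mainTheorem6:
  fixes B :: "('a, 'b, 'p, 'm) pbundle"
    and \<omega> :: "'p \<Rightarrow> 'p tvec \<Rightarrow> 'b tvec"
    and H :: "'b \<Rightarrow> 'b tvec set"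
  assumes "lie_groupoid (gpd B)"
    and "principal_bundle B"
    and "connection_pair B \<omega> H"
  shows "\<exists>F0 F1.
    (\<forall>p u v. (p, u, v) \<in> qtot B (At_q B H) \<longrightarrow>
       F0 (qcls B H (At_q B H) (p, u, v)) = qcls B H (Ad_q B H) (p, \<omega> p u, v)) \<and>
    (\<forall>p u v g. (p, u, v) \<in> qtot B (At_q B H) \<and> (p, g) \<in> act_dom B \<longrightarrow>
       F1 (qcls B H (At_q B H) (p, u, v), g) = (qcls B H (Ad_q B H) (p, \<omega> p u, v), g)) \<and>
    smooth_functor (At_gpd B H) (Ad_gpd B H) F0 F1 \<and>
    quasi_connection B H F0 F1"
proof -
  interpret bundle_with_connection B \<omega> H
    using assms by unfold_locales
  interpret connection_functor B \<omega> H
    using At_quasi_action Ad_quasi_action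
    by (simp add: connection_functor_def bundle_with_connection_axioms)
  have "smooth_functor (At_gpd B H) (Ad_gpd B H) F0 F1"
    unfolding smooth_functor_def using is_functor_F F0_dsmooth F1_dsmooth
    by (simp add: At_gpd_def Ad_gpd_def)
  then show ?thesis
    using F_formula quasi_connection_F by (intro exI[of _ F0] exI[of _ F1]) blast
qed

end
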